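(* Let $M$ be a manifold of real dimension $2n$. A generalized complex structure $\mathcal J$ on $E=T\oplus T^*$ gives rise to a $\mathbb Z$-grading $$\wedge^\bullet T^*\otimes\mathbb C=U^{-n}\oplus\cdots\oplus U^{n},$$ where $U^k$ is the $ik$-eigenbundle of $\mathcal J$ acting in the spin representation, and $U^n=K$ is the canonical line bundle of $\mathcal J$.
   Context: Let $T=TM$, with inner product $\langle X+\xi,Y+\eta\rangle=\tfrac12(\xi(Y)+\eta(X))$ on $T\oplus T^*$ and, for a real closed 3-form $H$, bracket $[X+\xi,Y+\eta]_H=[X,Y]+\mathcal L_X\eta-i_Yd\xi+i_Xi_YH$. A generalized complex structure on $(T\oplus T^*,[\cdot,\cdot]_H)$ is an endomorphism $\mathcal J$ of $T\oplus T^*$ with $\mathcal J^2=-1$ whose $+i$-eigenbundle $L\subset(T\oplus T^* )\otimes\mathbb C$ is involutive for the bracket; it is then orthogonal, i.e. $\mathcal J$ is a section of $\mathfrak{so}(T\oplus T^* )$. The Clifford algebra of $T\oplus T^*$ (relation $v^2=\langle v,v\rangle$) acts on $\wedge^\bullet T^*$ by $(X+\xi)\cdot\varphi=i_X\varphi+\xi\wedge\varphi$. The Lie algebra $\mathfrak{so}(T\oplus T^* )\cong\wedge^2(T\oplus T^* )$ sits inside the Clifford algebra so that $x\in\mathfrak{so}(T\oplus T^* )$ acts on $v\in T\oplus T^*$ by $v\mapsto xv-vx$; its action on $\wedge^\bullet T^*$ through the Clifford action is the spin representation. Explicitly, an element with components $A\in\mathrm{End}(T)$, $B\in\wedge^2T^*$,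 $\beta\in\wedge^2T$ acts on forms by $\varphi\mapsto -A^*\varphi+\tfrac12\mathrm{Tr}(A)\varphi-B\wedge\varphi+i_\beta\varphi$, where $A^*$ acts as a derivation and, for $\beta=\tfrac12\beta^{ij}e_i\wedge e_j$, $i_\beta\varphi=\tfrac12\beta^{ij}i_{e_j}i_{e_i}\varphi$. The canonical line bundle $K\subset\wedge^\bullet T^*\otimes\mathbb C$ of $\mathcal J$ is the complex line subbundle of forms annihilated by the Clifford action of all of $L$. *)

theory Defs
  imports "HOL-Analysis.Analysis"
begin

section \<open>Smooth maps and smooth manifolds\<close>

primrec Ck_on :: "nat \<Rightarrow> 'b::real_normed_vector set \<Rightarrow> ('b \<Rightarrow> 'c::real_normed_vector) \<Rightarrow> bool" where
  "Ck_on 0 S f \<longleftrightarrow> continuous_on S f"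
| "Ck_on (Suc k) S f \<longleftrightarrow> (\<forall>x\<in>S. f differentiable (at x)) \<and>
     (\<forall>v. Ck_on k S (\<lambda>x. frechet_derivative f (at x) v))"

text \<open>Used only for open \<open>S\<close> and finite-dimensional domain.\<close>

definition smooth_on :: "'b::real_normed_vector set \<Rightarrow> ('b \<Rightarrow> 'c::real_normed_vector) \<Rightarrow> bool" where
  "smooth_on S f \<longleftrightarrow> (\<forall>k. Ck_on k S f)"

definition pderivative :: "'m::finite \<Rightarrow> (real^'m \<Rightarrow> 'c::real_normed_vector) \<Rightarrow> real^'m \<Rightarrow> 'c" where
  "pderivative i f x = frechet_derivative f (at x) (axis i 1)"

text \<open>A chart is a pair of a domain and a coordinate map; the map is relevant on the domain only.\<close>

type_synonym ('a, 'm) chart = "'a set \<times> ('a \<Rightarrow> real^'m)"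

definition chart_inv :: "('a, 'm::finite) chart \<Rightarrow> real^'m \<Rightarrow> 'a" where
  "chart_inv c = inv_into (fst c) (snd c)"

text \<open>The points of the manifold are all the elements of the type \<open>'a\<close>; its dimension is
  \<open>CARD('m)\<close>. The atlas need not be maximal.\<close>

definition smooth_atlas ::
  "('a::{t2_space, second_countable_topology}, 'm::finite) chart set \<Rightarrow> bool" where
  "smooth_atlas \<A> \<longleftrightarrow>
     (\<Union>c\<in>\<A>. fst c) = UNIV \<and>
     (\<forall>c\<in>\<A>. open (fst c) \<and> open (snd c ` fst c) \<and>
        homeomorphism (fst c) (snd c ` fst c) (snd c) (chart_inv c)) \<and>
     (\<forall>c\<in>\<A>. \<forall>d\<in>\<A>. smooth_on (snd c ` (fst c \<inter> fst d)) (snd d \<circ> chart_inv c))"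

text \<open>
  The tangent space at a point \<open>p\<close> is \<open>real^'m\<close>: a tangent vector is given by its components in
  one fixed chart around \<open>p\<close>, the preferred chart \<open>chart_at \<A> p\<close>. Its components in another
  chart are obtained by the Jacobian matrix of the change of coordinates. No relation is assumed
  between the preferred charts of different points, so smoothness and derivatives of sections
  always refer to their components in one chart (\<open>sect_in_chart\<close>, \<open>form_in_chart\<close>). A covector is
  given by its components in the dual basis, with the pairing of \<open>\<xi>\<close> and \<open>X\<close> the sum over
  \<open>i\<close> of \<open>\<xi> $ i * X $ i\<close>. A section of \<open>T \<oplus> T*\<close> is hence a function into \<open>('k, 'm) TT\<close>, with
  \<open>'k = real\<close>, or \<open>'k = complex\<close> for the complexification.
\<close>

type_synonym ('k, 'm) TT = "('k^'m) \<times> ('k^'m)"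

definition chart_at :: "('a, 'm::finite) chart set \<Rightarrow> 'a \<Rightarrow> ('a, 'm) chart" where
  "chart_at \<A> p = (SOME c. c \<in> \<A> \<and> p \<in> fst c)"

text \<open>\<open>jacobian c d p $ i $ j\<close> is the derivative at \<open>p\<close> of the \<open>i\<close>-th coordinate of \<open>d\<close> by the
  \<open>j\<close>-th coordinate of \<open>c\<close>.\<close>

definition jacobian :: "('a, 'm::finite) chart \<Rightarrow> ('a, 'm) chart \<Rightarrow> 'a \<Rightarrow> real^'m^'m" where
  "jacobian c d p = matrix (frechet_derivative (snd d \<circ> chart_inv c) (at (snd c p)))"

definition sect_in_chart ::
  "('a, 'm::finite) chart set \<Rightarrow> ('a, 'm) chart \<Rightarrow> ('a \<Rightarrow> ('k::real_normed_field, 'm) TT) \<Rightarrow>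
   real^'m \<Rightarrow> ('k, 'm) TT" where
  "sect_in_chart \<A> c s x =
     (let p = chart_inv c x; c0 = chart_at \<A> p in
       (\<chi> i. \<Sum>j\<in>UNIV. of_real (jacobian c0 c p $ i $ j) * fst (s p) $ j,
        \<chi> i. \<Sum>j\<in>UNIV. of_real (jacobian c c0 p $ j $ i) * snd (s p) $ j))"

definition smooth_sect ::
  "('a, 'm::finite) chart set \<Rightarrow> 'a set \<Rightarrow> ('a \<Rightarrow> ('k::real_normed_field, 'm) TT) \<Rightarrow> bool" where
  "smooth_sect \<A> U s \<longleftrightarrow> (\<forall>c\<in>\<A>. smooth_on (snd c ` (fst c \<inter> U)) (sect_in_chart \<A> c s))"

section \<open>Exterior forms\<close>

text \<open>An element of the full exterior algebra of the cotangent space is encoded as a function on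
  lists of tangent vectors: its value on the lists of length \<open>k\<close> is its component of degree \<open>k\<close>,
  an alternating multilinear function of \<open>k\<close> vectors.\<close>

type_synonym ('m, 'k) form = "(real^'m) list \<Rightarrow> 'k"

definition is_form :: "('m::finite, 'k::real_vector) form \<Rightarrow> bool" where
  "is_form \<phi> \<longleftrightarrow> (\<forall>us ws. linear (\<lambda>v. \<phi> (us @ v # ws))) \<and> (\<forall>vs. \<not> distinct vs \<longrightarrow> \<phi> vs = 0)"

definition has_degree :: "nat \<Rightarrow> ('m::finite, 'k::real_vector) form \<Rightarrow> bool" where
  "has_degree k \<phi> \<longleftrightarrow> (\<forall>vs. length vs \<noteq> k \<longrightarrow> \<phi> vs = 0)"

definition omit_nth :: "nat \<Rightarrow> 'b list \<Rightarrow> 'b list" where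
  "omit_nth i vs = take i vs @ drop (Suc i) vs"

definition form_in_chart ::
  "('a, 'm::finite) chart set \<Rightarrow> ('a, 'm) chart \<Rightarrow> ('a \<Rightarrow> ('m, 'k::real_normed_vector) form) \<Rightarrow>
   real^'m \<Rightarrow> ('m, 'k) form" where
  "form_in_chart \<A> c \<omega> x vs =
     (let p = chart_inv c x in \<omega> p (map (\<lambda>v. jacobian c (chart_at \<A> p) p *v v) vs))"

definition smooth_form ::
  "('a, 'm::finite) chart set \<Rightarrow> 'a set \<Rightarrow> ('a \<Rightarrow> ('m, 'k::real_normed_vector) form) \<Rightarrow> bool" where
  "smooth_form \<A> U \<omega> \<longleftrightarrow>
     (\<forall>c\<in>\<A>. \<forall>vs. smooth_on (snd c ` (fst c \<inter> U)) (\<lambda>x. form_in_chart \<A> c \<omega> x vs))"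

text \<open>The Lie bracket terms of the invariant formula are absent because the vectors are extended
  to vector fields with constant components in the chart.\<close>

definition ext_deriv ::
  "('a, 'm::finite) chart set \<Rightarrow> ('a \<Rightarrow> ('m, 'k::real_normed_field) form) \<Rightarrow> 'a \<Rightarrow> ('m, 'k) form" where
  "ext_deriv \<A> \<omega> p vs =
     (let c = chart_at \<A> p in
       \<Sum>i<length vs. (-1) ^ i *
         frechet_derivative (\<lambda>x. form_in_chart \<A> c \<omega> x (omit_nth i vs)) (at (snd c p)) (vs ! i))"

definition closed_real_3form ::
  "('a, 'm::finite) chart set \<Rightarrow> ('a \<Rightarrow> ('m, real) form) \<Rightarrow> bool" where
  "closed_real_3form \<A> H \<longleftrightarrow>
     (\<forall>p. is_form (H p) \<and> has_degree 3 (H p)) \<and> smooth_form \<A> UNIV H \<and>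
     (\<forall>p vs. ext_deriv \<A> H p vs = 0)"

section \<open>Generalized complex structures\<close>

text \<open>The bracket of \<open>s = X + \<xi>\<close> and \<open>t = Y + \<eta>\<close>, namely
  \<open>[X,Y] + L\<^sub>X \<eta> - i\<^sub>Y d\<xi> + i\<^sub>X i\<^sub>Y H\<close>, is written in the coordinates of the preferred chart at
  \<open>p\<close>, so that its value at \<open>p\<close> needs no change of coordinates. It is extended
  bilinearly to complex sections.\<close>

definition courant_bracket ::
  "('a, 'm::finite) chart set \<Rightarrow> ('a \<Rightarrow> ('m, real) form) \<Rightarrow>
   ('a \<Rightarrow> ('k::real_normed_field, 'm) TT) \<Rightarrow> ('a \<Rightarrow> ('k, 'm) TT) \<Rightarrow> 'a \<Rightarrow> ('k, 'm) TT" where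
  "courant_bracket \<A> H s t p =
     (let c = chart_at \<A> p; x = snd c p;
          X = (\<lambda>i y. fst (sect_in_chart \<A> c s y) $ i); \<xi> = (\<lambda>i y. snd (sect_in_chart \<A> c s y) $ i);
          Y = (\<lambda>i y. fst (sect_in_chart \<A> c t y) $ i); \<eta> = (\<lambda>i y. snd (sect_in_chart \<A> c t y) $ i)
      in
       (\<chi> k. \<Sum>i\<in>UNIV. X i x * pderivative i (Y k) x - Y i x * pderivative i (X k) x,
        \<chi> k. (\<Sum>i\<in>UNIV. X i x * pderivative i (\<eta> k) x + \<eta> i x * pderivative k (X i) x)
            - (\<Sum>i\<in>UNIV. Y i x * (pderivative i (\<xi> k) x - pderivative k (\<xi> i) x))
            + (\<Sum>i\<in>UNIV. \<Sum>j\<in>UNIV.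
                 Y i x * X j x * of_real (H p [axis i 1, axis j 1, axis k 1]))))"

definition complexify ::
  "((real, 'm) TT \<Rightarrow> (real, 'm) TT) \<Rightarrow> (complex, 'm::finite) TT \<Rightarrow> (complex, 'm) TT" where
  "complexify F v =
     (let a = F (\<chi> i. Re (fst v $ i), \<chi> i. Re (snd v $ i));
          b = F (\<chi> i. Im (fst v $ i), \<chi> i. Im (snd v $ i))
      in (\<chi> i. Complex (fst a $ i) (fst b $ i), \<chi> i. Complex (snd a $ i) (snd b $ i)))"

text \<open>The fibre of the eigenbundle of \<open>J\<close> for \<open>\<i>\<close>.\<close>

definition gcs_L ::
  "('a \<Rightarrow> (real, 'm) TT \<Rightarrow> (real, 'm) TT) \<Rightarrow> 'a \<Rightarrow> (complex, 'm::finite) TT set" where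
  "gcs_L J p = {v. complexify (J p) v = (\<i> *s fst v, \<i> *s snd v)}"

definition smooth_endomorphism ::
  "('a::topological_space, 'm::finite) chart set \<Rightarrow>
   ('a \<Rightarrow> (real, 'm) TT \<Rightarrow> (real, 'm) TT) \<Rightarrow> bool" where
  "smooth_endomorphism \<A> J \<longleftrightarrow> (\<forall>p. linear (J p)) \<and>
     (\<forall>U s. open U \<longrightarrow> smooth_sect \<A> U s \<longrightarrow> smooth_sect \<A> U (\<lambda>p. J p (s p)))"

definition involutive ::
  "('a::topological_space, 'm::finite) chart set \<Rightarrow> ('a \<Rightarrow> ('m, real) form) \<Rightarrow>
   ('a \<Rightarrow> (complex, 'm) TT set) \<Rightarrow> bool" where
  "involutive \<A> H L \<longleftrightarrow>
     (\<forall>U s t. open U \<longrightarrow> smooth_sect \<A> U s \<longrightarrow> smooth_sect \<A> U t \<longrightarrow>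
        (\<forall>p\<in>U. s p \<in> L p) \<longrightarrow> (\<forall>p\<in>U. t p \<in> L p) \<longrightarrow>
        (\<forall>p\<in>U. courant_bracket \<A> H s t p \<in> L p))"

definition generalized_complex_structure ::
  "('a::topological_space, 'm::finite) chart set \<Rightarrow> ('a \<Rightarrow> ('m, real) form) \<Rightarrow>
   ('a \<Rightarrow> (real, 'm) TT \<Rightarrow> (real, 'm) TT) \<Rightarrow> bool" where
  "generalized_complex_structure \<A> H J \<longleftrightarrow>
     smooth_endomorphism \<A> J \<and> (\<forall>p v. J p (J p v) = - v) \<and> involutive \<A> H (gcs_L J)"

section \<open>Clifford action and spin representation on complex forms\<close>

definition contract :: "complex^'m \<Rightarrow> ('m::finite, complex) form \<Rightarrow> ('m, complex) form" where
  "contract X \<phi> vs = (\<Sum>i\<in>UNIV. X $ i * \<phi> (axis i 1 # vs))"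

definition wedge1 :: "complex^'m \<Rightarrow> ('m::finite, complex) form \<Rightarrow> ('m, complex) form" where
  "wedge1 \<xi> \<phi> vs =
     (\<Sum>i<length vs. (-1) ^ i * (\<Sum>k\<in>UNIV. \<xi> $ k * of_real (vs ! i $ k)) * \<phi> (omit_nth i vs))"

definition clifford ::
  "(complex, 'm) TT \<Rightarrow> ('m::finite, complex) form \<Rightarrow> ('m, complex) form" where
  "clifford v \<phi> vs = contract (fst v) \<phi> vs + wedge1 (snd v) \<phi> vs"

text \<open>The components of an element \<open>F\<close> of \<open>so(T \<oplus> T*)\<close> are given by
  \<open>F X = A X + i\<^sub>X B\<close> for vectors \<open>X\<close> and \<open>F \<xi> = i\<^sub>\<xi> \<beta> - A* \<xi>\<close> for covectors \<open>\<xi>\<close>.\<close>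

definition compA :: "((real, 'm) TT \<Rightarrow> (real, 'm) TT) \<Rightarrow> real^'m::finite \<Rightarrow> real^'m" where
  "compA F X = fst (F (X, 0))"

definition compB :: "((real, 'm) TT \<Rightarrow> (real, 'm) TT) \<Rightarrow> 'm::finite \<Rightarrow> 'm \<Rightarrow> real" where
  "compB F i j = snd (F (axis i 1, 0)) $ j"

definition comp_beta :: "((real, 'm) TT \<Rightarrow> (real, 'm) TT) \<Rightarrow> 'm::finite \<Rightarrow> 'm \<Rightarrow> real" where
  "comp_beta F i j = fst (F (0, axis i 1)) $ j"

text \<open>The four terms are \<open>- A* \<phi>\<close>, with \<open>A*\<close> acting as a derivation, \<open>1/2 Tr(A) \<phi>\<close>,
  \<open>- B \<and> \<phi>\<close> with \<open>B = 1/2 B\<^sub>i\<^sub>j e\<^sup>i \<and> e\<^sup>j\<close>, and \<open>i\<^sub>\<beta> \<phi>\<close>. The formula is the spin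
  representation for \<open>F\<close> in \<open>so(T \<oplus> T*)\<close> only, i.e. \<open>F\<close> skew for the inner product; for a
  generalized complex structure this follows from involutivity.\<close>

definition spin ::
  "((real, 'm) TT \<Rightarrow> (real, 'm) TT) \<Rightarrow> ('m::finite, complex) form \<Rightarrow> ('m, complex) form" where
  "spin F \<phi> vs =
     - (\<Sum>i<length vs. \<phi> (vs[i := compA F (vs ! i)]))
     + 1/2 * of_real (\<Sum>i\<in>UNIV. compA F (axis i 1) $ i) * \<phi> vs
     - 1/2 * (\<Sum>i\<in>UNIV. \<Sum>j\<in>UNIV.
          of_real (compB F i j) * wedge1 (axis i 1) (wedge1 (axis j 1) \<phi>) vs)
     + 1/2 * (\<Sum>i\<in>UNIV. \<Sum>j\<in>UNIV.
          of_real (comp_beta F i j) * contract (axis j 1) (contract (axis i 1) \<phi>) vs)"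

definition spin_eigenbundle ::
  "('a \<Rightarrow> (real, 'm) TT \<Rightarrow> (real, 'm) TT) \<Rightarrow> int \<Rightarrow> 'a \<Rightarrow> ('m::finite, complex) form set" where
  "spin_eigenbundle J k p = {\<phi>. is_form \<phi> \<and> (\<forall>vs. spin (J p) \<phi> vs = \<i> * of_int k * \<phi> vs)}"

definition canonical_bundle ::
  "('a \<Rightarrow> (real, 'm) TT \<Rightarrow> (real, 'm) TT) \<Rightarrow> 'a \<Rightarrow> ('m::finite, complex) form set" where
  "canonical_bundle J p = {\<phi>. is_form \<phi> \<and> (\<forall>v\<in>gcs_L J p. \<forall>vs. clifford v \<phi> vs = 0)}"

section \<open>Subbundles and gradings of the bundle of complex forms\<close>

definition complex_subspace :: "('b \<Rightarrow> complex) set \<Rightarrow> bool" where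
  "complex_subspace W \<longleftrightarrow> (\<lambda>_. 0) \<in> W \<and>
     (\<forall>\<phi>\<in>W. \<forall>\<psi>\<in>W. (\<lambda>b. \<phi> b + \<psi> b) \<in> W) \<and> (\<forall>z. \<forall>\<phi>\<in>W. (\<lambda>b. z * \<phi> b) \<in> W)"

text \<open>Every point has a neighbourhood with a smooth frame of \<open>F\<close> consisting of \<open>r\<close> sections.\<close>

definition smooth_subbundle ::
  "('a::topological_space, 'm::finite) chart set \<Rightarrow> nat \<Rightarrow> ('a \<Rightarrow> ('m, complex) form set) \<Rightarrow> bool" where
  "smooth_subbundle \<A> r F \<longleftrightarrow>
     (\<forall>p. complex_subspace (F p) \<and> (\<forall>\<phi>\<in>F p. is_form \<phi>)) \<and>
     (\<forall>p. \<exists>V s. open V \<and> p \<in> V \<and> (\<forall>j<r. smooth_form \<A> V (s j)) \<and>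
        (\<forall>q\<in>V. (\<forall>j<r. s j q \<in> F q) \<and>
           (\<forall>\<phi>\<in>F q. \<exists>!z :: nat \<Rightarrow> complex.
              (\<forall>j\<ge>r. z j = 0) \<and> (\<forall>vs. \<phi> vs = (\<Sum>j<r. z j * s j q vs)))))"

definition is_direct_sum :: "('b \<Rightarrow> complex) set \<Rightarrow> int set \<Rightarrow> (int \<Rightarrow> ('b \<Rightarrow> complex) set) \<Rightarrow> bool" where
  "is_direct_sum V I W \<longleftrightarrow>
     (\<forall>k\<in>I. complex_subspace (W k) \<and> W k \<subseteq> V) \<and>
     (\<forall>\<phi>\<in>V. \<exists>!\<psi>. (\<forall>k\<in>I. \<psi> k \<in> W k) \<and> (\<forall>k. k \<notin> I \<longrightarrow> \<psi> k = (\<lambda>_. 0)) \<and>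
        (\<forall>b. \<phi> b = (\<Sum>k\<in>I. \<psi> k b)))"

end

theory Submission
  imports Defs "HOL-Library.Function_Algebras"
begin

text \<open>
  At a point, let \<open>v\<close> in \<open>T \<oplus> T*\<close> act on forms by Clifford multiplication; \<open>v - i J v\<close> runs through
  \<open>L\<close> and \<open>v + i J v\<close> through its conjugate. Involutivity makes \<open>L\<close> isotropic, so \<open>J\<close> is skew and
  its spin action \<open>x\<close> satisfies \<open>[x, v] = J v\<close>. A form \<open>\<phi>\<close> killed by \<open>L\<close> (a vacuum) exists and
  satisfies \<open>x \<phi> = i n \<phi>\<close>, and each factor from the conjugate of \<open>L\<close> lowers the eigenvalue by \<open>i\<close>.
  The products of such factors applied to \<open>\<phi>\<close> span a Clifford submodule, hence all forms, and
  products of \<open>k\<close> factors span \<open>U\<^sup>n\<^sup>-\<^sup>k\<close>. They are independent because the product of all \<open>2n\<close>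
  factors does not kill \<open>\<phi>\<close>: it spans \<open>U\<^sup>-\<^sup>n\<close>, which contains the conjugate of \<open>\<phi>\<close>.
  Smooth local frames arise by choosing the basis of \<open>L\<close> and the vacuum smoothly.
\<close>

section \<open>Clifford action and spin representation\<close>

text \<open>All fibrewise algebra is done with real vectors: elements of L and of its conjugate
  appear only as \<open>v + z J v\<close> with z = -i or z = i. Since \<open>v\<close> and
  \<open>J v\<close> give proportional elements, CARD('m) = 2n real vectors that span the fibre
  together with their images under \<open>J\<close> stand for a basis of either eigenbundle. The
  dimension of the space of forms is never computed. Spanning comes first and identifies the
  eigenspaces with spans of products; only then can the conjugate vacuum show that the top product
  is nonzero, and independence rests on that. The obstacle to smoothness is that vacua chosen
  separately at each point vary in no controlled way. The product of all factors from L turns every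
  form into a vacuum, so it is applied to a form with constant components in a chart. At the centre
  this form is the conjugate of a vacuum; the result there is the conjugate of a top product, hence
  nonzero, and it stays nonzero nearby.\<close>

definition sc :: "complex \<Rightarrow> ('b \<Rightarrow> complex) \<Rightarrow> 'b \<Rightarrow> complex" where
  "sc z \<phi> = (\<lambda>b. z * \<phi> b)"

lemma sc_apply: "sc z \<phi> b = z * \<phi> b"
  by (simp add: sc_def)

lemma sum_fun_apply: "(\<Sum>i\<in>I. f i) b = (\<Sum>i\<in>I. f i b)" for f :: "'i \<Rightarrow> 'b \<Rightarrow> complex"
  by (induction I rule: infinite_finite_induct) auto

text \<open>Makes \<open>subspace\<close> and \<open>span\<close> over the complex numbers available
  for forms; addition and zero are the pointwise ones of \<open>Function_Algebras\<close>.\<close>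

interpretation cfun: vector_space "sc :: complex \<Rightarrow> ('b \<Rightarrow> complex) \<Rightarrow> _"
  by unfold_locales (auto simp: sc_def fun_eq_iff algebra_simps)

lemma complex_subspace_iff: "complex_subspace W \<longleftrightarrow> cfun.subspace W"
  by (auto simp: complex_subspace_def cfun.subspace_def sc_def plus_fun_def zero_fun_def)

definition clinear :: "(('b \<Rightarrow> complex) \<Rightarrow> ('c \<Rightarrow> complex)) \<Rightarrow> bool" where
  "clinear T \<longleftrightarrow> (\<forall>\<phi> \<psi>. T (\<phi> + \<psi>) = T \<phi> + T \<psi>) \<and> (\<forall>z \<phi>. T (sc z \<phi>) = sc z (T \<phi>))"

lemma clinear_add: "clinear T \<Longrightarrow> T (\<phi> + \<psi>) = T \<phi> + T \<psi>"
  and clinear_sc: "clinear T \<Longrightarrow> T (sc z \<phi>) = sc z (T \<phi>)"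
  by (auto simp: clinear_def)

lemma clinear_zero: "clinear T \<Longrightarrow> T 0 = 0"
  using clinear_sc[of T 0 0] by simp

lemma clinear_uminus: "clinear T \<Longrightarrow> T (- \<phi>) = - T \<phi>"
  using clinear_sc[of T "-1" \<phi>] by simp

lemma clinear_diff: "clinear T \<Longrightarrow> T (\<phi> - \<psi>) = T \<phi> - T \<psi>"
  using clinear_add[of T \<phi> "- \<psi>"] by (simp only: clinear_uminus add_uminus_conv_diff)

lemma clinear_sum: "clinear T \<Longrightarrow> T (\<Sum>i\<in>I. f i) = (\<Sum>i\<in>I. T (f i))"
  by (induction I rule: infinite_finite_induct) (auto simp: clinear_zero clinear_add)

lemmas clinear_simps = clinear_add clinear_sc clinear_zero clinear_uminus clinear_diff clinear_sum

section \<open>Interior and exterior multiplication\<close>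

definition covec :: "complex^'m::finite \<Rightarrow> real^'m \<Rightarrow> complex" where
  "covec \<xi> v = (\<Sum>k\<in>UNIV. \<xi> $ k * of_real (v $ k))"

text \<open>Interior multiplication by one real vector, defined for any function on lists. It is
  what makes induction over the argument list possible.\<close>

definition ins :: "real^'m::finite \<Rightarrow> ('m, 'k) form \<Rightarrow> ('m, 'k) form" where
  "ins v \<phi> = (\<lambda>vs. \<phi> (v # vs))"

lemma ins_apply: "ins v \<phi> vs = \<phi> (v # vs)"
  by (simp add: ins_def)

lemma ins_linear [simp]:
  "ins v (\<phi> - \<psi>) = ins v \<phi> - ins v \<psi>"
  "ins v (- \<phi>) = - ins v \<phi>" "ins v 0 = 0" "ins v (sc z \<phi>) = sc z (ins v \<phi>)"
  for \<phi> \<psi> :: "('m::finite, complex) form"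
  by (auto simp: ins_def sc_def fun_eq_iff)

lemma wedge1_Nil [simp]: "wedge1 \<xi> \<phi> [] = 0"
  by (simp add: wedge1_def)

text \<open>The graded Leibniz rule of interior multiplication, obtained by splitting off the
  summand for the head. It acts as a recursion equation for \<open>wedge1\<close>, so the sum over
  omitted positions need not be unfolded again.\<close>

lemma wedge1_Cons: "wedge1 \<xi> \<phi> (v # vs) = covec \<xi> v * \<phi> vs - wedge1 \<xi> (ins v \<phi>) vs"
  unfolding wedge1_def length_Cons
  by (subst sum.lessThan_Suc_shift)
     (simp add: omit_nth_def covec_def ins_def sum_negf algebra_simps)

lemma ins_wedge1: "ins v (wedge1 \<xi> \<phi>) = sc (covec \<xi> v) \<phi> - wedge1 \<xi> (ins v \<phi>)"
  by (rule ext) (simp add: ins_apply wedge1_Cons sc_apply)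

lemma clinear_wedge1: "clinear (wedge1 \<xi>)"
  by (auto simp: clinear_def wedge1_def fun_eq_iff sc_def algebra_simps sum.distrib sum_distrib_left)

lemma clinear_contract: "clinear (contract X)"
  by (auto simp: clinear_def contract_def fun_eq_iff sc_def algebra_simps sum.distrib sum_distrib_left)

lemma wedge1_add_left: "wedge1 (\<xi> + \<eta>) \<phi> = wedge1 \<xi> \<phi> + wedge1 \<eta> \<phi>"
  by (auto simp: wedge1_def fun_eq_iff algebra_simps sum.distrib sum_distrib_left)

lemma wedge1_scale_left: "wedge1 (z *s \<xi>) \<phi> = sc z (wedge1 \<xi> \<phi>)"
  by (auto simp: wedge1_def fun_eq_iff sc_def algebra_simps sum_distrib_left)

lemma contract_add_left: "contract (X + Y) \<phi> = contract X \<phi> + contract Y \<phi>"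
  by (auto simp: contract_def fun_eq_iff algebra_simps sum.distrib)

lemma contract_scale_left: "contract (z *s X) \<phi> = sc z (contract X \<phi>)"
  by (auto simp: contract_def fun_eq_iff sc_def algebra_simps sum_distrib_left)

lemma wedge1_zero_left: "wedge1 0 \<phi> = 0" and contract_zero_left: "contract 0 \<phi> = 0"
  by (auto simp: wedge1_def contract_def fun_eq_iff)

lemma wedge1_sum_left: "wedge1 (\<Sum>i\<in>I. f i) \<phi> = (\<Sum>i\<in>I. wedge1 (f i) \<phi>)"
  by (induction I rule: infinite_finite_induct) (auto simp: wedge1_zero_left wedge1_add_left)

lemma contract_sum_left: "contract (\<Sum>i\<in>I. f i) \<phi> = (\<Sum>i\<in>I. contract (f i) \<phi>)"
  by (induction I rule: infinite_finite_induct) (auto simp: contract_zero_left contract_add_left)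

text \<open>Interior multiplication of the anticommutator reproduces the anticommutator on
  \<open>ins v \<phi>\<close>, because the scalar terms cancel in pairs; the list shrinks until
  nothing is left.\<close>

lemma wedge1_anticommute: "wedge1 \<xi> (wedge1 \<eta> \<phi>) + wedge1 \<eta> (wedge1 \<xi> \<phi>) = 0"
proof
  fix vs
  show "(wedge1 \<xi> (wedge1 \<eta> \<phi>) + wedge1 \<eta> (wedge1 \<xi> \<phi>)) vs = 0 vs"
  proof (induction vs arbitrary: \<phi>)
    case (Cons v vs)
    from Cons[of "ins v \<phi>"] show ?case
      by (simp add: wedge1_Cons ins_wedge1 clinear_simps[OF clinear_wedge1] sc_apply algebra_simps)
  qed simp
qed

lemma contract_wedge1:
  "contract X (wedge1 \<xi> \<phi>) = sc (\<Sum>i\<in>UNIV. X $ i * \<xi> $ i) \<phi> - wedge1 \<xi> (contract X \<phi>)"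
proof -
  have *: "contract X \<psi> = (\<Sum>i\<in>UNIV. sc (X $ i) (ins (axis i 1) \<psi>))" for \<psi>
    by (auto simp: contract_def fun_eq_iff sum_fun_apply sc_apply ins_apply)
  have ax: "covec \<xi> (axis i 1) = \<xi> $ i" for i
    by (simp add: covec_def axis_def if_distrib cong: if_cong)
  show ?thesis
    unfolding * clinear_simps[OF clinear_wedge1] ins_wedge1 ax
    by (simp add: cfun.scale_right_diff_distrib sum_subtractf cfun.scale_sum_left)
qed

section \<open>Alternating multilinear functions are preserved\<close>

lemma is_form_linear: "is_form \<phi> \<Longrightarrow> linear (\<lambda>v. \<phi> (us @ v # ws))"
  by (simp add: is_form_def)

lemma is_form_linear0: "is_form \<phi> \<Longrightarrow> linear (\<lambda>v. \<phi> (v # ws))"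
  using is_form_linear[of \<phi> "[]" ws] by simp

lemma is_form_not_distinct: "is_form \<phi> \<Longrightarrow> \<not> distinct vs \<Longrightarrow> \<phi> vs = 0"
  by (simp add: is_form_def)

lemma is_formI:
  assumes "\<And>us ws. linear (\<lambda>v. \<phi> (us @ v # ws))" "\<And>vs. \<not> distinct vs \<Longrightarrow> \<phi> vs = 0"
  shows "is_form \<phi>"
  using assms by (simp add: is_form_def)

lemma is_form_ins: "is_form \<phi> \<Longrightarrow> is_form (ins v \<phi>)"
  using is_form_linear[of \<phi> "v # _"] by (auto simp: ins_def is_form_not_distinct intro!: is_formI)

lemma is_form_swap:
  assumes "is_form \<phi>" shows "\<phi> (v # w # vs) = - \<phi> (w # v # vs)"
proof -
  have l1: "linear (\<lambda>x. \<phi> (x # y # vs))" for y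
    using is_form_linear[OF assms, of "[]"] by simp
  have l2: "linear (\<lambda>y. \<phi> (x # y # vs))" for x
    using is_form_linear[OF assms, of "[x]"] by simp
  have z: "\<phi> (x # x # vs) = 0" for x
    by (rule is_form_not_distinct[OF assms]) simp
  have "0 = \<phi> ((v + w) # (v + w) # vs)" using z by simp
  also have "\<dots> = \<phi> (v # v # vs) + \<phi> (v # w # vs) + (\<phi> (w # v # vs) + \<phi> (w # w # vs))"
    by (simp add: linear_add[OF l1] linear_add[OF l2])
  finally show ?thesis using z by (simp add: add_eq_0_iff2)
qed

lemma ins_swap: "is_form \<phi> \<Longrightarrow> ins v (ins w \<phi>) = - ins w (ins v \<phi>)"
  by (rule ext) (simp add: ins_apply is_form_swap[of \<phi> w v])

lemma is_form_add: "is_form \<phi> \<Longrightarrow> is_form \<psi> \<Longrightarrow> is_form (\<phi> + \<psi>)" for \<phi> :: "('m::finite, complex) form"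
  by (auto simp: is_form_def intro!: linear_compose_add)

lemma is_form_sc: "is_form \<phi> \<Longrightarrow> is_form (sc z \<phi>)"
  by (auto simp: is_form_def sc_def linear_iff algebra_simps)

lemma is_form_0: "is_form (0 :: ('m::finite, complex) form)"
  by (auto simp: is_form_def linear_iff)

lemma subspace_is_form: "cfun.subspace {\<phi> :: ('m::finite, complex) form. is_form \<phi>}"
  by (simp add: cfun.subspace_def is_form_add is_form_sc is_form_0)

lemma is_form_sum:
  "(\<And>i. i \<in> I \<Longrightarrow> is_form (f i)) \<Longrightarrow> is_form (\<Sum>i\<in>I. f i :: ('m::finite, complex) form)"
  using cfun.subspace_sum[OF subspace_is_form, of I f] by simp

lemma contract_eq_sum: "contract X \<phi> = (\<Sum>i\<in>UNIV. sc (X $ i) (ins (axis i 1) \<phi>))"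
  by (auto simp: contract_def fun_eq_iff sum_fun_apply sc_apply ins_apply)

lemma is_form_contract: "is_form \<phi> \<Longrightarrow> is_form (contract X \<phi>)"
  unfolding contract_eq_sum by (intro is_form_sum is_form_sc is_form_ins)

lemma axis_expansion: "v = (\<Sum>i\<in>UNIV. v $ i *\<^sub>R axis i 1)" for v :: "real^'m::finite"
  by (simp add: vec_eq_iff axis_def if_distrib cong: if_cong)

lemma linear_form_vec:
  fixes f :: "real^'m::finite \<Rightarrow> complex"
  assumes "linear f"
  shows "f v = (\<Sum>i\<in>UNIV. of_real (v $ i) * f (axis i 1))"
proof -
  have "f v = f (\<Sum>i\<in>UNIV. v $ i *\<^sub>R axis i 1)" by (rule arg_cong[OF axis_expansion])
  then show ?thesis
    by (simp only: linear_sum[OF assms] linear_scale[OF assms] scaleR_conv_of_real[where 'a=complex])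
qed

lemma wedge1_linear_slot:
  assumes "is_form \<phi>"
  shows "linear (\<lambda>v. wedge1 \<xi> \<phi> (us @ v # ws))"
  using assms
proof (induction us arbitrary: \<phi>)
  case Nil
  have cv: "linear (covec \<xi>)"
    by (auto simp: linear_iff covec_def algebra_simps sum.distrib sum_distrib_left scaleR_conv_of_real[where 'a=complex])
  have "ins (v + w) \<phi> = ins v \<phi> + ins w \<phi>" "ins (r *\<^sub>R v) \<phi> = sc (of_real r) (ins v \<phi>)" for v w r
    by (auto simp: fun_eq_iff ins_apply sc_apply linear_add[OF is_form_linear0[OF Nil]]
         linear_scale[OF is_form_linear0[OF Nil]] scaleR_conv_of_real[where 'a=complex])
  then show ?case
    by (auto simp: linear_iff wedge1_Cons linear_add[OF cv] linear_scale[OF cv]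
        clinear_simps[OF clinear_wedge1] sc_apply algebra_simps scaleR_conv_of_real[where 'a=complex])
next
  case (Cons u us)
  show ?case
    unfolding append_Cons wedge1_Cons
    by (intro linear_compose_sub Cons.IH is_form_ins Cons.prems
         linear_compose[OF is_form_linear[OF Cons.prems], of "(*) (covec \<xi> u)", unfolded o_def])
       (auto simp: linear_iff algebra_simps)
qed

text \<open>This is the alternation of \<open>wedge1 \<xi> \<phi>\<close> on a list whose head
  \<open>v\<close> reappears later, rewritten through \<open>wedge1_Cons\<close>. The generic
  repetition, inside the tail, is handled by induction in \<open>is_form_wedge1\<close>.\<close>

lemma wedge1_ins_repeat:
  assumes "is_form \<phi>"
  shows "wedge1 \<xi> (ins v \<phi>) (us @ v # ws) = covec \<xi> v * \<phi> (us @ v # ws)"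
  using assms
proof (induction us arbitrary: \<phi>)
  case Nil
  have "ins v (ins v \<phi>) = 0"
    by (auto simp: fun_eq_iff ins_apply is_form_not_distinct[OF Nil])
  then show ?case by (simp add: wedge1_Cons clinear_zero[OF clinear_wedge1]) (simp add: ins_apply)
next
  case (Cons u us)
  have 0: "ins v \<phi> (us @ v # ws) = 0"
    by (simp add: ins_apply is_form_not_distinct[OF Cons.prems])
  have "wedge1 \<xi> (ins v \<phi>) (u # us @ v # ws) = - wedge1 \<xi> (ins u (ins v \<phi>)) (us @ v # ws)"
    by (simp only: wedge1_Cons 0) simp
  also have "ins u (ins v \<phi>) = - ins v (ins u \<phi>)"
    by (rule ins_swap[OF Cons.prems])
  also have "- wedge1 \<xi> (- ins v (ins u \<phi>)) (us @ v # ws) = wedge1 \<xi> (ins v (ins u \<phi>)) (us @ v # ws)"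
    by (simp only: clinear_uminus[OF clinear_wedge1]) simp
  also have "\<dots> = covec \<xi> v * ins u \<phi> (us @ v # ws)"
    by (rule Cons.IH[OF is_form_ins[OF Cons.prems]])
  finally show ?case by (simp add: ins_apply)
qed

lemma is_form_wedge1: assumes "is_form \<phi>" shows "is_form (wedge1 \<xi> \<phi>)"
proof (rule is_formI)
  show "linear (\<lambda>v. wedge1 \<xi> \<phi> (us @ v # ws))" for us ws
    by (rule wedge1_linear_slot[OF assms])
next
  fix vs :: "(real^'a) list" assume "\<not> distinct vs"
  then show "wedge1 \<xi> \<phi> vs = 0" using assms
  proof (induction vs arbitrary: \<phi>)
    case (Cons v vs)
    show ?case
    proof (cases "distinct vs")
      case True
      with Cons.prems obtain us ws where "vs = us @ v # ws" by (auto dest: split_list)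
      then show ?thesis using wedge1_ins_repeat[OF Cons.prems(2)] by (simp add: wedge1_Cons)
    next
      case False
      then show ?thesis
        by (simp add: wedge1_Cons is_form_not_distinct[OF Cons.prems(2)] Cons.IH is_form_ins Cons.prems(2))
    qed
  qed simp
qed

section \<open>Real vectors and covectors acting on forms\<close>

definition cvec :: "real^'m::finite \<Rightarrow> complex^'m" where
  "cvec x = (\<chi> i. of_real (x $ i))"

lemma cvec_simps [simp]: "cvec x $ i = of_real (x $ i)" "cvec (x + y) = cvec x + cvec y"
  "cvec (r *\<^sub>R x) = of_real r *s cvec x" "cvec 0 = 0" "cvec (axis i 1) = axis i 1"
  "cvec (- x) = - cvec x"
  by (auto simp: cvec_def vec_eq_iff axis_def)

lemma covec_cvec: "covec (cvec x) v = of_real (x \<bullet> v)"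
  by (simp add: covec_def inner_vec_def)

lemma contract_cvec: assumes "is_form \<phi>" shows "contract (cvec X) \<phi> = ins X \<phi>"
  by (rule ext) (simp add: contract_def ins_apply linear_form_vec[OF is_form_linear0[OF assms], of X])

lemma contract_anticommute:
  assumes "is_form \<phi>"
  shows "contract (cvec X) (contract (cvec Y) \<phi>) + contract (cvec Y) (contract (cvec X) \<phi>) = 0"
  by (simp add: contract_cvec is_form_ins assms ins_swap[OF assms, of X Y])

text \<open>A sum of wedges after contractions acts as the derivation extending the endomorphism
  with terms \<open>f i\<close> tensor \<open>g i\<close>. It serves both diagonal blocks of the
  spin action and, for dual bases, the degree operator.\<close>

lemma sum_wedge1_contract:
  fixes f g :: "'m::finite \<Rightarrow> real^'m"
  assumes "is_form \<phi>"
  shows "(\<Sum>i\<in>UNIV. wedge1 (cvec (f i)) (contract (cvec (g i)) \<phi>)) vs =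
    (\<Sum>j<length vs. \<phi> (vs[j := \<Sum>i\<in>UNIV. (f i \<bullet> (vs ! j)) *\<^sub>R g i]))"
  using assms
proof (induction vs arbitrary: \<phi>)
  case Nil then show ?case by (simp add: sum_fun_apply)
next
  case (Cons v vs)
  note l = is_form_linear0[OF Cons.prems]
  have "(\<Sum>i\<in>UNIV. wedge1 (cvec (f i)) (contract (cvec (g i)) \<phi>)) (v # vs) =
     (\<Sum>i\<in>UNIV. of_real (f i \<bullet> v) * \<phi> (g i # vs)) +
     (\<Sum>i\<in>UNIV. wedge1 (cvec (f i)) (contract (cvec (g i)) (ins v \<phi>))) vs"
    by (simp add: sum_fun_apply wedge1_Cons covec_cvec contract_cvec Cons.prems is_form_ins
       ins_swap[OF Cons.prems, of v] clinear_uminus[OF clinear_wedge1] ins_apply sum.distrib)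
  also have "(\<Sum>i\<in>UNIV. of_real (f i \<bullet> v) * \<phi> (g i # vs)) = \<phi> ((\<Sum>i\<in>UNIV. (f i \<bullet> v) *\<^sub>R g i) # vs)"
    by (simp only: linear_sum[OF l] linear_scale[OF l]) (simp add: scaleR_conv_of_real[where 'a=complex])
  finally show ?case
    unfolding Cons.IH[OF is_form_ins[OF Cons.prems]]
    by (simp only: length_Cons sum.lessThan_Suc_shift nth_Cons_0 nth_Cons_Suc list_update.simps nat.case ins_apply)
qed

definition rc :: "(real, 'm::finite) TT \<Rightarrow> ('m, complex) form \<Rightarrow> ('m, complex) form" where
  "rc v \<phi> = contract (cvec (fst v)) \<phi> + wedge1 (cvec (snd v)) \<phi>"

lemma clinear_rc: "clinear (rc v)"
  by (simp add: clinear_def rc_def clinear_simps[OF clinear_wedge1] clinear_simps[OF clinear_contract]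
      cfun.scale_right_distrib)

lemmas rc_simps = clinear_simps[OF clinear_rc]

lemma rc_add_left: "rc (v + w) \<phi> = rc v \<phi> + rc w \<phi>"
  by (simp add: rc_def wedge1_add_left contract_add_left)

lemma rc_scale_left: "rc (r *\<^sub>R v) \<phi> = sc (of_real r) (rc v \<phi>)"
  by (simp add: rc_def wedge1_scale_left contract_scale_left cfun.scale_right_distrib)

lemma rc_zero_left: "rc 0 \<phi> = 0"
  using rc_scale_left[of 0 0 \<phi>] by simp

lemma rc_uminus_left: "rc (- v) \<phi> = - rc v \<phi>"
  using rc_scale_left[of "-1" v \<phi>] by simp

lemma rc_sum_left: "rc (\<Sum>i\<in>I. f i) \<phi> = (\<Sum>i\<in>I. rc (f i) \<phi>)"
  by (induction I rule: infinite_finite_induct) (auto simp: rc_zero_left rc_add_left)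

lemma is_form_rc: "is_form \<phi> \<Longrightarrow> is_form (rc v \<phi>)"
  by (simp add: rc_def is_form_add is_form_contract is_form_wedge1)

text \<open>Twice the inner product, so that the Clifford relation has no factor.\<close>

definition pair :: "(real, 'm::finite) TT \<Rightarrow> (real, 'm) TT \<Rightarrow> real" where
  "pair v w = fst v \<bullet> snd w + snd v \<bullet> fst w"

lemma pair_simps: "pair (u + v) w = pair u w + pair v w" "pair u (v + w) = pair u v + pair u w"
  "pair (r *\<^sub>R v) w = r * pair v w" "pair v (r *\<^sub>R w) = r * pair v w"
  "pair (- v) w = - pair v w" "pair v (- w) = - pair v w"
  by (auto simp: pair_def algebra_simps inner_simps)

lemma pair_commute: "pair v w = pair w v"
  by (simp add: pair_def inner_commute)

lemma clifford_relation:
  assumes "is_form \<phi>"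
  shows "rc v (rc w \<phi>) + rc w (rc v \<phi>) = sc (of_real (pair v w)) \<phi>"
proof -
  let ?X = "cvec (fst v)" let ?Y = "cvec (fst w)" let ?\<xi> = "cvec (snd v)" let ?\<eta> = "cvec (snd w)"
  have i: "(\<Sum>i\<in>UNIV. cvec x $ i * cvec y $ i) = of_real (x \<bullet> y)" for x y :: "real^'a"
    by (simp add: inner_vec_def)
  have "rc v (rc w \<phi>) + rc w (rc v \<phi>) =
     (contract ?X (contract ?Y \<phi>) + contract ?Y (contract ?X \<phi>)) +
     (wedge1 ?\<xi> (wedge1 ?\<eta> \<phi>) + wedge1 ?\<eta> (wedge1 ?\<xi> \<phi>)) +
     (contract ?X (wedge1 ?\<eta> \<phi>) + wedge1 ?\<eta> (contract ?X \<phi>)) +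
     (contract ?Y (wedge1 ?\<xi> \<phi>) + wedge1 ?\<xi> (contract ?Y \<phi>))"
    by (simp add: rc_def clinear_simps[OF clinear_wedge1] clinear_simps[OF clinear_contract] algebra_simps)
  then show ?thesis
    unfolding contract_anticommute[OF assms] wedge1_anticommute contract_wedge1 i
    by (simp add: pair_def cfun.scale_left_distrib inner_commute)
qed

lemma rc_swap:
  assumes "is_form \<phi>"
  shows "rc v (rc w \<phi>) = sc (of_real (pair v w)) \<phi> - rc w (rc v \<phi>)"
  using clifford_relation[OF assms, of v w] by (simp add: eq_diff_eq)

abbreviation ev :: "'m::finite \<Rightarrow> (real, 'm) TT" where "ev i \<equiv> (axis i 1, 0)"
abbreviation ec :: "'m::finite \<Rightarrow> (real, 'm) TT" where "ec i \<equiv> (0, axis i 1)"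

lemma TT_expansion:
  fixes v :: "(real, 'm::finite) TT"
  shows "v = (\<Sum>i\<in>UNIV. (fst v $ i) *\<^sub>R ev i + (snd v $ i) *\<^sub>R ec i)"
  by (rule prod_eqI) (simp_all add: fst_sum snd_sum axis_expansion[symmetric])

lemma rc_expansion:
  "rc v \<phi> = (\<Sum>i\<in>UNIV. sc (of_real (fst v $ i)) (rc (ev i) \<phi>) + sc (of_real (snd v $ i)) (rc (ec i) \<phi>))"
  using arg_cong[OF TT_expansion[of v], of "\<lambda>u. rc u \<phi>"]
  by (simp only: rc_sum_left rc_add_left rc_scale_left)

lemma pair_ev: "pair v (ev i) = snd v $ i" "pair v (ec i) = fst v $ i"
  "pair (ev i) v = snd v $ i" "pair (ec i) v = fst v $ i"
  by (auto simp: pair_def inner_axis inner_axis')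

section \<open>The spin representation inside the Clifford algebra\<close>

definition skew :: "((real, 'm::finite) TT \<Rightarrow> (real, 'm) TT) \<Rightarrow> bool" where
  "skew F \<longleftrightarrow> (\<forall>v w. pair (F v) w = - pair v (F w))"

text \<open>The Clifford element of a skew \<open>F\<close> is one half of the sum of
  \<open>F u\<close> times the dual vector of \<open>u\<close> over a basis. The basis
  \<open>ev\<close>, \<open>ec\<close> is dual to \<open>ec\<close>, \<open>ev\<close> for
  \<open>pair\<close>. Sorting the products into vector and covector parts yields the four terms of
  \<open>spin\<close>.\<close>

lemma spin_clifford:
  fixes F :: "(real, 'm::finite) TT \<Rightarrow> (real, 'm) TT"
  assumes "linear F" "skew F" "is_form \<phi>"
  shows "spin F \<phi> = sc (1/2) (\<Sum>i\<in>UNIV. rc (F (ev i)) (rc (ec i) \<phi>) + rc (F (ec i)) (rc (ev i) \<phi>))"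
proof
  fix vs
  let ?A = "compA F"
  define D where "D = (\<Sum>j<length vs. \<phi> (vs[j := ?A (vs ! j)]))"
  have linA: "linear ?A"
    using linear_compose[OF linear_compose[OF bounded_linear.linear[OF bounded_linear_Pair[OF bounded_linear_ident bounded_linear_zero]] assms(1)] bounded_linear.linear[OF bounded_linear_fst]] by (simp add: compA_def[abs_def] o_def)
  have Ax: "?A v = (\<Sum>i\<in>UNIV. (axis i 1 \<bullet> v) *\<^sub>R ?A (axis i 1))" for v
  proof -
    have "?A v = ?A (\<Sum>i\<in>UNIV. v $ i *\<^sub>R axis i 1)" by (rule arg_cong[OF axis_expansion])
    then show ?thesis by (simp add: linear_sum[OF linA] linear_scale[OF linA] inner_axis')
  qed
  \<comment> \<open>Skewness makes the action on covectors the negative transpose of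
    \<open>?A\<close>; hence the same derivation \<open>D\<close> arises from both diagonal blocks
    and survives the factor 1/2.\<close>
  have sk: "snd (F (ec i)) \<bullet> v = - (?A v $ i)" for i v
  proof -
    have "snd (F (ec i)) \<bullet> v = pair (F (ec i)) (v, 0)" by (simp add: pair_def)
    also have "\<dots> = - pair (ec i) (F (v, 0))" using assms(2) by (simp add: skew_def)
    finally show ?thesis by (simp add: pair_ev compA_def)
  qed
  have D1: "(\<Sum>i\<in>UNIV. wedge1 (cvec (axis i 1)) (contract (cvec (?A (axis i 1))) \<phi>)) vs = D"
    unfolding D_def sum_wedge1_contract[OF assms(3)] by (simp flip: Ax)
  have A2: "(\<Sum>i\<in>UNIV. (snd (F (ec i)) \<bullet> v) *\<^sub>R axis i 1) = - ?A v" for v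
    by (simp add: sk sum_negf axis_expansion[symmetric])
  have D2: "(\<Sum>i\<in>UNIV. wedge1 (cvec (snd (F (ec i)))) (contract (cvec (axis i 1)) \<phi>)) vs = - D"
  proof -
    have "\<phi> (vs[j := - ?A (vs ! j)]) = - \<phi> (vs[j := ?A (vs ! j)])" if "j < length vs" for j
      using linear_neg[OF is_form_linear[OF assms(3), of "take j vs" "drop (Suc j) vs"]] that
      by (simp add: upd_conv_take_nth_drop)
    then show ?thesis
      unfolding D_def sum_wedge1_contract[OF assms(3)] A2 by (simp add: sum_negf)
  qed
  have vexp: "cvec x = (\<Sum>j\<in>UNIV. of_real (x $ j) *s axis j 1)" for x :: "real^'m"
    by (simp add: vec_eq_iff axis_def if_distrib cong: if_cong)
  have wexp: "wedge1 (cvec x) \<psi> = (\<Sum>j\<in>UNIV. sc (of_real (x $ j)) (wedge1 (axis j 1) \<psi>))" for x :: "real^'m" and \<psi>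
    by (subst vexp) (simp only: wedge1_sum_left wedge1_scale_left)
  have cexp: "contract (cvec x) \<psi> = (\<Sum>j\<in>UNIV. sc (of_real (x $ j)) (contract (axis j 1) \<psi>))" for x :: "real^'m" and \<psi>
    by (subst vexp) (simp only: contract_sum_left contract_scale_left)
  have wB: "(\<Sum>i\<in>UNIV. wedge1 (cvec (snd (F (ev i)))) (wedge1 (axis i 1) \<phi>)) vs =
     - (\<Sum>i\<in>UNIV. \<Sum>j\<in>UNIV. of_real (compB F i j) * wedge1 (axis i 1) (wedge1 (axis j 1) \<phi>) vs)"
  proof -
    have "wedge1 (axis j 1) (wedge1 (axis i 1) \<phi>) vs = - wedge1 (axis i 1) (wedge1 (axis j 1) \<phi>) vs" for i j :: 'm
      using wedge1_anticommute[of "axis j 1" "axis i 1" \<phi>] by (auto simp: fun_eq_iff add_eq_0_iff2)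
    note sw = this
    have "wedge1 (cvec (snd (F (ev i)))) (wedge1 (axis i 1) \<phi>) vs =
      (\<Sum>j\<in>UNIV. - (of_real (compB F i j) * wedge1 (axis i 1) (wedge1 (axis j 1) \<phi>) vs))" for i
      unfolding wexp[of "snd (F (ev i))"] sum_fun_apply sc_apply compB_def
      by (rule sum.cong, rule refl, simp only: sw[of _ i] mult_minus_right)
    then show ?thesis
      by (simp add: sum_fun_apply sum_negf)
  qed
  have cb: "(\<Sum>i\<in>UNIV. contract (cvec (fst (F (ec i)))) (contract (axis i 1) \<phi>)) vs =
     (\<Sum>i\<in>UNIV. \<Sum>j\<in>UNIV. of_real (comp_beta F i j) * contract (axis j 1) (contract (axis i 1) \<phi>) vs)"
    by (subst cexp) (simp add: sum_fun_apply sc_apply comp_beta_def)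
  \<comment> \<open>Only this block has the contraction on the outside; moving it past the wedge is
    the origin of the trace term.\<close>
  have tr: "(\<Sum>i\<in>UNIV. contract (cvec (?A (axis i 1))) (wedge1 (axis i 1) \<phi>)) vs =
     of_real (\<Sum>i\<in>UNIV. ?A (axis i 1) $ i) * \<phi> vs - D"
    unfolding contract_wedge1 D1[symmetric]
    by (simp add: sum_fun_apply sc_apply sum_subtractf axis_def if_distrib sum_distrib_right cong: if_cong)
       (simp flip: axis_def)
  have "(\<Sum>i\<in>UNIV. rc (F (ev i)) (rc (ec i) \<phi>) + rc (F (ec i)) (rc (ev i) \<phi>)) =
    (\<Sum>i\<in>UNIV. contract (cvec (?A (axis i 1))) (wedge1 (axis i 1) \<phi>)) +
    (\<Sum>i\<in>UNIV. wedge1 (cvec (snd (F (ev i)))) (wedge1 (axis i 1) \<phi>)) +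
    (\<Sum>i\<in>UNIV. contract (cvec (fst (F (ec i)))) (contract (axis i 1) \<phi>)) +
    (\<Sum>i\<in>UNIV. wedge1 (cvec (snd (F (ec i)))) (contract (cvec (axis i 1)) \<phi>))"
    by (simp add: rc_def compA_def wedge1_zero_left contract_zero_left sum.distrib algebra_simps)
  then show "spin F \<phi> vs = sc (1/2) (\<Sum>i\<in>UNIV. rc (F (ev i)) (rc (ec i) \<phi>) + rc (F (ec i)) (rc (ev i) \<phi>)) vs"
    by (simp add: sc_apply tr wB cb D2[simplified cvec_simps] spin_def D_def[symmetric] algebra_simps)
qed

text \<open>Moving \<open>v\<close> through a product of two vectors leaves two scalar terms. Summed
  over the dual bases, one family reassembles \<open>F v\<close> by expansion and the other does so
  by skewness; the two copies absorb the factor 1/2.\<close>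

lemma spin_commutator:
  fixes F :: "(real, 'm::finite) TT \<Rightarrow> (real, 'm) TT"
  assumes "linear F" "skew F" "is_form \<phi>"
  shows "spin F (rc v \<phi>) = rc v (spin F \<phi>) + rc (F v) \<phi>"
proof -
  let ?c = "\<lambda>r::real. sc (of_real r)"
  have com: "rc a (rc b (rc v \<phi>)) = rc v (rc a (rc b \<phi>)) + ?c (pair b v) (rc a \<phi>) - ?c (pair a v) (rc b \<phi>)" for a b
  proof -
    have "rc a (rc b (rc v \<phi>)) = ?c (pair b v) (rc a \<phi>) - rc a (rc v (rc b \<phi>))"
      by (subst rc_swap[OF assms(3), of b v]) (simp add: rc_simps)
    also have "rc a (rc v (rc b \<phi>)) = ?c (pair a v) (rc b \<phi>) - rc v (rc a (rc b \<phi>))"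
      by (rule rc_swap[OF is_form_rc[OF assms(3)]])
    finally show ?thesis by (simp add: fun_eq_iff)
  qed
  have "(\<Sum>i\<in>UNIV. ?c (pair (ec i) v) (rc (F (ev i)) \<phi>) + ?c (pair (ev i) v) (rc (F (ec i)) \<phi>)) = rc (F v) \<phi>"
  proof -
    have "F v = (\<Sum>i\<in>UNIV. (fst v $ i) *\<^sub>R F (ev i) + (snd v $ i) *\<^sub>R F (ec i))"
      using arg_cong[OF TT_expansion[of v], of F]
      by (simp only: linear_sum[OF assms(1)] linear_add[OF assms(1)] linear_scale[OF assms(1)])
    then show ?thesis by (simp add: rc_sum_left rc_add_left rc_scale_left pair_ev)
  qed
  moreover have "(\<Sum>i\<in>UNIV. ?c (pair (F (ev i)) v) (rc (ec i) \<phi>) + ?c (pair (F (ec i)) v) (rc (ev i) \<phi>)) = - rc (F v) \<phi>"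
  proof -
    have "pair (F u) v = - pair u (F v)" for u using assms(2) unfolding skew_def by blast
    then have "(\<Sum>i\<in>UNIV. ?c (pair (F (ev i)) v) (rc (ec i) \<phi>) + ?c (pair (F (ec i)) v) (rc (ev i) \<phi>)) =
      - (\<Sum>i\<in>UNIV. ?c (fst (F v) $ i) (rc (ev i) \<phi>) + ?c (snd (F v) $ i) (rc (ec i) \<phi>))"
      by (simp add: pair_ev sum_negf[symmetric] algebra_simps)
    also have "\<dots> = - rc (F v) \<phi>"
      by (simp only: rc_expansion[symmetric])
    finally show ?thesis .
  qed
  ultimately have s: "(\<Sum>i\<in>UNIV. rc (F (ev i)) (rc (ec i) (rc v \<phi>)) + rc (F (ec i)) (rc (ev i) (rc v \<phi>))) =
    (\<Sum>i\<in>UNIV. rc v (rc (F (ev i)) (rc (ec i) \<phi>)) + rc v (rc (F (ec i)) (rc (ev i) \<phi>))) + rc (F v) \<phi> + rc (F v) \<phi>"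
    unfolding com by (simp add: sum.distrib sum_subtractf algebra_simps eq_neg_iff_add_eq_0)
  have half: "sc (1/2) (\<psi> + \<theta> + \<theta>) = sc (1/2) \<psi> + \<theta>" for \<psi> \<theta> :: "('m, complex) form"
    by (auto simp: fun_eq_iff sc_apply algebra_simps)
  show ?thesis
    unfolding spin_clifford[OF assms] spin_clifford[OF assms(1,2) is_form_rc[OF assms(3)]] s half
    by (simp only: rc_simps)
qed

section \<open>Degrees and irreducibility of the Clifford module\<close>

lemma form_eq_0_on_axes:
  assumes "is_form \<phi>" "\<And>is. length is = k \<Longrightarrow> \<phi> (map (\<lambda>i. axis i 1) is) = 0" "length vs = k"
  shows "\<phi> vs = (0::complex)"
  using assms
proof (induction k arbitrary: \<phi> vs)
  case (Suc k)
  then obtain v ws where vs: "vs = v # ws" "length ws = k" by (auto simp: length_Suc_conv)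
  have "\<phi> (axis i 1 # ws) = 0" for i
  proof -
    have "ins (axis i 1) \<phi> ws = 0"
    proof (rule Suc.IH[OF is_form_ins[OF Suc.prems(1)] _ vs(2)])
      fix "is" :: "'a list" assume "length is = k"
      then show "ins (axis i 1) \<phi> (map (\<lambda>i. axis i 1) is) = 0"
        using Suc.prems(2)[of "i # is"] by (simp add: ins_apply)
    qed
    then show ?thesis by (simp add: ins_apply)
  qed
  then show ?case
    by (simp add: vs linear_form_vec[OF is_form_linear0[OF Suc.prems(1)], of v])
qed simp

lemma form_eq_0_length:
  fixes \<phi> :: "('m::finite, complex) form"
  assumes "is_form \<phi>" "CARD('m) < length vs"
  shows "\<phi> vs = 0"
proof (rule form_eq_0_on_axes[OF assms(1) _ refl])
  fix "is" :: "'m list" assume l: "length is = length vs"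
  have "\<not> distinct is"
    using card_mono[of UNIV "set is"] distinct_card[of "is"] assms(2) l by auto
  then have "\<not> distinct (map (\<lambda>i. axis i 1 :: real^'m) is)" by (simp add: distinct_map)
  then show "\<phi> (map (\<lambda>i. axis i 1) is) = 0" by (rule is_form_not_distinct[OF assms(1)])
qed

definition homog :: "nat \<Rightarrow> ('m::finite, complex) form \<Rightarrow> ('m, complex) form" where
  "homog k \<phi> = (\<lambda>vs. if length vs = k then \<phi> vs else 0)"

lemma is_form_homog: assumes "is_form \<phi>" shows "is_form (homog k \<phi>)"
proof (rule is_formI)
  show "linear (\<lambda>v. homog k \<phi> (us @ v # ws))" for us ws
    using is_form_linear[OF assms] by (cases "length (us @ undefined # ws) = k") (simp_all add: homog_def linear_iff)
qed (simp add: homog_def is_form_not_distinct[OF assms])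

lemma form_eq_sum_homog:
  fixes \<phi> :: "('m::finite, complex) form"
  assumes "is_form \<phi>"
  shows "\<phi> = (\<Sum>k\<le>CARD('m). homog k \<phi>)"
proof
  fix vs :: "(real^'m) list"
  show "\<phi> vs = (\<Sum>k\<le>CARD('m). homog k \<phi>) vs"
    using form_eq_0_length[OF assms, of vs] by (auto simp: sum_fun_apply homog_def not_le)
qed

lemma rc_ins: "is_form \<phi> \<Longrightarrow> rc (v, 0) \<phi> = ins v \<phi>"
  by (simp add: rc_def contract_cvec wedge1_zero_left)

text \<open>The Euler operator \<open>\<Sum>i. e\<^sup>i \<and> i_{e\<^sub>i}\<close> multiplies a form by its degree.\<close>

lemma homog_Suc:
  assumes "is_form \<phi>"
  shows "homog (Suc k) \<phi> = sc (1 / of_nat (Suc k)) (\<Sum>i\<in>UNIV. rc (ec i) (homog k (ins (axis i 1) \<phi>)))"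
proof
  fix vs
  let ?\<theta> = "homog (Suc k) \<phi>"
  have f: "is_form ?\<theta>" by (rule is_form_homog[OF assms])
  have "homog k (ins (axis i 1) \<phi>) = contract (cvec (axis i 1)) ?\<theta>" for i
    unfolding contract_cvec[OF f] by (rule ext) (simp add: ins_apply homog_def)
  then have "(\<Sum>i\<in>UNIV. rc (ec i) (homog k (ins (axis i 1) \<phi>))) vs =
      (\<Sum>i\<in>UNIV. wedge1 (cvec (axis i 1)) (contract (cvec (axis i 1)) ?\<theta>)) vs"
    by (simp add: rc_def contract_zero_left)
  also have "\<dots> = of_nat (length vs) * ?\<theta> vs"
    unfolding sum_wedge1_contract[OF f] by (simp add: inner_axis' axis_expansion[symmetric])
  finally show "?\<theta> vs = sc (1 / of_nat (Suc k)) (\<Sum>i\<in>UNIV. rc (ec i) (homog k (ins (axis i 1) \<phi>))) vs"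
    by (simp add: sc_apply homog_def del: of_nat_Suc)
qed

text \<open>Contracting a nonzero form with as many vectors as its top degree leaves a nonzero
  constant, so the constant form \<open>\<Omega>\<close> lies in \<open>W\<close>. Wedging with the
  covectors \<open>ec i\<close> then rebuilds every homogeneous part of \<open>\<psi>\<close> from
  constants, by \<open>homog_Suc\<close>.\<close>

lemma clifford_irreducible:
  fixes W :: "('m::finite, complex) form set"
  assumes W: "cfun.subspace W" "\<And>\<phi>. \<phi> \<in> W \<Longrightarrow> is_form \<phi>" "\<And>v \<phi>. \<phi> \<in> W \<Longrightarrow> rc v \<phi> \<in> W"
    and \<phi>: "\<phi> \<in> W" "\<phi> \<noteq> 0" and \<psi>: "is_form \<psi>"
  shows "\<psi> \<in> W"
proof -
  define \<Omega> :: "('m, complex) form" where "\<Omega> = (\<lambda>vs. if vs = [] then 1 else 0)"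
  have ins_W: "ins v \<phi> \<in> W" if "\<phi> \<in> W" for v \<phi>
    using W(3)[OF that, of "(v, 0)"] rc_ins[OF W(2)[OF that]] by simp
  have app_W: "(\<lambda>ws. \<phi> (us @ ws)) \<in> W" if "\<phi> \<in> W" for us \<phi>
    using that
  proof (induction us arbitrary: \<phi>)
    case (Cons u us)
    from Cons.IH[OF ins_W[OF Cons.prems]] show ?case by (simp add: ins_def)
  qed simp
  define P where "P = (\<lambda>k. \<exists>vs. length vs = k \<and> \<phi> vs \<noteq> 0)"
  define k where "k = (GREATEST k. P k)"
  have bd: "\<forall>k. P k \<longrightarrow> k \<le> CARD('m)"
    using form_eq_0_length[OF W(2)[OF \<phi>(1)]] unfolding P_def by (metis not_le)
  obtain vs0 where "\<phi> vs0 \<noteq> 0" using \<phi>(2) by (auto simp: fun_eq_iff)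
  then have "P (length vs0)" by (auto simp: P_def)
  then have Pk: "P k" unfolding k_def by (rule GreatestI_nat[of P _ "CARD('m)"]) (use bd in auto)
  then obtain us where us: "length us = k" "\<phi> us \<noteq> 0" by (auto simp: P_def)
  \<comment> \<open>\<open>us\<close> has the top degree \<open>k\<close> occurring in
    \<open>\<phi>\<close>, so nothing of positive degree remains once it is inserted.\<close>
  have "\<phi> (us @ ws) = \<phi> us * \<Omega> ws" for ws
  proof (cases "ws = []")
    case False
    have "\<not> P (length (us @ ws))"
      using Greatest_le_nat[of P "length (us @ ws)" "CARD('m)"] bd us(1) False unfolding k_def[symmetric] by auto
    then show ?thesis using False by (auto simp: P_def \<Omega>_def)
  qed (simp add: \<Omega>_def)
  then have "\<Omega> = sc (1 / \<phi> us) (\<lambda>ws. \<phi> (us @ ws))"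
    using us(2) by (auto simp: sc_def fun_eq_iff)
  then have \<Omega>: "\<Omega> \<in> W" using cfun.subspace_scale[OF W(1) app_W[OF \<phi>(1)]] by simp
  have "homog k \<psi> \<in> W" for k
    using \<psi>
  proof (induction k arbitrary: \<psi>)
    case 0
    have "homog 0 \<psi> = sc (\<psi> []) \<Omega>" by (auto simp: homog_def sc_def \<Omega>_def fun_eq_iff)
    then show ?case using cfun.subspace_scale[OF W(1) \<Omega>] by simp
  next
    case (Suc k)
    show ?case
      unfolding homog_Suc[OF Suc.prems]
      by (intro cfun.subspace_scale[OF W(1)] cfun.subspace_sum[OF W(1)] W(3) Suc.IH is_form_ins Suc.prems)
  qed
  then show ?thesis
    by (subst form_eq_sum_homog[OF \<psi>]) (intro cfun.subspace_sum[OF W(1)])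
qed

lemma eigenvectors_independent:
  fixes T :: "('b \<Rightarrow> complex) \<Rightarrow> 'b \<Rightarrow> complex"
  assumes "clinear T" "finite I" "\<And>k. k \<in> I \<Longrightarrow> T (\<psi> k) = sc (\<mu> k) (\<psi> k)" "inj_on \<mu> I" "(\<Sum>k\<in>I. \<psi> k) = 0" "k \<in> I"
  shows "\<psi> k = 0"
  using assms(2-)
proof (induction I arbitrary: \<psi> k rule: finite_induct)
  case (insert a I)
  have e: "T (\<psi> k) = sc (\<mu> k) (\<psi> k)" if "k \<in> I" for k using insert.prems(1)[of k] that by simp
  \<comment> \<open>Applying \<open>T - \<mu> a\<close> removes the summand of \<open>a\<close> and
    multiplies the others by the nonzero factors \<open>\<mu> k - \<mu> a\<close>.\<close>
  have "0 = T (\<Sum>k\<in>insert a I. \<psi> k) - sc (\<mu> a) (\<Sum>k\<in>insert a I. \<psi> k)"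
    by (simp only: insert.prems(3) clinear_zero[OF assms(1)] cfun.scale_zero_right diff_self)
  also have "\<dots> = (\<Sum>k\<in>insert a I. T (\<psi> k) - sc (\<mu> a) (\<psi> k))"
    by (simp only: clinear_sum[OF assms(1)] cfun.scale_sum_right sum_subtractf)
  also have "\<dots> = (\<Sum>k\<in>insert a I. sc (\<mu> k - \<mu> a) (\<psi> k))"
    by (rule sum.cong) (use insert.prems(1) in \<open>simp_all only: cfun.scale_left_diff_distrib\<close>)
  also have "\<dots> = (\<Sum>k\<in>I. sc (\<mu> k - \<mu> a) (\<psi> k))"
    using insert.hyps by simp
  finally have s: "(\<Sum>k\<in>I. sc (\<mu> k - \<mu> a) (\<psi> k)) = 0" by simp
  have z: "\<psi> j = 0" if "j \<in> I" for j
  proof -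
    have "sc (\<mu> j - \<mu> a) (\<psi> j) = 0"
    proof (rule insert.IH[OF _ _ s that])
      show "T (sc (\<mu> k - \<mu> a) (\<psi> k)) = sc (\<mu> k) (sc (\<mu> k - \<mu> a) (\<psi> k))" if "k \<in> I" for k
        by (simp add: clinear_sc[OF assms(1)] e that mult.commute)
      show "inj_on \<mu> I" using insert.prems(2) by simp
    qed
    moreover have "\<mu> j \<noteq> \<mu> a" using insert.prems(2) insert.hyps(2) that by (auto simp: inj_on_def)
    ultimately show ?thesis by simp
  qed
  then show ?case using insert.prems(3,4) insert.hyps by auto
qed simp

section \<open>Linearity and conjugation\<close>

lemma clinear_spin: "clinear (spin F)"
proof -
  note l = clinear_simps[OF clinear_wedge1] clinear_simps[OF clinear_contract]
  have "spin F (\<phi> + \<psi>) vs = spin F \<phi> vs + spin F \<psi> vs" for \<phi> \<psi> vs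
    unfolding spin_def l plus_fun_apply by (simp add: sum.distrib distrib_left)
  moreover have "spin F (sc z \<phi>) vs = z * spin F \<phi> vs" for z \<phi> vs
    unfolding spin_def l sc_apply by (simp add: algebra_simps sum_distrib_left)
  ultimately show ?thesis by (simp add: clinear_def fun_eq_iff sc_apply)
qed

text \<open>Complex conjugation commutes with the action of real vectors and of real endomorphisms.
  It therefore exchanges L with its conjugate and negates the imaginary eigenvalues of
  \<open>spin\<close>.\<close>

definition cj :: "('b \<Rightarrow> complex) \<Rightarrow> 'b \<Rightarrow> complex" where
  "cj \<phi> = (\<lambda>b. cnj (\<phi> b))"

lemma cj_eq_0 [simp]: "cj \<phi> = 0 \<longleftrightarrow> \<phi> = 0"
  by (auto simp: cj_def fun_eq_iff)

lemma cj_simps: "cj (\<phi> + \<psi>) = cj \<phi> + cj \<psi>" "cj (sc z \<phi>) = sc (cnj z) (cj \<phi>)"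
  by (auto simp: cj_def sc_def fun_eq_iff)

lemma is_form_cj: "is_form \<phi> \<Longrightarrow> is_form (cj \<phi>)"
  by (auto simp: is_form_def linear_iff cj_def)

lemma wedge1_cj: "wedge1 \<xi> (cj \<phi>) = cj (wedge1 (\<chi> i. cnj (\<xi> $ i)) \<phi>)"
  by (auto simp: wedge1_def cj_def fun_eq_iff)

lemma contract_cj: "contract \<xi> (cj \<phi>) = cj (contract (\<chi> i. cnj (\<xi> $ i)) \<phi>)"
  by (auto simp: contract_def cj_def fun_eq_iff)

lemma cnj_cvec: "(\<chi> i. cnj (cvec x $ i)) = cvec x" "(\<chi> i. cnj (axis j 1 $ i)) = axis j 1"
  by (auto simp: vec_eq_iff axis_def)

lemma rc_cj: "rc v (cj \<phi>) = cj (rc v \<phi>)"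
  unfolding rc_def wedge1_cj contract_cj cnj_cvec cj_simps ..

lemma spin_cj: "spin F (cj \<phi>) = cj (spin F \<phi>)"
proof
  fix vs
  show "spin F (cj \<phi>) vs = cj (spin F \<phi>) vs"
    unfolding spin_def wedge1_cj contract_cj cnj_cvec by (simp add: cj_def)
qed

section \<open>Fock space of a skew complex structure\<close>

text \<open>The Clifford action of \<open>v + z J v\<close>, which lies in \<open>L\<close> for \<open>z = -\<i>\<close> and in the
  conjugate of \<open>L\<close> for \<open>z = \<i>\<close>.\<close>

definition tw :: "((real, 'm) TT \<Rightarrow> (real, 'm) TT) \<Rightarrow> complex \<Rightarrow> (real, 'm::finite) TT \<Rightarrow>
    ('m, complex) form \<Rightarrow> ('m, complex) form" where
  "tw J z v \<phi> = rc v \<phi> + sc z (rc (J v) \<phi>)"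

lemma clinear_tw: "clinear (tw J z v)"
  by (simp add: clinear_def tw_def rc_simps cfun.scale_right_distrib mult.commute add_ac)

lemmas tw_simps = clinear_simps[OF clinear_tw]

lemma is_form_tw: "is_form \<phi> \<Longrightarrow> is_form (tw J z v \<phi>)"
  by (simp add: tw_def is_form_add is_form_sc is_form_rc)

lemma cj_tw: "cj (tw J z v \<phi>) = tw J (cnj z) v (cj \<phi>)"
  by (simp add: tw_def cj_simps rc_cj)

text \<open>The products of \<open>k\<close> factors from the conjugate of L, one for each sublist
  of \<open>bs\<close> of length \<open>k\<close>, applied to \<open>\<phi>\<close>. Lists give
  every product an index and a binomial count before the products are known to be distinct. The
  products without \<open>b\<close> precede those with \<open>b\<close> outermost.\<close>

primrec frame :: "((real, 'm) TT \<Rightarrow> (real, 'm) TT) \<Rightarrow> (real, 'm::finite) TT list \<Rightarrow>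
    ('m, complex) form \<Rightarrow> nat \<Rightarrow> ('m, complex) form list" where
  "frame J [] \<phi> k = (if k = 0 then [\<phi>] else [])"
| "frame J (b # bs) \<phi> k = frame J bs \<phi> k @ map (tw J \<i> b) (if k = 0 then [] else frame J bs \<phi> (k - 1))"

lemma length_frame: "length (frame J bs \<phi> k) = length bs choose k"
proof (induction bs arbitrary: k)
  case Nil then show ?case by (cases k) auto
next
  case (Cons b bs) then show ?case by (cases k) (auto simp: add.commute)
qed

lemma frame_eq_Nil: "length bs < k \<Longrightarrow> frame J bs \<phi> k = []"
  using length_frame[of J bs \<phi> k] by (simp add: binomial_eq_0)

text \<open>If \<open>bs\<close> and its image under \<open>J\<close> span, then
  \<open>z = \<i>\<close> leads from a vacuum to the lowest eigenspace, whereas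
  \<open>z = - \<i>\<close> turns any form into a vacuum.\<close>

definition full :: "((real, 'm) TT \<Rightarrow> (real, 'm) TT) \<Rightarrow> complex \<Rightarrow> (real, 'm::finite) TT list \<Rightarrow>
    ('m, complex) form \<Rightarrow> ('m, complex) form" where
  "full J z bs \<phi> = foldr (tw J z) bs \<phi>"

lemma full_simps [simp]: "full J z [] \<phi> = \<phi>" "full J z (b # bs) \<phi> = tw J z b (full J z bs \<phi>)"
  "full J z (as @ bs) \<phi> = full J z as (full J z bs \<phi>)"
  by (simp_all add: full_def)

lemma clinear_full: "clinear (full J z bs)"
  by (induction bs) (simp_all add: clinear_def tw_simps)

lemma is_form_full: "is_form \<phi> \<Longrightarrow> is_form (full J z bs \<phi>)"
  by (induction bs) (simp_all add: is_form_tw)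

lemma cj_full: "cj (full J z bs \<phi>) = full J (cnj z) bs (cj \<phi>)"
  by (induction bs) (simp_all add: cj_tw)

lemma frame_length: "frame J bs \<phi> (length bs) = [full J \<i> bs \<phi>]"
  by (induction bs) (simp_all add: frame_eq_Nil)

lemma frame_0: "frame J bs \<phi> 0 = [\<phi>]"
  by (induction bs) simp_all

lemma is_form_frame: "is_form \<phi> \<Longrightarrow> x \<in> set (frame J bs \<phi> k) \<Longrightarrow> is_form x"
  by (induction bs arbitrary: k x) (auto simp: is_form_tw split: if_splits)

text \<open>Coefficients are functions on all naturals, of which the first \<open>length xs\<close>
  enter, to match the coordinates in \<open>smooth_subbundle\<close>.\<close>

definition lcomb :: "(nat \<Rightarrow> complex) \<Rightarrow> ('b \<Rightarrow> complex) list \<Rightarrow> 'b \<Rightarrow> complex" where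
  "lcomb z xs = (\<Sum>j<length xs. sc (z j) (xs ! j))"

lemma sum_lessThan_add: "(\<Sum>j<m + n. f j) = (\<Sum>j<m. f j) + (\<Sum>j<n. f (j + m))" for n :: nat
  by (induction n) (simp_all add: add_ac)

lemma lcomb_append: "lcomb z (xs @ ys) = lcomb z xs + lcomb (\<lambda>j. z (j + length xs)) ys"
  unfolding lcomb_def length_append sum_lessThan_add
  by (intro arg_cong2[of _ _ _ _ "(+)"] sum.cong refl) (simp_all add: nth_append)

lemma lcomb_single: "lcomb z [x] = sc (z 0) x"
  by (simp add: lcomb_def)

lemma lcomb_map: "clinear T \<Longrightarrow> lcomb z (map T xs) = T (lcomb z xs)"
  by (simp add: lcomb_def clinear_sum clinear_sc)

lemma span_set_iff_lcomb: "\<psi> \<in> cfun.span (set xs) \<longleftrightarrow> (\<exists>z. \<psi> = lcomb z xs)"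
proof
  have "cfun.subspace {\<psi>. \<exists>z. \<psi> = lcomb z xs}"
  proof (rule cfun.subspaceI)
    show "0 \<in> {\<psi>. \<exists>z. \<psi> = lcomb z xs}"
      by (auto simp: lcomb_def intro!: exI[of _ "\<lambda>_. 0"])
  next
    fix x y assume "x \<in> {\<psi>. \<exists>z. \<psi> = lcomb z xs}" "y \<in> {\<psi>. \<exists>z. \<psi> = lcomb z xs}"
    then obtain z w where "x = lcomb z xs" "y = lcomb w xs" by auto
    then have "x + y = lcomb (\<lambda>j. z j + w j) xs"
      by (simp add: lcomb_def cfun.scale_left_distrib sum.distrib)
    then show "x + y \<in> {\<psi>. \<exists>z. \<psi> = lcomb z xs}" by auto
  next
    fix c x assume "x \<in> {\<psi>. \<exists>z. \<psi> = lcomb z xs}"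
    then obtain z where "x = lcomb z xs" by auto
    then have "sc c x = lcomb (\<lambda>j. c * z j) xs"
      by (simp add: lcomb_def cfun.scale_sum_right)
    then show "sc c x \<in> {\<psi>. \<exists>z. \<psi> = lcomb z xs}" by auto
  qed
  moreover have "x \<in> {\<psi>. \<exists>z. \<psi> = lcomb z xs}" if "x \<in> set xs" for x
  proof -
    from that obtain i where i: "i < length xs \<and> xs ! i = x" unfolding in_set_conv_nth ..
    have "lcomb (\<lambda>j. if j = i then 1 else 0) xs = (\<Sum>j<length xs. if j = i then xs ! j else 0)"
      unfolding lcomb_def by (rule sum.cong) auto
    also have "\<dots> = x" using i by simp
    finally show ?thesis by auto
  qed
  ultimately have "cfun.span (set xs) \<subseteq> {\<psi>. \<exists>z. \<psi> = lcomb z xs}"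
    by (intro cfun.span_minimal) auto
  then show "\<psi> \<in> cfun.span (set xs) \<Longrightarrow> \<exists>z. \<psi> = lcomb z xs" by auto
next
  show "\<exists>z. \<psi> = lcomb z xs \<Longrightarrow> \<psi> \<in> cfun.span (set xs)"
    unfolding lcomb_def
    by (elim exE, hypsubst, rule cfun.span_sum, rule cfun.span_scale, rule cfun.span_base) simp
qed

lemma clinear_image_span:
  assumes "clinear T" "\<And>x. x \<in> S \<Longrightarrow> T x \<in> cfun.span S'" "x \<in> cfun.span S"
  shows "T x \<in> cfun.span S'"
proof -
  have "cfun.subspace {x. T x \<in> cfun.span S'}"
    by (rule cfun.subspaceI) (auto simp: clinear_simps[OF assms(1)] cfun.span_zero cfun.span_add cfun.span_scale)
  then have "cfun.span S \<subseteq> {x. T x \<in> cfun.span S'}"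
    using assms(2) by (intro cfun.span_minimal) auto
  then show ?thesis using assms(3) by auto
qed

section \<open>Commutation relations in one fibre\<close>

locale skew_complex_structure =
  fixes J :: "(real, 'm) TT \<Rightarrow> (real, 'm::finite) TT"
  assumes lin: "linear J" and JJ: "J (J v) = - v" and sk: "skew J"
begin

lemma pair_J: "pair (J v) w = - pair v (J w)"
  using sk unfolding skew_def by blast

lemma tw_add_left: "tw J z (v + w) \<phi> = tw J z v \<phi> + tw J z w \<phi>"
  by (simp add: tw_def linear_add[OF lin] rc_add_left cfun.scale_right_distrib)

lemma tw_scale_left: "tw J z (r *\<^sub>R v) \<phi> = sc (of_real r) (tw J z v \<phi>)"
  by (simp add: tw_def linear_scale[OF lin] rc_scale_left cfun.scale_right_distrib mult.commute)

lemma tw_zero_left: "tw J z 0 \<phi> = 0"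
  using tw_scale_left[of z 0 0 \<phi>] by simp

text \<open>For \<open>z * z = -1\<close> the vector \<open>v + z J v\<close> is an eigenvector of
  \<open>J\<close> for \<open>- z\<close>. Thus \<open>v\<close> and \<open>J v\<close> give the
  same line, which is why half of a real basis suffices.\<close>

lemma tw_J:
  assumes "z * z = -1" shows "tw J z (J v) \<phi> = sc (- z) (tw J z v \<phi>)"
  using assms by (simp add: tw_def JJ rc_uminus_left cfun.scale_right_distrib fun_eq_iff sc_apply flip: mult.assoc)

lemma rc_eq_tw: "rc v \<phi> = sc (1/2) (tw J \<i> v \<phi> + tw J (- \<i>) v \<phi>)"
  by (auto simp: tw_def fun_eq_iff sc_apply algebra_simps)

text \<open>The complex bilinear extension of \<open>pair\<close>, evaluated on
  \<open>v + z J v\<close> and \<open>w + y J w\<close>.\<close>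

definition herm :: "complex \<Rightarrow> complex \<Rightarrow> (real, 'm) TT \<Rightarrow> (real, 'm) TT \<Rightarrow> complex" where
  "herm z y v w = of_real (pair v w) + y * of_real (pair v (J w)) + z * of_real (pair (J v) w)
     + z * y * of_real (pair (J v) (J w))"

lemma tw_swap_gen:
  assumes "is_form \<phi>"
  shows "tw J z v (tw J y w \<phi>) = sc (herm z y v w) \<phi> - tw J y w (tw J z v \<phi>)"
  unfolding tw_def rc_simps rc_swap[OF assms, of v] rc_swap[OF assms, of "J v"]
  by (auto simp: fun_eq_iff sc_apply herm_def algebra_simps)

lemma tw_swap:
  assumes "is_form \<phi>" "z * z = -1"
  shows "tw J z v (tw J z w \<phi>) = - tw J z w (tw J z v \<phi>)"
proof -
  \<comment> \<open>Both eigenbundles are isotropic: skewness cancels the two mixed terms, and it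
    makes \<open>J\<close> preserve \<open>pair\<close>, so that the outer terms cancel as
    well.\<close>
  have "herm z z v w = 0"
    using assms(2) by (simp add: herm_def pair_J JJ pair_simps)
  then show ?thesis using tw_swap_gen[OF assms(1), of z v z w] by simp
qed

lemma tw_square:
  assumes "is_form \<phi>" "z * z = -1"
  shows "tw J z v (tw J z v \<phi>) = 0"
proof
  fix vs
  show "tw J z v (tw J z v \<phi>) vs = 0 vs"
    using fun_cong[OF tw_swap[OF assms, of v v], of vs] by simp
qed

lemma tw_full_swap:
  assumes "is_form \<phi>" "z * z = -1"
  shows "tw J z b (full J z bs \<phi>) = sc ((-1) ^ length bs) (full J z bs (tw J z b \<phi>))"
proof (induction bs)
  case (Cons a bs)
  have "tw J z b (full J z (a # bs) \<phi>) = - tw J z a (tw J z b (full J z bs \<phi>))"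
    by (simp add: tw_swap[OF is_form_full[OF assms(1)] assms(2), of b])
  then show ?case by (simp add: Cons.IH tw_simps)
qed simp

lemma tw_full_eq_0:
  assumes "is_form \<phi>" "z * z = -1" "b \<in> set bs"
  shows "tw J z b (full J z bs \<phi>) = 0"
  using assms(3)
proof (induction bs)
  case (Cons a bs)
  show ?case
  proof (cases "a = b")
    case True
    then show ?thesis by (simp add: tw_square[OF is_form_full[OF assms(1)] assms(2)])
  next
    case False
    then have "tw J z b (full J z bs \<phi>) = 0" using Cons by auto
    then show ?thesis
      unfolding full_simps tw_swap[OF is_form_full[OF assms(1)] assms(2), of b a] by (simp only: tw_simps minus_zero)
  qed
qed simp

text \<open>The commutator with \<open>spin J\<close> acts as \<open>J\<close>, and
  \<open>v + z J v\<close> is an eigenvector of \<open>J\<close> for \<open>- z\<close>. With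
  \<open>z = \<i>\<close> an eigenvalue therefore drops by \<open>\<i>\<close>.\<close>

lemma spin_tw:
  assumes "is_form \<phi>" "z * z = -1"
  shows "spin J (tw J z v \<phi>) = tw J z v (spin J \<phi>) - sc z (tw J z v \<phi>)"
proof -
  have "sc z (sc z (rc (J v) \<phi>)) = - rc (J v) \<phi>" using assms(2) by simp
  then show ?thesis
    unfolding tw_def clinear_simps[OF clinear_spin] spin_commutator[OF lin sk assms(1)] JJ rc_uminus_left
      cfun.scale_right_distrib by (simp add: cfun.scale_right_distrib fun_eq_iff sc_apply algebra_simps)
qed

text \<open>The subspace \<open>W\<close> is left general to cover two uses: annihilation, with
  \<open>W\<close> equal to {0}, and stability of a span.\<close>

lemma tw_spanned:
  assumes "cfun.subspace W" "z * z = -1" "\<And>b. b \<in> set bs \<Longrightarrow> tw J z b \<phi> \<in> W"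
    "v \<in> span (set bs \<union> J ` set bs)"
  shows "tw J z v \<phi> \<in> W"
proof -
  have "subspace {v. tw J z v \<phi> \<in> W}"
    by (rule subspaceI) (auto simp: tw_zero_left tw_add_left tw_scale_left cfun.subspace_0[OF assms(1)]
      cfun.subspace_add[OF assms(1)] cfun.subspace_scale[OF assms(1)])
  moreover have "set bs \<union> J ` set bs \<subseteq> {v. tw J z v \<phi> \<in> W}"
    using assms(3) by (auto simp: tw_J[OF assms(2)] intro!: cfun.subspace_scale[OF assms(1)] cfun.subspace_neg[OF assms(1)])
  ultimately have "span (set bs \<union> J ` set bs) \<subseteq> {v. tw J z v \<phi> \<in> W}"
    by (rule span_minimal[rotated])
  then show ?thesis using assms(4) by auto
qed

lemma full_vacuum:
  assumes "is_form \<phi>" "z * z = -1" "span (set bs \<union> J ` set bs) = UNIV"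
  shows "tw J z v (full J z bs \<phi>) = 0"
proof -
  have "tw J z v (full J z bs \<phi>) \<in> {0}"
    by (rule tw_spanned[OF _ assms(2)]) (use assms in \<open>auto simp: tw_full_eq_0 cfun.subspace_def\<close>)
  then show ?thesis by simp
qed

section \<open>Vacua and the module they generate\<close>

definition vacuum :: "('m, complex) form \<Rightarrow> bool" where
  "vacuum \<phi> \<longleftrightarrow> is_form \<phi> \<and> (\<forall>v. tw J (- \<i>) v \<phi> = 0)"

text \<open>Starting from the constant form 1, the vectors are treated in turn. If \<open>a\<close>
  does not kill the current form, that form is replaced by its image under \<open>a\<close>, which
  is killed by \<open>a\<close> because squares vanish and still by the earlier vectors because of
  anticommutation.\<close>

lemma vacuum_exists:
  assumes "span (set bs \<union> J ` set bs) = UNIV"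
  obtains \<phi> where "vacuum \<phi>" "\<phi> \<noteq> 0"
proof -
  have "\<exists>\<phi>. is_form \<phi> \<and> \<phi> \<noteq> 0 \<and> (\<forall>b\<in>set as. tw J (- \<i>) b \<phi> = 0)" for as
  proof (induction as)
    case Nil
    let ?\<Omega> = "\<lambda>vs. if vs = [] then 1 else 0 :: complex"
    have "is_form ?\<Omega>" by (auto simp: is_form_def linear_iff)
    moreover have "?\<Omega> \<noteq> 0" by (auto simp: fun_eq_iff)
    ultimately show ?case unfolding list.set ball_empty simp_thms by blast
  next
    case (Cons a as)
    then obtain \<phi> where p: "is_form \<phi>" "\<phi> \<noteq> 0" "\<forall>b\<in>set as. tw J (- \<i>) b \<phi> = 0" by blast
    show ?case
    proof (cases "tw J (- \<i>) a \<phi> = 0")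
      case True
      then have "\<forall>b\<in>set (a # as). tw J (- \<i>) b \<phi> = 0" using p(3) by (metis set_ConsD)
      then show ?thesis using p(1,2) by blast
    next
      case False
      have "tw J (- \<i>) b (tw J (- \<i>) a \<phi>) = 0" if "b \<in> set as" for b
        using p that by (simp add: tw_swap[OF p(1), of _ b] tw_simps)
      then show ?thesis using False p(1) by (intro exI[of _ "tw J (- \<i>) a \<phi>"]) (auto simp: is_form_tw tw_square)
    qed
  qed
  then obtain \<phi> where p: "is_form \<phi>" "\<phi> \<noteq> 0" "\<forall>b\<in>set bs. tw J (- \<i>) b \<phi> = 0" by blast
  have "tw J (- \<i>) v \<phi> \<in> {0}" for v
    by (rule tw_spanned[of _ _ bs]) (use assms p in \<open>auto simp: cfun.subspace_def\<close>)
  then show ?thesis using that[of \<phi>] p by (auto simp: vacuum_def)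
qed

text \<open>On a vacuum \<open>J v\<close> acts as \<open>- \<i>\<close> times \<open>v\<close>.
  Inserted in \<open>spin_clifford\<close>, each pair \<open>ev i\<close>, \<open>ec i\<close>
  contributes \<open>\<i>\<close> by the Clifford relation, and one half of CARD('m) such
  contributions remains.\<close>

lemma spin_vacuum:
  assumes "vacuum \<phi>"
  shows "spin J \<phi> = sc (\<i> * of_nat CARD('m) / 2) \<phi>"
proof -
  have f: "is_form \<phi>" using assms by (simp add: vacuum_def)
  have J: "rc (J v) \<phi> = sc (- \<i>) (rc v \<phi>)" for v
  proof -
    have "tw J (- \<i>) v \<phi> = 0" using assms unfolding vacuum_def by blast
    then have "sc (- \<i>) (rc v \<phi> + sc (- \<i>) (rc (J v) \<phi>)) = 0" by (simp add: tw_def)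
    then show ?thesis by (auto simp: fun_eq_iff sc_apply algebra_simps)
  qed
  \<comment> \<open>Swapping brings \<open>J\<close> next to the vacuum; the scalars produced by the
    two swaps cancel by skewness.\<close>
  have s: "rc (J a) (rc b \<phi>) + rc (J b) (rc a \<phi>) = sc (\<i> * of_real (pair a b)) \<phi>" for a b
  proof -
    have "rc (J a) (rc b \<phi>) + rc (J b) (rc a \<phi>) = sc \<i> (rc b (rc a \<phi>) + rc a (rc b \<phi>))"
      unfolding rc_swap[OF f, of "J a"] rc_swap[OF f, of "J b"] J rc_simps
      by (auto simp: fun_eq_iff sc_apply pair_J pair_commute[of b] algebra_simps)
    then show ?thesis unfolding clifford_relation[OF f] by (simp add: pair_commute)
  qed
  have "spin J \<phi> = sc (1/2) (\<Sum>i\<in>(UNIV :: 'm set). sc (\<i> * of_real 1) \<phi>)"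
    unfolding spin_clifford[OF lin sk f] s by (simp add: pair_ev)
  also have "\<dots> = sc (\<i> * of_nat CARD('m) / 2) \<phi>"
    by (auto simp: fun_eq_iff sc_apply sum_fun_apply)
  finally show ?thesis .
qed

lemma spin_frame:
  assumes "is_form \<phi>" "spin J \<phi> = sc (\<i> * c) \<phi>" "x \<in> set (frame J bs \<phi> k)"
  shows "spin J x = sc (\<i> * (c - of_nat k)) x"
  using assms(3)
proof (induction bs arbitrary: x k)
  case Nil
  then show ?case using assms(2) by (auto split: if_splits)
next
  case (Cons b bs)
  consider "x \<in> set (frame J bs \<phi> k)" | k' y where "k = Suc k'" "y \<in> set (frame J bs \<phi> k')" "x = tw J \<i> b y"
    using Cons.prems by (cases k) auto
  then show ?case
  proof cases
    case 1 then show ?thesis by (rule Cons.IH)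
  next
    case 2
    have "spin J x = sc (\<i> * (c - of_nat k')) (tw J \<i> b y) - sc \<i> (tw J \<i> b y)"
      unfolding 2(3) spin_tw[OF is_form_frame[OF assms(1) 2(2)], of \<i>, simplified] Cons.IH[OF 2(2)] tw_simps ..
    then show ?thesis unfolding 2 by (auto simp: fun_eq_iff sc_apply algebra_simps)
  qed
qed

definition gens :: "(real, 'm) TT list \<Rightarrow> ('m, complex) form \<Rightarrow> ('m, complex) form set" where
  "gens bs \<phi> = (\<Union>k. set (frame J bs \<phi> k))"

lemma gens_Cons: "gens (b # bs) \<phi> = gens bs \<phi> \<union> tw J \<i> b ` gens bs \<phi>"
proof -
  have 1: "set (frame J (b # bs) \<phi> k) \<subseteq> gens bs \<phi> \<union> tw J \<i> b ` gens bs \<phi>" for k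
    by (auto simp: gens_def)
  have 2: "x \<in> gens (b # bs) \<phi> \<and> tw J \<i> b x \<in> gens (b # bs) \<phi>" if x: "x \<in> gens bs \<phi>" for x
  proof -
    obtain k where k: "x \<in> set (frame J bs \<phi> k)" using x unfolding gens_def by blast
    then have "x \<in> set (frame J (b # bs) \<phi> k)" "tw J \<i> b x \<in> set (frame J (b # bs) \<phi> (Suc k))"
      by auto
    then show ?thesis unfolding gens_def by blast
  qed
  show ?thesis
  proof
    show "gens (b # bs) \<phi> \<subseteq> gens bs \<phi> \<union> tw J \<i> b ` gens bs \<phi>"
      using 1 unfolding gens_def[of "b # bs"] by blast
    show "gens bs \<phi> \<union> tw J \<i> b ` gens bs \<phi> \<subseteq> gens (b # bs) \<phi>"
      using 2 by blast
  qed
qed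

lemma gens_Nil: "gens [] \<phi> = {\<phi>}"
  by (auto simp: gens_def split: if_splits)

lemma is_form_gens: "is_form \<phi> \<Longrightarrow> x \<in> gens bs \<phi> \<Longrightarrow> is_form x"
  by (auto simp: gens_def is_form_frame)

text \<open>The new factor anticommutes inwards to its own slot; if it meets itself there, the
  product vanishes. Up to sign the result is again a product, or zero.\<close>

lemma tw_gens_basis:
  assumes "is_form \<phi>" "a \<in> set bs" "x \<in> gens bs \<phi>"
  shows "tw J \<i> a x \<in> cfun.span (gens bs \<phi>)"
  using assms(2,3)
proof (induction bs arbitrary: x)
  case (Cons b bs)
  have sub: "cfun.span (gens bs \<phi>) \<subseteq> cfun.span (gens (b # bs) \<phi>)"
    by (intro cfun.span_mono) (auto simp: gens_Cons)
  have im: "tw J \<i> b y \<in> cfun.span (gens (b # bs) \<phi>)" if "y \<in> cfun.span (gens bs \<phi>)" for y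
    by (rule clinear_image_span[OF clinear_tw _ that]) (auto simp: gens_Cons intro: cfun.span_base)
  consider "x \<in> gens bs \<phi>" | y where "y \<in> gens bs \<phi>" "x = tw J \<i> b y"
    using Cons.prems by (auto simp: gens_Cons)
  then show ?case
  proof cases
    case 1
    show ?thesis
    proof (cases "a = b")
      case True then show ?thesis using im cfun.span_base[OF 1] by simp
    next
      case False then show ?thesis using Cons.IH[OF _ 1] Cons.prems sub by auto
    qed
  next
    case 2
    note fy = is_form_gens[OF assms(1) 2(1)]
    show ?thesis
    proof (cases "a = b")
      case True
      have "tw J \<i> b (tw J \<i> b y) = 0" by (rule tw_square[OF fy]) simp
      then show ?thesis unfolding True 2 by (simp only: cfun.span_zero)
    next
      case False
      then have "tw J \<i> a y \<in> cfun.span (gens bs \<phi>)" using Cons.IH[OF _ 2(1)] Cons.prems by auto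
      from cfun.span_neg[OF im[OF this]] show ?thesis
        unfolding 2 by (subst tw_swap[OF fy]) simp_all
    qed
  qed
qed simp

text \<open>A factor from L moves inwards past each \<open>b\<close> at the cost of a scalar times
  the product without \<open>b\<close>, and finally kills the vacuum.\<close>

lemma tw_gens_annihilate:
  assumes "vacuum \<phi>" "x \<in> gens bs \<phi>"
  shows "tw J (- \<i>) v x \<in> cfun.span (gens bs \<phi>)"
  using assms(2)
proof (induction bs arbitrary: x)
  case Nil
  then show ?case using assms(1) unfolding gens_Nil vacuum_def singleton_iff by (metis cfun.span_zero)
next
  case (Cons b bs)
  have f: "is_form \<phi>" using assms(1) by (simp add: vacuum_def)
  have sub: "cfun.span (gens bs \<phi>) \<subseteq> cfun.span (gens (b # bs) \<phi>)"
    by (intro cfun.span_mono) (auto simp: gens_Cons)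
  have im: "tw J \<i> b y \<in> cfun.span (gens (b # bs) \<phi>)" if "y \<in> cfun.span (gens bs \<phi>)" for y
    by (rule clinear_image_span[OF clinear_tw _ that]) (auto simp: gens_Cons intro: cfun.span_base)
  consider "x \<in> gens bs \<phi>" | y where "y \<in> gens bs \<phi>" "x = tw J \<i> b y"
    using Cons.prems by (auto simp: gens_Cons)
  then show ?case
  proof cases
    case 1 then show ?thesis using Cons.IH sub by auto
  next
    case 2
    have "tw J (- \<i>) v y \<in> cfun.span (gens bs \<phi>)" by (rule Cons.IH[OF 2(1)])
    moreover have "y \<in> cfun.span (gens (b # bs) \<phi>)" using cfun.span_base[OF 2(1)] sub by auto
    ultimately show ?thesis
      unfolding 2 tw_swap_gen[OF is_form_gens[OF f 2(1)], of "- \<i>" v \<i> b]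
      by (intro cfun.span_diff cfun.span_scale im)
  qed
qed

lemma frames_span:
  assumes "vacuum \<phi>" "\<phi> \<noteq> 0" "span (set bs \<union> J ` set bs) = UNIV" "is_form \<psi>"
  shows "\<psi> \<in> cfun.span (gens bs \<phi>)"
proof (rule clifford_irreducible[OF cfun.subspace_span _ _ _ assms(2,4)])
  have f: "is_form \<phi>" using assms(1) by (simp add: vacuum_def)
  have "cfun.span (gens bs \<phi>) \<subseteq> {\<phi>. is_form \<phi>}"
    by (rule cfun.span_minimal[OF _ subspace_is_form]) (auto intro: is_form_gens[OF f])
  then show "\<theta> \<in> cfun.span (gens bs \<phi>) \<Longrightarrow> is_form \<theta>" for \<theta> by auto
  have "\<phi> \<in> set (frame J bs \<phi> 0)" by (simp add: frame_0)
  then show "\<phi> \<in> cfun.span (gens bs \<phi>)" by (intro cfun.span_base) (auto simp: gens_def)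
  fix v \<theta> assume t: "\<theta> \<in> cfun.span (gens bs \<phi>)"
  have "tw J \<i> v x \<in> cfun.span (gens bs \<phi>)" if "x \<in> gens bs \<phi>" for x
    by (rule tw_spanned[OF cfun.subspace_span _ tw_gens_basis[OF f _ that]]) (use assms(3) in auto)
  then have "tw J \<i> v \<theta> \<in> cfun.span (gens bs \<phi>)" "tw J (- \<i>) v \<theta> \<in> cfun.span (gens bs \<phi>)"
    using clinear_image_span[OF clinear_tw _ t] tw_gens_annihilate[OF assms(1)] by blast+
  then show "rc v \<theta> \<in> cfun.span (gens bs \<phi>)"
    unfolding rc_eq_tw by (intro cfun.span_scale cfun.span_add)
qed

lemma frame_decomposition:
  assumes "vacuum \<phi>" "\<phi> \<noteq> 0" "span (set bs \<union> J ` set bs) = UNIV" "is_form \<psi>"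
  obtains f where "\<And>k. f k \<in> cfun.span (set (frame J bs \<phi> k))" "\<psi> = (\<Sum>k\<le>length bs. f k)"
proof -
  let ?S = "\<lambda>k. cfun.span (set (frame J bs \<phi> k))"
  let ?D = "{\<psi>. \<exists>f. (\<forall>k. f k \<in> ?S k) \<and> \<psi> = (\<Sum>k\<le>length bs. f k)}"
  have "cfun.subspace ?D"
  proof (rule cfun.subspaceI)
    show "0 \<in> ?D" by (auto intro!: exI[of _ "\<lambda>_. 0"] simp: cfun.span_zero)
  next
    fix x y assume "x \<in> ?D" "y \<in> ?D"
    then obtain f g where "\<forall>k. f k \<in> ?S k" "x = (\<Sum>k\<le>length bs. f k)"
      "\<forall>k. g k \<in> ?S k" "y = (\<Sum>k\<le>length bs. g k)" by auto
    then show "x + y \<in> ?D"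
      by (intro CollectI exI[of _ "\<lambda>k. f k + g k"]) (auto simp: sum.distrib intro: cfun.span_add)
  next
    fix c x assume "x \<in> ?D"
    then obtain f where "\<forall>k. f k \<in> ?S k" "x = (\<Sum>k\<le>length bs. f k)" by auto
    then show "sc c x \<in> ?D"
      by (intro CollectI exI[of _ "\<lambda>k. sc c (f k)"]) (auto simp: cfun.scale_sum_right intro: cfun.span_scale)
  qed
  moreover have "gens bs \<phi> \<subseteq> ?D"
  proof
    fix x assume "x \<in> gens bs \<phi>"
    then obtain k where k: "x \<in> set (frame J bs \<phi> k)" by (auto simp: gens_def)
    then have "k \<le> length bs" using frame_eq_Nil[of bs k J \<phi>] by (cases "k \<le> length bs") auto
    then have "x = (\<Sum>j\<le>length bs. if j = k then x else 0)" by simp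
    then show "x \<in> ?D"
      using k by (intro CollectI exI[of _ "\<lambda>j. if j = k then x else 0"]) (auto intro: cfun.span_base cfun.span_zero)
  qed
  ultimately have "\<psi> \<in> ?D" using frames_span[OF assms] cfun.span_minimal by blast
  then show ?thesis using that by auto
qed

section \<open>Eigenspaces and independence of the products\<close>

lemma spin_span_frame:
  assumes "is_form \<phi>" "spin J \<phi> = sc (\<i> * c) \<phi>" "x \<in> cfun.span (set (frame J bs \<phi> k))"
  shows "is_form x" "spin J x = sc (\<i> * (c - of_nat k)) x"
proof -
  have "cfun.subspace {x. is_form x \<and> spin J x = sc (\<i> * (c - of_nat k)) x}"
    by (rule cfun.subspaceI) (auto simp: is_form_0 is_form_add is_form_sc clinear_simps[OF clinear_spin]
       cfun.scale_right_distrib mult.commute)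
  then have "cfun.span (set (frame J bs \<phi> k)) \<subseteq> {x. is_form x \<and> spin J x = sc (\<i> * (c - of_nat k)) x}"
    using spin_frame[OF assms(1,2)] is_form_frame[OF assms(1)] by (intro cfun.span_minimal) auto
  then show "is_form x" "spin J x = sc (\<i> * (c - of_nat k)) x" using assms(3) by auto
qed

text \<open>An eigenvector is decomposed along the frames. Subtracting it from the component with
  its own eigenvalue leaves a zero sum of eigenvectors for distinct eigenvalues, so that component
  is the eigenvector itself.\<close>

lemma eigenspace_eq_span_frame:
  assumes "vacuum \<phi>" "\<phi> \<noteq> 0" "span (set bs \<union> J ` set bs) = UNIV" "length bs = CARD('m)" "k \<le> CARD('m)"
  shows "{\<psi>. is_form \<psi> \<and> spin J \<psi> = sc (\<i> * (of_nat CARD('m) / 2 - of_nat k)) \<psi>} =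
    cfun.span (set (frame J bs \<phi> k))"
proof -
  let ?c = "of_nat CARD('m) / 2 :: complex"
  have f: "is_form \<phi>" using assms(1) by (simp add: vacuum_def)
  have e: "spin J \<phi> = sc (\<i> * ?c) \<phi>" using spin_vacuum[OF assms(1)] by simp
  note sp = spin_span_frame[OF f e]
  have "x \<in> {\<psi>. is_form \<psi> \<and> spin J \<psi> = sc (\<i> * (?c - of_nat k)) \<psi>}" if "x \<in> cfun.span (set (frame J bs \<phi> k))" for x
    using sp[OF that] by auto
  moreover have "x \<in> cfun.span (set (frame J bs \<phi> k))"
    if x: "x \<in> {\<psi>. is_form \<psi> \<and> spin J \<psi> = sc (\<i> * (?c - of_nat k)) \<psi>}" for x
  proof -
    obtain g where g: "\<And>k. g k \<in> cfun.span (set (frame J bs \<phi> k))" "x = (\<Sum>k\<le>length bs. g k)"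
      using frame_decomposition[OF assms(1-3), of x] x by auto
    have k: "k \<in> {..length bs}" using assms by simp
    have "g k - x = 0"
    proof -
      let ?\<psi> = "\<lambda>j. if j = k then g j - x else g j"
      have "?\<psi> k = 0"
      proof (rule eigenvectors_independent[where T = "spin J" and I = "{..length bs}" and \<psi> = ?\<psi>
          and \<mu> = "\<lambda>j. \<i> * (?c - of_nat j)", OF clinear_spin _ _ _ _ k])
        show "spin J (?\<psi> j) = sc (\<i> * (?c - of_nat j)) (?\<psi> j)" for j
          using sp(2)[OF g(1)[of j]] x by (auto simp: clinear_simps[OF clinear_spin] cfun.scale_right_diff_distrib)
        show "inj_on (\<lambda>j. \<i> * (?c - of_nat j)) {..length bs}" by (auto simp: inj_on_def)
        have "(\<Sum>j\<le>length bs. ?\<psi> j) = (\<Sum>j\<le>length bs. g j) - (\<Sum>j\<le>length bs. if j = k then x else 0)"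
          unfolding sum_subtractf[symmetric] by (rule sum.cong) auto
        then show "(\<Sum>j\<le>length bs. ?\<psi> j) = 0" using k by (simp flip: g(2))
      qed simp
      then show ?thesis by simp
    qed
    then show ?thesis using g(1)[of k] by simp
  qed
  ultimately show ?thesis by blast
qed

text \<open>\<open>eigenspace_eq_span_frame\<close> relies on spanning alone, so it may be used
  here, before any independence is known. Conjugating a vacuum negates its eigenvalue, which lands
  in the eigenspace of \<open>k = CARD('m)\<close>, spanned by the top product.\<close>

lemma full_neq_0:
  assumes "vacuum \<phi>" "\<phi> \<noteq> 0" "span (set bs \<union> J ` set bs) = UNIV" "length bs = CARD('m)"
  shows "full J \<i> bs \<phi> \<noteq> 0"
proof
  assume "full J \<i> bs \<phi> = 0"
  have "spin J (cj \<phi>) = sc (\<i> * (of_nat CARD('m) / 2 - of_nat CARD('m))) (cj \<phi>)"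
    unfolding spin_cj spin_vacuum[OF assms(1)] cj_simps by (simp add: field_simps)
  then have "cj \<phi> \<in> cfun.span (set (frame J bs \<phi> (length bs)))"
    using eigenspace_eq_span_frame[OF assms, of "CARD('m)"] assms by (auto simp: vacuum_def is_form_cj)
  then have "cj \<phi> = 0" using \<open>full J \<i> bs \<phi> = 0\<close> by (simp add: frame_length)
  then show False using assms(2) by simp
qed

text \<open>The relation is weakened by the factors \<open>pre\<close> already multiplied on, and
  only their product with the rest must be nonzero. A combination splits into products without and
  with \<open>b\<close>. Multiplying by \<open>b\<close> kills the second kind, so induction clears
  the coefficients of the first; then the second kind is treated with \<open>b\<close> moved into
  \<open>pre\<close>.\<close>

lemma frame_independent_aux:
  assumes "is_form \<phi>" "full J \<i> (pre @ bs) \<phi> \<noteq> 0" "full J \<i> pre (lcomb z (frame J bs \<phi> k)) = 0"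
    "j < length (frame J bs \<phi> k)"
  shows "z j = 0"
  using assms(2-)
proof (induction bs arbitrary: pre z k j)
  case Nil
  then have k: "k = 0" "j = 0" by (auto split: if_splits)
  have "sc (z 0) (full J \<i> pre \<phi>) = 0"
    using Nil.prems(2) unfolding k frame.simps if_P[OF refl] lcomb_single clinear_sc[OF clinear_full] .
  then have "z 0 = 0 \<or> full J \<i> pre \<phi> = 0" unfolding cfun.scale_eq_0_iff .
  then show ?case using Nil.prems(1) unfolding k append_Nil2 by blast
next
  case (Cons b bs)
  let ?A = "frame J bs \<phi> k" and ?B = "if k = 0 then [] else frame J bs \<phi> (k - 1)"
  let ?w = "\<lambda>j. z (j + length ?A)"
  let ?T = "tw J \<i> b"
  let ?F = "full J \<i> pre"
  have ff: "\<And>x. x \<in> set ?A \<Longrightarrow> is_form x" "\<And>x. x \<in> set ?B \<Longrightarrow> is_form x"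
    using is_form_frame[OF assms(1)] by (auto split: if_splits)
  have fA: "is_form (lcomb z ?A)"
    unfolding lcomb_def by (intro is_form_sum is_form_sc ff(1)) simp
  have fB: "is_form (lcomb ?w ?B)"
    unfolding lcomb_def by (intro is_form_sum is_form_sc ff(2)) (simp split: if_splits)
  have lc: "lcomb z (frame J (b # bs) \<phi> k) = lcomb z ?A + ?T (lcomb ?w ?B)"
    by (simp only: frame.simps lcomb_append lcomb_map[OF clinear_tw])
  have ne: "full J \<i> ((pre @ [b]) @ bs) \<phi> \<noteq> 0" using Cons.prems(1) by (simp only: full_simps not_False_eq_True)
  have z: "?F (lcomb z ?A) = - ?F (?T (lcomb ?w ?B))"
    using Cons.prems(2) unfolding lc clinear_add[OF clinear_full] by (rule eq_neg_iff_add_eq_0[THEN iffD2])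
  \<comment> \<open>Up to sign the outer factor passes \<open>?F\<close>, where it meets its own
    copy and squares to zero.\<close>
  have "?T (?F (?T (lcomb ?w ?B))) = 0"
    using tw_full_swap[OF is_form_tw[OF fB, of J \<i> b], of \<i> b pre] tw_square[OF fB, of \<i> b]
    by (simp add: clinear_simps[OF clinear_full])
  then have "?T (?F (lcomb z ?A)) = 0" by (simp only: z tw_simps) simp
  then have "?F (?T (lcomb z ?A)) = 0"
    using tw_full_swap[OF fA, of \<i> b pre] by simp
  then have "full J \<i> (pre @ [b]) (lcomb z ?A) = 0" by (simp only: full_simps)
  note A = Cons.IH[OF ne this]
  then have A0: "lcomb z ?A = 0" by (simp add: lcomb_def)
  have B: "?w i = 0" if i: "i < length ?B" for i
  proof -
    have k: "k \<noteq> 0" using i by (cases "k = 0") simp_all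
    have "?F (?T (lcomb ?w ?B)) = 0" using z A0 by (simp add: clinear_simps[OF clinear_full])
    then have "full J \<i> (pre @ [b]) (lcomb ?w (frame J bs \<phi> (k - 1))) = 0" using k by simp
    from Cons.IH[OF ne this] i k show ?thesis by simp
  qed
  show ?case
  proof (cases "j < length ?A")
    case False
    then have "j - length ?A < length ?B" using Cons.prems(3) by auto
    from B[OF this] False show ?thesis by simp
  qed (rule A)
qed

lemma frame_independent:
  assumes "vacuum \<phi>" "\<phi> \<noteq> 0" "span (set bs \<union> J ` set bs) = UNIV" "length bs = CARD('m)"
    "lcomb z (frame J bs \<phi> k) = 0" "j < length (frame J bs \<phi> k)"
  shows "z j = 0"
  using frame_independent_aux[of \<phi> "[]" bs z k j] full_neq_0[OF assms(1-4)] assms by (simp add: vacuum_def)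

end

section \<open>Smooth functions on open sets\<close>

text \<open>Spanning is an open condition. Each basis vector \<open>e\<close> is written with fixed
  coefficients in the limit vectors; \<open>B e x\<close>, the same combination at \<open>x\<close>,
  is close to \<open>e\<close>. The map sending each \<open>e\<close> to \<open>B e x\<close> is
  then close enough to the identity to be injective, hence onto.\<close>

lemma spanning_eventually:
  fixes b :: "'i \<Rightarrow> 'x \<Rightarrow> 'v::euclidean_space"
  assumes "finite I" "\<And>i. i \<in> I \<Longrightarrow> (b i \<longlongrightarrow> b0 i) F" "span (b0 ` I) = UNIV"
  shows "\<forall>\<^sub>F x in F. span ((\<lambda>i. b i x) ` I) = UNIV"
proof -
  \<comment> \<open>Different indices may have the same limit; passing to \<open>I'\<close> allows
    the sum over vectors to be reindexed.\<close>
  obtain I' where I': "I' \<subseteq> I" "b0 ` I = b0 ` I'" "inj_on b0 I'"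
    using subset_image_inj[of "b0 ` I" b0 I] by auto
  have fI': "finite I'" using I'(1) assms(1) finite_subset by blast
  have "\<forall>e. \<exists>c. e = (\<Sum>i\<in>I'. c i *\<^sub>R b0 i)"
  proof
    fix e
    have "e \<in> span (b0 ` I')" using assms(3) I'(2) by simp
    then obtain u where "e = (\<Sum>v\<in>b0 ` I'. u v *\<^sub>R v)"
      using span_finite[of "b0 ` I'"] fI' by auto
    then have "e = (\<Sum>i\<in>I'. u (b0 i) *\<^sub>R b0 i)" by (simp add: sum.reindex[OF I'(3)])
    then show "\<exists>c. e = (\<Sum>i\<in>I'. c i *\<^sub>R b0 i)" by (rule exI[of _ "\<lambda>i. u (b0 i)"])
  qed
  then obtain c where c: "\<And>e. e = (\<Sum>i\<in>I'. c e i *\<^sub>R b0 i)" by metis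
  define B where "B = (\<lambda>e x. \<Sum>i\<in>I'. c e i *\<^sub>R b i x)"
  have "((\<lambda>x. \<Sum>e\<in>Basis. norm (B e x - e)) \<longlongrightarrow> (\<Sum>e\<in>Basis. norm ((\<Sum>i\<in>I'. c e i *\<^sub>R b0 i) - e))) F"
    unfolding B_def using I'(1) by (intro tendsto_intros assms(2)) auto
  also have "(\<Sum>e\<in>Basis. norm ((\<Sum>i\<in>I'. c e i *\<^sub>R b0 i) - e)) = 0" by (simp flip: c)
  finally have "\<forall>\<^sub>F x in F. (\<Sum>e\<in>Basis. norm (B e x - e)) < 1"
    by (rule order_tendstoD) simp
  then show ?thesis
  proof (rule eventually_mono)
    fix x assume lt: "(\<Sum>e\<in>Basis. norm (B e x - e)) < 1"
    define T where "T = (\<lambda>u. \<Sum>e\<in>Basis. (u \<bullet> e) *\<^sub>R B e x)"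
    have T: "linear T"
      by (auto simp: T_def linear_iff inner_simps scaleR_left_distrib sum.distrib scaleR_sum_right)
    have "u = 0" if "T u = 0" for u
    proof (rule ccontr)
      assume "u \<noteq> 0"
      have "u = (\<Sum>e\<in>Basis. (u \<bullet> e) *\<^sub>R e)" by (simp add: euclidean_representation)
      then have "u = (\<Sum>e\<in>Basis. (u \<bullet> e) *\<^sub>R e) - T u" using that by simp
      also have "\<dots> = (\<Sum>e\<in>Basis. (u \<bullet> e) *\<^sub>R (e - B e x))"
        by (simp add: T_def sum_subtractf scaleR_diff_right)
      finally have "norm u \<le> (\<Sum>e\<in>Basis. norm ((u \<bullet> e) *\<^sub>R (e - B e x)))" by (metis norm_sum)
      also have "\<dots> \<le> (\<Sum>e\<in>Basis. norm u * norm (B e x - e))"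
        by (intro sum_mono) (auto simp: norm_minus_commute Basis_le_norm intro!: mult_right_mono)
      also have "\<dots> < norm u * 1"
        unfolding sum_distrib_left[symmetric] using lt \<open>u \<noteq> 0\<close> by (intro mult_strict_left_mono) auto
      finally show False by simp
    qed
    then have "surj T"
      using linear_injective_imp_surjective[OF T] linear_injective_0[OF T] by blast
    moreover have "T u \<in> span ((\<lambda>i. b i x) ` I)" for u
      unfolding T_def B_def using I'(1) by (intro span_sum span_scale span_base) auto
    ultimately show "span ((\<lambda>i. b i x) ` I) = UNIV" by (metis UNIV_eq_I surjD)
  qed
qed

lemma complex_basis_exists:
  fixes J :: "'v::euclidean_space \<Rightarrow> 'v"
  assumes J: "linear J" "\<And>v. J (J v) = - v" and n: "DIM('v) = 2 * n"
  obtains bs where "length bs = n" "span (set bs \<union> J ` set bs) = UNIV"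
proof -
  have "\<exists>bs. length bs = k \<and> dim (set bs \<union> J ` set bs) = 2 * k" if "k \<le> n" for k
    using that
  proof (induction k)
    case (Suc k)
    then obtain bs where bs: "length bs = k" "dim (set bs \<union> J ` set bs) = 2 * k" by auto
    define S where "S = set bs \<union> J ` set bs"
    have JS: "J w \<in> span S" if "w \<in> span S" for w
    proof -
      have "J ` span S = span (J ` S)" by (rule span_linear_image[OF J(1), symmetric])
      also have "\<dots> \<subseteq> span S"
        by (rule span_minimal) (auto simp: S_def image_Un image_image J(2) intro: span_base span_neg)
      finally show ?thesis using that by auto
    qed
    have "span S \<noteq> UNIV" using Suc.prems bs(2) n by (metis S_def dim_UNIV dim_span lessI mult_less_cancel1 not_le zero_less_numeral)
    then obtain v where v: "v \<notin> span S" by auto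
    have "J v \<notin> span (insert v S)"
    proof
      assume "J v \<in> span (insert v S)"
      then obtain t where t: "J v - t *\<^sub>R v \<in> span S" by (auto simp: span_breakdown_eq)
      define d where "d = - (1 + t * t)"
      have "d \<noteq> 0" unfolding d_def by (metis add_nonneg_eq_0_iff neg_equal_0_iff_equal zero_le_one zero_le_square zero_neq_one)
      \<comment> \<open>If \<open>J v - t v\<close> lay in the span, so would its image under
        \<open>J + t\<close>, which is \<open>v\<close> times the nonzero number -(1 + t^2).\<close>
      have "J (J v - t *\<^sub>R v) + t *\<^sub>R (J v - t *\<^sub>R v) \<in> span S"
        by (intro span_add span_scale JS t)
      also have "J (J v - t *\<^sub>R v) + t *\<^sub>R (J v - t *\<^sub>R v) = (- (1 + t * t)) *\<^sub>R v"
        by (simp add: linear_diff[OF J(1)] linear_scale[OF J(1)] J(2) algebra_simps)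
      finally have "d *\<^sub>R v \<in> span S" by (simp add: d_def)
      then have "(1 / d) *\<^sub>R (d *\<^sub>R v) \<in> span S" by (rule span_scale)
      then show False using v \<open>d \<noteq> 0\<close> by simp
    qed
    then have "dim (insert (J v) (insert v S)) = 2 * Suc k"
      using v bs(2) by (simp add: dim_insert S_def)
    moreover have "insert (J v) (insert v S) = set (v # bs) \<union> J ` set (v # bs)" by (auto simp: S_def)
    ultimately show ?case using bs(1) by (intro exI[of _ "v # bs"]) simp
  qed simp
  from this[of n] obtain bs where "length bs = n" "dim (set bs \<union> J ` set bs) = DIM('v)" using n by auto
  then show ?thesis using that[of bs] dim_eq_full by blast
qed

section \<open>Closure properties of smooth functions\<close>

lemma Ck_on_cong:
  assumes "open S" "\<And>x. x \<in> S \<Longrightarrow> f x = g x" "Ck_on k S f"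
  shows "Ck_on k S g"
  using assms(2,3)
proof (induction k arbitrary: f g)
  case 0
  then show ?case by (metis Ck_on.simps(1) continuous_on_cong)
next
  case (Suc k)
  have d: "f differentiable (at x)" if "x \<in> S" for x using Suc.prems(2) that by simp
  have e: "frechet_derivative f (at x) = frechet_derivative g (at x)" if "x \<in> S" for x
    by (rule frechet_derivative_transform_within_open[OF d[OF that] assms(1) that Suc.prems(1)])
  have "g differentiable (at x)" if "x \<in> S" for x
    using has_derivative_transform_within_open[of f _ x UNIV S g, OF _ assms(1) that Suc.prems(1)] d[OF that]
    unfolding differentiable_def by blast
  moreover have "Ck_on k S (\<lambda>x. frechet_derivative g (at x) v)" for v
    by (rule Suc.IH[of "\<lambda>x. frechet_derivative f (at x) v"]) (use Suc.prems e in auto)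
  ultimately show ?case by simp
qed

lemma Ck_on_Suc_imp: "Ck_on (Suc k) S f \<Longrightarrow> Ck_on k S f"
proof (induction k arbitrary: f)
  case 0
  then show ?case
    by (metis Ck_on.simps continuous_on_eq_continuous_within differentiable_at_withinI differentiable_imp_continuous_within)
next
  case (Suc k)
  then show ?case by (metis Ck_on.simps(2))
qed

lemma Ck_on_subset: "Ck_on k S f \<Longrightarrow> T \<subseteq> S \<Longrightarrow> Ck_on k T f"
  by (induction k arbitrary: f) (auto intro: continuous_on_subset)

text \<open>By uniqueness of derivatives an explicit \<open>f'\<close> may replace
  \<open>frechet_derivative\<close>, so the inductions on \<open>k\<close> can work with the usual
  differentiation rules.\<close>

lemma Ck_on_SucI:
  assumes "open S" "\<And>x. x \<in> S \<Longrightarrow> (f has_derivative f' x) (at x)" "\<And>v. Ck_on k S (\<lambda>x. f' x v)"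
  shows "Ck_on (Suc k) S f"
proof -
  have "frechet_derivative f (at x) = f' x" if "x \<in> S" for x
    using frechet_derivative_at[OF assms(2)[OF that]] by simp
  then have "Ck_on k S (\<lambda>x. frechet_derivative f (at x) v)" for v
    by (intro Ck_on_cong[OF assms(1) _ assms(3)[of v]]) simp
  then show ?thesis using assms(2) by (auto simp: differentiable_def)
qed

lemma Ck_on_SucD:
  assumes "Ck_on (Suc k) S f"
  shows "x \<in> S \<Longrightarrow> (f has_derivative frechet_derivative f (at x)) (at x)"
    "Ck_on k S (\<lambda>x. frechet_derivative f (at x) v)" "Ck_on k S f"
  using assms Ck_on_Suc_imp[OF assms] by (auto simp: frechet_derivative_works)

lemma Ck_on_const: "open S \<Longrightarrow> Ck_on k S (\<lambda>x. c)"
proof (induction k arbitrary: c)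
  case (Suc k)
  then show ?case by (intro Ck_on_SucI[of S _ "\<lambda>x v. 0"]) auto
qed auto

lemma Ck_on_bounded_linear:
  assumes "open S" "bounded_linear h" "Ck_on k S f"
  shows "Ck_on k S (\<lambda>x. h (f x))"
  using assms(3)
proof (induction k arbitrary: f)
  case 0
  then show ?case by (auto intro: bounded_linear.continuous_on[OF assms(2)])
next
  case (Suc k)
  show ?case
    by (rule Ck_on_SucI[OF assms(1) bounded_linear.has_derivative[OF assms(2) Ck_on_SucD(1)[OF Suc.prems]]])
      (auto intro: Suc.IH Ck_on_SucD(2)[OF Suc.prems])
qed

lemma Ck_on_ident: "open S \<Longrightarrow> Ck_on k S (\<lambda>x. x)"
proof (cases k)
  case (Suc k')
  assume "open S"
  then show ?thesis unfolding Suc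
    by (intro Ck_on_SucI[of S _ "\<lambda>x v. v"] Ck_on_const) auto
qed auto

lemma Ck_on_add:
  assumes "open S" "Ck_on k S f" "Ck_on k S g"
  shows "Ck_on k S (\<lambda>x. f x + g x)"
  using assms(2,3)
proof (induction k arbitrary: f g)
  case 0 then show ?case by (auto intro: continuous_on_add)
next
  case (Suc k)
  show ?case
    by (rule Ck_on_SucI[OF assms(1) has_derivative_add[OF Ck_on_SucD(1)[OF Suc.prems(1)] Ck_on_SucD(1)[OF Suc.prems(2)]]])
      (auto intro: Suc.IH Ck_on_SucD(2)[OF Suc.prems(1)] Ck_on_SucD(2)[OF Suc.prems(2)])
qed

lemma Ck_on_bilinear:
  assumes "open S" "bounded_bilinear pr" "Ck_on k S f" "Ck_on k S g"
  shows "Ck_on k S (\<lambda>x. pr (f x) (g x))"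
  using assms(3,4)
proof (induction k arbitrary: f g)
  case 0 then show ?case by (auto intro: bounded_bilinear.continuous_on[OF assms(2)])
next
  case (Suc k)
  show ?case
    by (rule Ck_on_SucI[OF assms(1) bounded_bilinear.FDERIV[OF assms(2) Ck_on_SucD(1)[OF Suc.prems(1)] Ck_on_SucD(1)[OF Suc.prems(2)]]])
      (auto intro!: Ck_on_add[OF assms(1)] Suc.IH Ck_on_SucD(2,3)[OF Suc.prems(1)] Ck_on_SucD(2,3)[OF Suc.prems(2)])
qed

lemma Ck_on_sum:
  assumes "open S" "\<And>i. i \<in> I \<Longrightarrow> Ck_on k S (f i)"
  shows "Ck_on k S (\<lambda>x. \<Sum>i\<in>I. f i x)"
  using assms(2)
  by (induction I rule: infinite_finite_induct) (auto intro: Ck_on_const Ck_on_add assms(1))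

text \<open>\<open>Ck_on\<close> speaks of derivatives in a fixed direction, whereas the chain rule
  evaluates the derivative of \<open>f\<close> in a direction moving with \<open>x\<close>.
  Expanding that direction in the Euclidean basis restores fixed directions and lets the induction
  hypothesis apply.\<close>

lemma Ck_on_compose:
  fixes f :: "'e::euclidean_space \<Rightarrow> 'c::real_normed_vector" and g :: "'b::real_normed_vector \<Rightarrow> 'e"
  assumes "open S" "open T" "g ` S \<subseteq> T" "Ck_on k T f" "Ck_on k S g"
  shows "Ck_on k S (\<lambda>x. f (g x))"
  using assms(4,5)
proof (induction k arbitrary: f)
  case 0
  then show ?case using assms(3) by (auto intro: continuous_on_compose2)
next
  case (Suc k)
  let ?Df = "\<lambda>y. frechet_derivative f (at y)" and ?Dg = "\<lambda>x. frechet_derivative g (at x)"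
  show ?case
  proof (rule Ck_on_SucI[OF assms(1), of _ "\<lambda>x v. \<Sum>i\<in>Basis. (?Dg x v \<bullet> i) *\<^sub>R ?Df (g x) i"])
    fix x assume x: "x \<in> S"
    then have gx: "g x \<in> T" using assms(3) by auto
    have f: "(f has_derivative ?Df (g x)) (at (g x))" by (rule Ck_on_SucD(1)[OF Suc.prems(1) gx])
    have lin: "linear (?Df (g x))" using f by (simp add: has_derivative_linear)
    have "((\<lambda>x. f (g x)) has_derivative (\<lambda>v. ?Df (g x) (?Dg x v))) (at x)"
      by (rule has_derivative_compose[OF Ck_on_SucD(1)[OF Suc.prems(2) x] f])
    also have "(\<lambda>v. ?Df (g x) (?Dg x v)) = (\<lambda>v. \<Sum>i\<in>Basis. (?Dg x v \<bullet> i) *\<^sub>R ?Df (g x) i)"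
    proof
      fix v
      have "?Df (g x) (?Dg x v) = ?Df (g x) (\<Sum>i\<in>Basis. (?Dg x v \<bullet> i) *\<^sub>R i)"
        by (simp only: euclidean_representation)
      then show "?Df (g x) (?Dg x v) = (\<Sum>i\<in>Basis. (?Dg x v \<bullet> i) *\<^sub>R ?Df (g x) i)"
        by (simp only: linear_sum[OF lin] linear_scale[OF lin])
    qed
    finally show "((\<lambda>x. f (g x)) has_derivative (\<lambda>v. \<Sum>i\<in>Basis. (?Dg x v \<bullet> i) *\<^sub>R ?Df (g x) i)) (at x)" .
  next
    fix v
    show "Ck_on k S (\<lambda>x. \<Sum>i\<in>Basis. (?Dg x v \<bullet> i) *\<^sub>R ?Df (g x) i)"
      by (intro Ck_on_sum[OF assms(1)] Ck_on_bilinear[OF assms(1) bounded_bilinear_scaleR]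
          Ck_on_bounded_linear[OF assms(1) bounded_linear_inner_left] Ck_on_SucD(2)[OF Suc.prems(2)]
          Suc.IH Ck_on_SucD(2)[OF Suc.prems(1)] Ck_on_SucD(3)[OF Suc.prems(2)])
  qed
qed

lemma smooth_on_cong: "open S \<Longrightarrow> (\<And>x. x \<in> S \<Longrightarrow> f x = g x) \<Longrightarrow> smooth_on S f \<Longrightarrow> smooth_on S g"
  unfolding smooth_on_def by (metis Ck_on_cong)

lemma smooth_on_subset: "smooth_on S f \<Longrightarrow> T \<subseteq> S \<Longrightarrow> smooth_on T f"
  unfolding smooth_on_def by (metis Ck_on_subset)

lemma smooth_on_const: "open S \<Longrightarrow> smooth_on S (\<lambda>x. c)"
  by (simp add: smooth_on_def Ck_on_const)

lemma smooth_on_ident: "open S \<Longrightarrow> smooth_on S (\<lambda>x. x)"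
  by (simp add: smooth_on_def Ck_on_ident)

lemma smooth_on_bounded_linear:
  "open S \<Longrightarrow> bounded_linear h \<Longrightarrow> smooth_on S f \<Longrightarrow> smooth_on S (\<lambda>x. h (f x))"
  by (simp add: smooth_on_def Ck_on_bounded_linear)

lemma smooth_on_add: "open S \<Longrightarrow> smooth_on S f \<Longrightarrow> smooth_on S g \<Longrightarrow> smooth_on S (\<lambda>x. f x + g x)"
  by (simp add: smooth_on_def Ck_on_add)

lemma smooth_on_bilinear:
  "open S \<Longrightarrow> bounded_bilinear pr \<Longrightarrow> smooth_on S f \<Longrightarrow> smooth_on S g \<Longrightarrow> smooth_on S (\<lambda>x. pr (f x) (g x))"
  by (simp add: smooth_on_def Ck_on_bilinear)

lemma smooth_on_mult:
  fixes f g :: "'b::real_normed_vector \<Rightarrow> 'c::real_normed_algebra"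
  shows "open S \<Longrightarrow> smooth_on S f \<Longrightarrow> smooth_on S g \<Longrightarrow> smooth_on S (\<lambda>x. f x * g x)"
  by (rule smooth_on_bilinear[OF _ bounded_bilinear_mult])

lemma smooth_on_sum:
  "open S \<Longrightarrow> (\<And>i. i \<in> I \<Longrightarrow> smooth_on S (f i)) \<Longrightarrow> smooth_on S (\<lambda>x. \<Sum>i\<in>I. f i x)"
  by (simp add: smooth_on_def Ck_on_sum)

lemma smooth_on_compose:
  fixes f :: "'e::euclidean_space \<Rightarrow> 'c::real_normed_vector"
  shows "open S \<Longrightarrow> open T \<Longrightarrow> g ` S \<subseteq> T \<Longrightarrow> smooth_on T f \<Longrightarrow> smooth_on S g \<Longrightarrow> smooth_on S (\<lambda>x. f (g x))"
  by (simp add: smooth_on_def Ck_on_compose)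

lemma smooth_on_has_derivative:
  "smooth_on S f \<Longrightarrow> x \<in> S \<Longrightarrow> (f has_derivative frechet_derivative f (at x)) (at x)"
  unfolding smooth_on_def using Ck_on_SucD(1) by blast

lemma smooth_on_frechet_derivative:
  "smooth_on S f \<Longrightarrow> smooth_on S (\<lambda>x. frechet_derivative f (at x) v)"
  unfolding smooth_on_def using Ck_on_SucD(2) by blast

lemma smooth_on_continuous_on: "smooth_on S f \<Longrightarrow> continuous_on S f"
  unfolding smooth_on_def using Ck_on.simps(1) by blast

lemma bounded_linear_axis: "bounded_linear (axis i :: 'c::real_normed_vector \<Rightarrow> 'c^'m::finite)"
proof (rule bounded_linear_intro[where K = 1])
  show "axis i (x + y) = axis i x + axis i y" for x y :: 'c by (simp add: vec_eq_iff axis_def)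
  show "axis i (r *\<^sub>R x) = r *\<^sub>R axis i x" for r and x :: 'c by (simp add: vec_eq_iff axis_def)
  show "norm (axis i x) \<le> norm x * 1" for x :: 'c
    using L2_set_le_sum[of UNIV "\<lambda>j. norm (axis i x $ j)"]
    by (simp add: norm_vec_def axis_def if_distrib cong: if_cong)
qed

lemma smooth_on_vec:
  fixes f :: "'m::finite \<Rightarrow> 'b::real_normed_vector \<Rightarrow> 'c::real_normed_vector"
  assumes "open S" "\<And>i. smooth_on S (f i)"
  shows "smooth_on S (\<lambda>x. \<chi> i. f i x)"
proof -
  have "(\<lambda>x. \<chi> i. f i x) = (\<lambda>x. \<Sum>i\<in>UNIV. axis i (f i x))"
    by (auto simp: vec_eq_iff axis_def fun_eq_iff if_distrib cong: if_cong)
  then show ?thesis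
    by (simp only:) (intro smooth_on_sum smooth_on_bounded_linear[OF _ bounded_linear_axis] assms)
qed

lemma smooth_on_Pair:
  assumes "open S" "smooth_on S f" "smooth_on S g"
  shows "smooth_on S (\<lambda>x. (f x, g x))"
proof -
  have "(\<lambda>x. (f x, g x)) = (\<lambda>x. (f x, 0) + (0, g x))" by simp
  then show ?thesis
    by (simp only:) (intro smooth_on_add smooth_on_bounded_linear[of S "\<lambda>y. (y, 0)"]
      smooth_on_bounded_linear[of S "\<lambda>y. (0, y)"] assms bounded_linear_Pair bounded_linear_ident bounded_linear_zero)
qed

lemma smooth_on_fst: "open S \<Longrightarrow> smooth_on S f \<Longrightarrow> smooth_on S (\<lambda>x. fst (f x))"
  and smooth_on_snd: "open S \<Longrightarrow> smooth_on S f \<Longrightarrow> smooth_on S (\<lambda>x. snd (f x))"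
  by (auto intro: smooth_on_bounded_linear bounded_linear_fst bounded_linear_snd)

lemma smooth_on_vec_nth: "open S \<Longrightarrow> smooth_on S f \<Longrightarrow> smooth_on S (\<lambda>x. f x $ i)"
  by (rule smooth_on_bounded_linear[OF _ bounded_linear_vec_nth])

lemma smooth_on_of_real:
  "open S \<Longrightarrow> smooth_on S f \<Longrightarrow> smooth_on S (\<lambda>x. of_real (f x) :: 'c::real_normed_algebra_1)"
  by (rule smooth_on_bounded_linear[OF _ bounded_linear_of_real])

section \<open>Sections and forms in charts\<close>

text \<open>The transition map of the bundle: vectors transform by the Jacobian, covectors by the
  transposed Jacobian of the inverse change of coordinates.\<close>

definition chg :: "('a, 'm::finite) chart \<Rightarrow> ('a, 'm) chart \<Rightarrow> 'a \<Rightarrow> ('k::real_normed_field, 'm) TT \<Rightarrow> ('k, 'm) TT" where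
  "chg c d p v = (\<chi> i. \<Sum>j\<in>UNIV. of_real (jacobian c d p $ i $ j) * fst v $ j,
                  \<chi> i. \<Sum>j\<in>UNIV. of_real (jacobian d c p $ j $ i) * snd v $ j)"

lemma sect_in_chart_eq: "sect_in_chart \<A> c s x = chg (chart_at \<A> (chart_inv c x)) c (chart_inv c x) (s (chart_inv c x))"
  by (simp add: sect_in_chart_def chg_def Let_def)

lemma linear_chg: "linear (chg c d p)"
  by (rule linearI)
     (simp_all add: chg_def vec_eq_iff algebra_simps sum.distrib scaleR_sum_right)

definition pull :: "real^'m^'m \<Rightarrow> ('m::finite, 'k) form \<Rightarrow> ('m, 'k) form" where
  "pull a \<phi> vs = \<phi> (map (\<lambda>v. a *v v) vs)"

lemma form_in_chart_eq:
  "form_in_chart \<A> c \<omega> x = pull (jacobian c (chart_at \<A> (chart_inv c x)) (chart_inv c x)) (\<omega> (chart_inv c x))"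
  by (rule ext) (simp add: form_in_chart_def pull_def Let_def)

lemma pull_mat_1 [simp]: "pull (mat 1) \<phi> = \<phi>"
  by (rule ext) (simp add: pull_def)

lemma pull_pull: "pull a (pull b \<phi>) = pull (b ** a) \<phi>"
  by (rule ext) (simp add: pull_def o_def matrix_vector_mul_assoc)

lemma is_form_pull: "is_form \<phi> \<Longrightarrow> is_form (pull a \<phi>)"
proof (rule is_formI)
  fix us ws assume "is_form \<phi>"
  from linear_compose[OF matrix_vector_mul_linear is_form_linear[OF this]]
  show "linear (\<lambda>v. pull a \<phi> (us @ v # ws))" by (simp add: pull_def o_def)
next
  fix vs :: "(real^'a) list" assume "is_form \<phi>" "\<not> distinct vs"
  then show "pull a \<phi> vs = 0" unfolding pull_def by (intro is_form_not_distinct) (auto simp: distinct_map)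
qed

lemma ins_pull: "ins v (pull a \<phi>) = pull a (ins (a *v v) \<phi>)"
  by (rule ext) (simp add: ins_apply pull_def)

lemma pull_wedge1: "pull a (wedge1 \<xi> \<phi>) = wedge1 (\<chi> i. \<Sum>j\<in>UNIV. of_real (a $ j $ i) * \<xi> $ j) (pull a \<phi>)"
proof
  fix vs
  have c: "covec \<xi> (a *v v) = covec (\<chi> i. \<Sum>j\<in>UNIV. of_real (a $ j $ i) * \<xi> $ j) v" for v
    unfolding covec_def matrix_vector_mult_def
    by (simp add: sum_distrib_left sum_distrib_right, subst sum.swap) (simp add: algebra_simps)
  show "pull a (wedge1 \<xi> \<phi>) vs = wedge1 (\<chi> i. \<Sum>j\<in>UNIV. of_real (a $ j $ i) * \<xi> $ j) (pull a \<phi>) vs"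
  proof (induction vs arbitrary: \<phi>)
    case (Cons v vs)
    show ?case
      using Cons[of "ins (a *v v) \<phi>"] by (simp add: pull_def[of a "wedge1 \<xi> _"] wedge1_Cons c ins_pull) (simp add: pull_def)
  qed (simp add: pull_def)
qed

text \<open>Evaluating a pulled-back form pushes its arguments forward by \<open>a\<close>, so
  \<open>X\<close> itself has to be moved back by the inverse \<open>b\<close>.\<close>

lemma pull_contract:
  assumes "is_form \<phi>" "a ** b = mat 1"
  shows "pull a (contract X \<phi>) = contract (\<chi> i. \<Sum>j\<in>UNIV. of_real (b $ i $ j) * X $ j) (pull a \<phi>)"
proof
  fix vs
  let ?w = "map ((*v) a) vs"
  have ab: "(\<Sum>i\<in>UNIV. a $ k $ i * b $ i $ j) = (if k = j then 1 else 0)" for k j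
    using arg_cong[OF assms(2), of "\<lambda>m. m $ k $ j"] by (simp add: matrix_matrix_mult_def mat_def)
  have ax: "(a *v axis i 1) $ k = a $ k $ i" for i k
    by (simp add: matrix_vector_mult_def axis_def if_distrib cong: if_cong)
  have "contract (\<chi> i. \<Sum>j\<in>UNIV. of_real (b $ i $ j) * X $ j) (pull a \<phi>) vs =
      (\<Sum>i\<in>UNIV. (\<Sum>j\<in>UNIV. of_real (b $ i $ j) * X $ j) * (\<Sum>k\<in>UNIV. of_real (a $ k $ i) * \<phi> (axis k 1 # ?w)))"
    by (simp add: contract_def pull_def linear_form_vec[OF is_form_linear0[OF assms(1)], of "a *v _"] ax)
  also have "\<dots> = (\<Sum>i\<in>UNIV. \<Sum>j\<in>UNIV. \<Sum>k\<in>UNIV. of_real (a $ k $ i * b $ i $ j) * X $ j * \<phi> (axis k 1 # ?w))"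
    by (simp add: sum_product algebra_simps)
  also have "\<dots> = (\<Sum>j\<in>UNIV. \<Sum>k\<in>UNIV. \<Sum>i\<in>UNIV. of_real (a $ k $ i * b $ i $ j) * X $ j * \<phi> (axis k 1 # ?w))"
    by (rule trans[OF sum.swap]) (intro sum.cong refl sum.swap)
  also have "\<dots> = (\<Sum>j\<in>UNIV. \<Sum>k\<in>UNIV. of_real (\<Sum>i\<in>UNIV. a $ k $ i * b $ i $ j) * X $ j * \<phi> (axis k 1 # ?w))"
    by (simp add: sum_distrib_right)
  also have "\<dots> = contract X \<phi> ?w"
    unfolding ab by (simp add: contract_def if_distrib if_distribR cong: if_cong)
  finally show "pull a (contract X \<phi>) vs = contract (\<chi> i. \<Sum>j\<in>UNIV. of_real (b $ i $ j) * X $ j) (pull a \<phi>) vs"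
    by (simp add: pull_def)
qed

lemma clifford_eq: "clifford v \<phi> = contract (fst v) \<phi> + wedge1 (snd v) \<phi>"
  by (rule ext) (simp add: clifford_def)

lemma smooth_on_form_pull:
  fixes a :: "real^'m \<Rightarrow> real^'m::finite^'m"
  assumes "open S" "\<And>i j. smooth_on S (\<lambda>x. a x $ i $ j)" "is_form \<phi>"
  shows "smooth_on S (\<lambda>x. pull (a x) \<phi> vs :: complex)"
  using assms(3)
proof (induction vs arbitrary: \<phi>)
  case Nil then show ?case by (simp add: pull_def smooth_on_const assms(1))
next
  case (Cons v vs)
  have "pull (a x) \<phi> (v # vs) = (\<Sum>k\<in>UNIV. of_real (\<Sum>j\<in>UNIV. a x $ k $ j * v $ j) * pull (a x) (ins (axis k 1) \<phi>) vs)" for x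
    by (simp add: pull_def ins_apply linear_form_vec[OF is_form_linear0[OF Cons.prems], of "a x *v v"])
       (simp add: matrix_vector_mult_def)
  then show ?case
    by (simp only:) (intro smooth_on_sum smooth_on_mult smooth_on_of_real smooth_on_const assms(1,2) Cons.IH is_form_ins Cons.prems)
qed

section \<open>Coordinate changes and smoothness on the manifold\<close>

locale smooth_manifold =
  fixes \<A> :: "('a::{t2_space, second_countable_topology}, 'm::finite) chart set"
  assumes atlas: "smooth_atlas \<A>"
begin

lemma chart_at: "chart_at \<A> p \<in> \<A>" "p \<in> fst (chart_at \<A> p)"
proof -
  have "\<exists>c. c \<in> \<A> \<and> p \<in> fst c" using atlas unfolding smooth_atlas_def by (metis UN_E UNIV_I)
  from someI_ex[OF this] show "chart_at \<A> p \<in> \<A>" "p \<in> fst (chart_at \<A> p)" by (auto simp: chart_at_def)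
qed

context
  fixes c assumes c: "c \<in> \<A>"
begin

lemma open_dom: "open (fst c)" and open_img: "open (snd c ` fst c)"
  and chart_homeo: "homeomorphism (fst c) (snd c ` fst c) (snd c) (chart_inv c)"
  using atlas c by (auto simp: smooth_atlas_def)

lemma chart_inv_chart [simp]: "p \<in> fst c \<Longrightarrow> chart_inv c (snd c p) = p"
  by (rule homeomorphism_apply1[OF chart_homeo])

lemma open_chart_image: assumes "open V" shows "open (snd c ` (fst c \<inter> V))"
proof -
  have "openin (top_of_set (snd c ` fst c)) (snd c ` (fst c \<inter> V))"
    by (rule homeomorphism_imp_open_map[OF chart_homeo]) (simp add: assms openin_open_Int)
  then show ?thesis using open_img openin_open_trans by blast
qed

lemma open_chart_vimage: assumes "open N" shows "open {q \<in> fst c. snd c q \<in> N}"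
proof -
  have "continuous_on (fst c) (snd c)" using chart_homeo by (simp add: homeomorphism_def)
  from continuous_open_preimage[OF this open_dom assms]
  have "open (fst c \<inter> snd c -` N)" .
  also have "fst c \<inter> snd c -` N = {q \<in> fst c. snd c q \<in> N}" by blast
  finally show ?thesis .
qed

lemma jacobian_has_derivative:
  assumes d: "d \<in> \<A>" and p: "p \<in> fst c" "p \<in> fst d"
  shows "((snd d \<circ> chart_inv c) has_derivative (\<lambda>v. jacobian c d p *v v)) (at (snd c p))"
proof -
  have sm: "smooth_on (snd c ` (fst c \<inter> fst d)) (snd d \<circ> chart_inv c)"
    using atlas c d by (auto simp: smooth_atlas_def)
  have D: "((snd d \<circ> chart_inv c) has_derivative frechet_derivative (snd d \<circ> chart_inv c) (at (snd c p))) (at (snd c p))"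
    by (rule smooth_on_has_derivative[OF sm]) (use p in auto)
  then show ?thesis
    unfolding jacobian_def by (simp add: matrix_works has_derivative_linear)
qed

end

lemma transition_smooth:
  "c \<in> \<A> \<Longrightarrow> d \<in> \<A> \<Longrightarrow> smooth_on (snd c ` (fst c \<inter> fst d)) (snd d \<circ> chart_inv c)"
  using atlas by (auto simp: smooth_atlas_def)

lemma jacobian_cocycle:
  assumes "c \<in> \<A>" "d \<in> \<A>" "e \<in> \<A>" "p \<in> fst c" "p \<in> fst d" "p \<in> fst e"
  shows "jacobian d e p ** jacobian c d p = jacobian c e p"
proof -
  let ?S = "snd c ` (fst c \<inter> fst d)"
  have g: "((snd e \<circ> chart_inv d) has_derivative (\<lambda>v. jacobian d e p *v v)) (at ((snd d \<circ> chart_inv c) (snd c p)))"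
    using jacobian_has_derivative[of d e p] assms by simp
  have "((\<lambda>x. (snd e \<circ> chart_inv d) ((snd d \<circ> chart_inv c) x)) has_derivative
      (\<lambda>v. jacobian d e p *v (jacobian c d p *v v))) (at (snd c p))"
    by (rule has_derivative_compose[OF jacobian_has_derivative[OF assms(1,2,4,5)] g])
  then have "((snd e \<circ> chart_inv c) has_derivative (\<lambda>v. jacobian d e p *v (jacobian c d p *v v))) (at (snd c p))"
  proof (rule has_derivative_transform_within_open[where s = ?S])
    show "open ?S" by (rule open_chart_image[OF assms(1) open_dom[OF assms(2)]])
    show "snd c p \<in> ?S" using assms by auto
    show "(snd e \<circ> chart_inv d) ((snd d \<circ> chart_inv c) x) = (snd e \<circ> chart_inv c) x" if "x \<in> ?S" for x
      using that assms by auto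
  qed
  then have "(\<lambda>v. jacobian d e p *v (jacobian c d p *v v)) = (\<lambda>v. jacobian c e p *v v)"
    using jacobian_has_derivative[OF assms(1,3,4,6)] has_derivative_unique by blast
  then show ?thesis
    by (simp add: matrix_vector_mul_assoc matrix_eq fun_eq_iff)
qed

lemma jacobian_self:
  assumes "c \<in> \<A>" "p \<in> fst c" shows "jacobian c c p = mat 1"
proof -
  have "((\<lambda>x. x) has_derivative (\<lambda>v. v)) (at (snd c p))" by simp
  then have "((snd c \<circ> chart_inv c) has_derivative (\<lambda>v. v)) (at (snd c p))"
  proof (rule has_derivative_transform_within_open[where s = "snd c ` fst c"])
    show "open (snd c ` fst c)" by (rule open_img[OF assms(1)])
  qed (use assms in auto)
  then have "(\<lambda>v. jacobian c c p *v v) = (\<lambda>v. v)"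
    using jacobian_has_derivative[OF assms(1,1,2,2)] has_derivative_unique by blast
  then show ?thesis by (simp add: matrix_eq fun_eq_iff)
qed

lemma smooth_jacobian:
  assumes "c \<in> \<A>" "d \<in> \<A>"
  shows "smooth_on (snd c ` (fst c \<inter> fst d)) (\<lambda>x. jacobian c d (chart_inv c x) $ i $ j)"
proof (rule smooth_on_cong[OF open_chart_image[OF assms(1) open_dom[OF assms(2)]]])
  show "smooth_on (snd c ` (fst c \<inter> fst d)) (\<lambda>x. frechet_derivative (snd d \<circ> chart_inv c) (at x) (axis j 1) $ i)"
    by (intro smooth_on_vec_nth smooth_on_frechet_derivative transition_smooth open_chart_image open_dom assms)
qed (use assms in \<open>auto simp: jacobian_def matrix_def\<close>)

lemma smooth_transition_compose:
  assumes "c \<in> \<A>" "d \<in> \<A>" "smooth_on (snd d ` (fst c \<inter> fst d)) f"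
  shows "smooth_on (snd c ` (fst c \<inter> fst d)) (\<lambda>x. f (snd d (chart_inv c x)))"
proof (rule smooth_on_compose[OF _ _ _ assms(3)])
  show "open (snd c ` (fst c \<inter> fst d))" by (rule open_chart_image[OF assms(1) open_dom[OF assms(2)]])
  show "open (snd d ` (fst c \<inter> fst d))"
    using open_chart_image[OF assms(2) open_dom[OF assms(1)]] by (simp add: Int_commute)
  show "(\<lambda>x. snd d (chart_inv c x)) ` snd c ` (fst c \<inter> fst d) \<subseteq> snd d ` (fst c \<inter> fst d)"
    using assms by auto
  show "smooth_on (snd c ` (fst c \<inter> fst d)) (\<lambda>x. snd d (chart_inv c x))"
    using transition_smooth[OF assms(1,2)] by (simp add: o_def)
qed

text \<open>Matrix inversion is avoided: the reverse coordinate change is smooth by the atlas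
  axioms, and its Jacobian is composed with the transition map.\<close>

lemma smooth_jacobian_inverse:
  assumes "c \<in> \<A>" "d \<in> \<A>"
  shows "smooth_on (snd c ` (fst c \<inter> fst d)) (\<lambda>x. jacobian d c (chart_inv c x) $ i $ j)"
proof (rule smooth_on_cong[OF open_chart_image[OF assms(1) open_dom[OF assms(2)]]])
  show "smooth_on (snd c ` (fst c \<inter> fst d)) (\<lambda>x. jacobian d c (chart_inv d (snd d (chart_inv c x))) $ i $ j)"
    by (rule smooth_transition_compose[OF assms])
       (use smooth_jacobian[OF assms(2,1)] in \<open>simp add: Int_commute\<close>)
qed (use assms in auto)

lemma chg_chg:
  assumes "c \<in> \<A>" "d \<in> \<A>" "e \<in> \<A>" "p \<in> fst c" "p \<in> fst d" "p \<in> fst e"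
  shows "chg d e p (chg c d p v) = chg c e p (v :: ('k::real_normed_field, 'm) TT)"
proof -
  have m: "(\<Sum>j\<in>UNIV. of_real (a $ i $ j) * (\<Sum>k\<in>UNIV. of_real (b $ j $ k) * x $ k)) =
      (\<Sum>k\<in>UNIV. of_real ((a ** b) $ i $ k) * x $ k)" for a b :: "real^'m^'m" and x :: "'k^'m" and i
  proof -
    have "(\<Sum>j\<in>UNIV. of_real (a $ i $ j) * (\<Sum>k\<in>UNIV. of_real (b $ j $ k) * x $ k)) =
      (\<Sum>j\<in>UNIV. \<Sum>k\<in>UNIV. of_real (a $ i $ j * b $ j $ k) * x $ k)"
      by (simp add: sum_distrib_left mult.assoc)
    also have "\<dots> = (\<Sum>k\<in>UNIV. \<Sum>j\<in>UNIV. of_real (a $ i $ j * b $ j $ k) * x $ k)"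
      by (rule sum.swap)
    also have "\<dots> = (\<Sum>k\<in>UNIV. of_real ((a ** b) $ i $ k) * x $ k)"
      by (simp add: matrix_matrix_mult_def sum_distrib_right)
    finally show ?thesis .
  qed
  have t: "(\<Sum>j\<in>UNIV. of_real (a $ j $ i) * (\<Sum>k\<in>UNIV. of_real (b $ k $ j) * x $ k)) =
      (\<Sum>k\<in>UNIV. of_real ((b ** a) $ k $ i) * x $ k)" for a b :: "real^'m^'m" and x :: "'k^'m" and i
    using m[of "transpose a" i "transpose b" x] by (simp add: matrix_transpose_mul[symmetric]) (simp add: transpose_def)
  show ?thesis
    using jacobian_cocycle[OF assms] jacobian_cocycle[OF assms(3,2,1,6,5,4)]
    by (simp add: chg_def vec_eq_iff m t)
qed

lemma chg_self: "c \<in> \<A> \<Longrightarrow> p \<in> fst c \<Longrightarrow> chg c c p v = v"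
  by (simp add: chg_def jacobian_self mat_def prod_eq_iff vec_eq_iff if_distrib if_distribR cong: if_cong)

lemma smooth_chg:
  assumes "c \<in> \<A>" "d \<in> \<A>" "smooth_on (snd d ` (fst c \<inter> fst d)) g"
  shows "smooth_on (snd d ` (fst c \<inter> fst d)) (\<lambda>x. chg c d (chart_inv d x) (g x :: ('k::real_normed_field, 'm) TT))"
proof -
  have o: "open (snd d ` (fst c \<inter> fst d))"
    using open_chart_image[OF assms(2) open_dom[OF assms(1)]] by (simp add: Int_commute)
  show ?thesis
    unfolding chg_def
    by (intro smooth_on_Pair smooth_on_vec smooth_on_sum smooth_on_mult smooth_on_of_real smooth_on_vec_nth
        smooth_on_fst smooth_on_snd o assms(3)
        smooth_jacobian[OF assms(2,1), unfolded Int_commute[of "fst d"]]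
        smooth_jacobian_inverse[OF assms(2,1), unfolded Int_commute[of "fst d"]])
qed

text \<open>The section over the domain of \<open>c\<close> whose components there are
  \<open>g\<close>. Its values are stored in the preferred charts, which jump from point to point;
  by \<open>chg_chg\<close> they drop out again in any chart of the atlas.\<close>

definition sect_of :: "('a, 'm) chart \<Rightarrow> (real^'m \<Rightarrow> ('k::real_normed_field, 'm) TT) \<Rightarrow> 'a \<Rightarrow> ('k, 'm) TT" where
  "sect_of c g p = chg c (chart_at \<A> p) p (g (snd c p))"

lemma sect_of_in_chart:
  assumes "c \<in> \<A>" "d \<in> \<A>" "x \<in> snd d ` (fst c \<inter> fst d)"
  shows "sect_in_chart \<A> d (sect_of c g) x = chg c d (chart_inv d x) (g (snd c (chart_inv d x)))"
proof -
  have "chart_inv d x \<in> fst c" "chart_inv d x \<in> fst d" using assms by auto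
  then show ?thesis
    unfolding sect_in_chart_eq sect_of_def by (intro chg_chg chart_at assms)
qed

lemma smooth_sect_of:
  assumes "c \<in> \<A>" "smooth_on (snd c ` fst c) g"
  shows "smooth_sect \<A> (fst c) (sect_of c g)"
  unfolding smooth_sect_def
proof
  fix d assume d: "d \<in> \<A>"
  have o: "open (snd d ` (fst c \<inter> fst d))"
    using open_chart_image[OF d open_dom[OF assms(1)]] by (simp add: Int_commute)
  have "smooth_on (snd c ` (fst d \<inter> fst c)) g"
    by (rule smooth_on_subset[OF assms(2)]) auto
  from smooth_transition_compose[OF d assms(1) this]
  have "smooth_on (snd d ` (fst c \<inter> fst d)) (\<lambda>x. g (snd c (chart_inv d x)))" by (simp add: Int_commute)
  from smooth_on_cong[OF o _ smooth_chg[OF assms(1) d this]]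
  show "smooth_on (snd d ` (fst d \<inter> fst c)) (sect_in_chart \<A> d (sect_of c g))"
    using sect_of_in_chart[OF assms(1) d, of _ g] by (simp add: Int_commute)
qed

lemma smooth_sect_subset: "smooth_sect \<A> U s \<Longrightarrow> V \<subseteq> U \<Longrightarrow> smooth_sect \<A> V s"
  unfolding smooth_sect_def by (blast intro: smooth_on_subset)

lemma smooth_form_subset: "smooth_form \<A> U s \<Longrightarrow> V \<subseteq> U \<Longrightarrow> smooth_form \<A> V s"
  unfolding smooth_form_def by (blast intro: smooth_on_subset)

text \<open>Clifford multiplication is independent of coordinates, so its smoothness can be read off
  from components in a single chart.\<close>

lemma pull_clifford:
  assumes "c \<in> \<A>" "d \<in> \<A>" "p \<in> fst c" "p \<in> fst d" "is_form \<phi>"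
  shows "pull (jacobian d c p) (clifford v \<phi>) = clifford (chg c d p v) (pull (jacobian d c p) \<phi>)"
proof -
  have "jacobian d c p ** jacobian c d p = mat 1"
    using jacobian_cocycle[OF assms(1,2,1,3,4,3)] jacobian_self[OF assms(1,3)] by simp
  from pull_contract[OF assms(5) this] show ?thesis
    by (simp add: clifford_eq chg_def pull_wedge1[symmetric]) (simp add: pull_def fun_eq_iff)
qed

lemma smooth_form_clifford:
  assumes "open V" "smooth_form \<A> V \<omega>" "\<And>p. p \<in> V \<Longrightarrow> is_form (\<omega> p)" "smooth_sect \<A> V s"
  shows "smooth_form \<A> V (\<lambda>p. clifford (s p) (\<omega> p))"
  unfolding smooth_form_def
proof (intro ballI allI)
  fix c vs assume c: "c \<in> \<A>"
  let ?S = "snd c ` (fst c \<inter> V)"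
  have o: "open ?S" by (rule open_chart_image[OF c assms(1)])
  have f: "smooth_on ?S (\<lambda>x. form_in_chart \<A> c \<omega> x ws)" for ws
    using assms(2) c by (simp add: smooth_form_def)
  have s: "smooth_on ?S (sect_in_chart \<A> c s)" using assms(4) c by (simp add: smooth_sect_def)
  have "smooth_on ?S (\<lambda>x. clifford (sect_in_chart \<A> c s x) (form_in_chart \<A> c \<omega> x) vs)"
    unfolding clifford_def contract_def wedge1_def
    by (intro smooth_on_add smooth_on_sum smooth_on_mult smooth_on_const smooth_on_vec_nth smooth_on_fst smooth_on_snd o f s)
  then show "smooth_on ?S (\<lambda>x. form_in_chart \<A> c (\<lambda>p. clifford (s p) (\<omega> p)) x vs)"
  proof (rule smooth_on_cong[OF o, rotated])
    fix x assume "x \<in> ?S"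
    then have p: "chart_inv c x \<in> fst c" "chart_inv c x \<in> V" using c by auto
    show "clifford (sect_in_chart \<A> c s x) (form_in_chart \<A> c \<omega> x) vs = form_in_chart \<A> c (\<lambda>p. clifford (s p) (\<omega> p)) x vs"
      unfolding form_in_chart_eq sect_in_chart_eq
      by (rule fun_cong[OF pull_clifford[symmetric]]) (use c p assms(3) chart_at in auto)
  qed
qed

text \<open>The form with constant components \<open>\<phi>\<close> in the chart \<open>c\<close>,
  which extends a given form at one point smoothly.\<close>

definition form_of :: "('a, 'm) chart \<Rightarrow> ('m, complex) form \<Rightarrow> 'a \<Rightarrow> ('m, complex) form" where
  "form_of c \<phi> p = pull (jacobian (chart_at \<A> p) c p) \<phi>"

lemma is_form_form_of: "is_form \<phi> \<Longrightarrow> is_form (form_of c \<phi> p)"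
  by (simp add: form_of_def is_form_pull)

lemma form_of_chart_at: "form_of (chart_at \<A> p) \<phi> p = \<phi>"
  by (simp add: form_of_def jacobian_self chart_at)

lemma smooth_form_of:
  assumes "c \<in> \<A>" "is_form \<phi>"
  shows "smooth_form \<A> (fst c) (form_of c \<phi>)"
  unfolding smooth_form_def
proof (intro ballI allI)
  fix d vs assume d: "d \<in> \<A>"
  let ?S = "snd d ` (fst d \<inter> fst c)"
  have o: "open ?S" by (rule open_chart_image[OF d open_dom[OF assms(1)]])
  have "smooth_on ?S (\<lambda>x. pull (jacobian d c (chart_inv d x)) \<phi> vs)"
    by (rule smooth_on_form_pull[OF o smooth_jacobian[OF d assms(1)] assms(2)])
  then show "smooth_on ?S (\<lambda>x. form_in_chart \<A> d (form_of c \<phi>) x vs)"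
  proof (rule smooth_on_cong[OF o, rotated])
    fix x assume "x \<in> ?S"
    then have p: "chart_inv d x \<in> fst c" "chart_inv d x \<in> fst d" using d by auto
    show "pull (jacobian d c (chart_inv d x)) \<phi> vs = form_in_chart \<A> d (form_of c \<phi>) x vs"
      unfolding form_in_chart_eq form_of_def pull_pull
      by (subst jacobian_cocycle) (use p d assms chart_at in auto)
  qed
qed

lemma smooth_form_nonzero_nearby:
  fixes \<omega> :: "'a \<Rightarrow> ('m, complex) form"
  assumes "open V" "smooth_form \<A> V \<omega>" "p \<in> V" "\<omega> p \<noteq> 0"
  obtains W where "open W" "p \<in> W" "W \<subseteq> V" "\<And>q. q \<in> W \<Longrightarrow> \<omega> q \<noteq> 0"
proof -
  let ?c = "chart_at \<A> p"
  let ?S = "snd ?c ` (fst ?c \<inter> V)"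
  obtain vs where vs: "\<omega> p vs \<noteq> 0" using assms(4) by (auto simp: fun_eq_iff)
  let ?f = "\<lambda>x. form_in_chart \<A> ?c \<omega> x vs"
  have "continuous_on ?S ?f"
    using assms(2) chart_at(1) by (auto simp: smooth_form_def intro!: smooth_on_continuous_on)
  then have N: "open (?S \<inter> ?f -` (- {0}))"
    by (rule continuous_open_preimage[OF _ open_chart_image[OF chart_at(1) assms(1)]]) auto
  let ?W = "{q \<in> fst ?c. snd ?c q \<in> ?S \<inter> ?f -` (- {0})}"
  have "p \<in> ?W"
    using vs assms(3) by (auto simp: form_in_chart_eq chart_at jacobian_self)
  moreover have "?W \<subseteq> V"
  proof
    fix q assume "q \<in> ?W"
    then obtain q' where "q' \<in> fst ?c" "q' \<in> V" "snd ?c q = snd ?c q'" "q \<in> fst ?c" by blast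
    then show "q \<in> V" using chart_inv_chart[OF chart_at(1)] by metis
  qed
  moreover have "\<omega> q \<noteq> 0" if "q \<in> ?W" for q
  proof -
    have "q \<in> fst ?c" "?f (snd ?c q) \<noteq> 0" using that by blast+
    then show ?thesis by (auto simp: form_in_chart_eq chart_at pull_def)
  qed
  ultimately show ?thesis using that[of ?W] open_chart_vimage[OF chart_at(1) N] by blast
qed

end

section \<open>Orthogonality and local frames\<close>

definition cpl :: "complex \<Rightarrow> (real, 'm::finite) TT \<Rightarrow> (real, 'm) TT \<Rightarrow> (complex, 'm) TT" where
  "cpl z v w = (\<chi> i. of_real (fst v $ i) + z * of_real (fst w $ i),
                \<chi> i. of_real (snd v $ i) + z * of_real (snd w $ i))"

lemma clifford_cpl: "clifford (cpl z v (J v)) \<phi> = tw J z v \<phi>"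
proof -
  have "fst (cpl z v (J v)) = cvec (fst v) + z *s cvec (fst (J v))"
    "snd (cpl z v (J v)) = cvec (snd v) + z *s cvec (snd (J v))"
    by (simp_all add: cpl_def vec_eq_iff)
  then show ?thesis
    by (simp add: clifford_eq contract_add_left contract_scale_left wedge1_add_left wedge1_scale_left
        tw_def rc_def cfun.scale_right_distrib)
qed

lemma cpl_inject: "cpl (- \<i>) a b = cpl (- \<i>) c d \<longleftrightarrow> a = c \<and> b = d"
  by (auto simp: cpl_def vec_eq_iff complex_eq_iff prod_eq_iff)

lemma gcs_L_eq:
  fixes J :: "'a \<Rightarrow> (real, 'm::finite) TT \<Rightarrow> (real, 'm) TT"
  assumes "\<And>v. J p (J p v) = - v"
  shows "gcs_L J p = range (\<lambda>v. cpl (- \<i>) v (J p v))"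
proof (intro equalityI subsetI)
  fix u assume "u \<in> gcs_L J p"
  define a :: "(real, 'm) TT" where "a = (\<chi> i. Re (fst u $ i), \<chi> i. Re (snd u $ i))"
  define b :: "(real, 'm) TT" where "b = (\<chi> i. Im (fst u $ i), \<chi> i. Im (snd u $ i))"
  have "complexify (J p) u = (\<i> *s fst u, \<i> *s snd u)" using \<open>u \<in> gcs_L J p\<close> by (simp add: gcs_L_def)
  then have "J p a = - b"
    by (auto simp: complexify_def Let_def a_def[symmetric] b_def[symmetric] prod_eq_iff vec_eq_iff complex_eq_iff)
       (auto simp: b_def)
  then have "u = cpl (- \<i>) a (J p a)"
    by (auto simp: cpl_def a_def b_def prod_eq_iff vec_eq_iff complex_eq_iff)
  then show "u \<in> range (\<lambda>v. cpl (- \<i>) v (J p v))" by blast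
next
  fix u assume "u \<in> range (\<lambda>v. cpl (- \<i>) v (J p v))"
  then obtain v where u: "u = cpl (- \<i>) v (J p v)" by blast
  have "(\<chi> i. Re (fst u $ i), \<chi> i. Re (snd u $ i)) = v" "(\<chi> i. Im (fst u $ i), \<chi> i. Im (snd u $ i)) = - J p v"
    by (auto simp: u cpl_def prod_eq_iff vec_eq_iff)
  moreover have "J p (- J p v) = v"
  proof -
    \<comment> \<open>Evaluating \<open>J p\<close> three times on \<open>v\<close> in two ways
      shows that it is odd.\<close>
    have "J p (- v) = - J p v" using assms[of "J p v"] unfolding assms[of v] .
    then show ?thesis using assms[of "- v"] by simp
  qed
  ultimately show "u \<in> gcs_L J p"
    by (simp add: gcs_L_def complexify_def Let_def) (simp add: u cpl_def vec_eq_iff complex_eq_iff)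
qed

section \<open>Isotropy of L from involutivity\<close>

lemma pderivative_cong:
  assumes "open S" "x \<in> S" "\<And>y. y \<in> S \<Longrightarrow> f y = g y" "f differentiable (at x)"
  shows "pderivative k f x = pderivative k g x"
  unfolding pderivative_def using frechet_derivative_transform_within_open[OF assms(4,1,2,3)] by simp

text \<open>The scaling factor has value 1 at \<open>x0\<close>, and its differential there is the
  coordinate covector of index \<open>j\<close>.\<close>

lemma pderivative_scaled:
  fixes g :: "real^'m::finite \<Rightarrow> complex"
  assumes "g differentiable (at x0)"
  shows "pderivative k (\<lambda>y. of_real (1 + (y - x0) $ j) * g y) x0 = (if k = j then g x0 else 0) + pderivative k g x0"
proof -
  let ?D = "frechet_derivative g (at x0)"
  have ax: "axis k 1 $ j = (if k = j then 1 else 0 :: real)" by (simp add: axis_def)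
  have "(g has_derivative ?D) (at x0)" using assms frechet_derivative_works by blast
  then have "((\<lambda>y. of_real (1 + (y - x0) $ j) * g y) has_derivative
      (\<lambda>h. of_real (1 + (x0 - x0) $ j) * ?D h + of_real (h $ j) * g x0)) (at x0)"
    by (intro derivative_eq_intros) (auto intro!: derivative_eq_intros bounded_linear_imp_has_derivative bounded_linear_vec_nth)
  from fun_cong[OF frechet_derivative_at[OF this], of "axis k 1", symmetric] show ?thesis
    by (simp add: pderivative_def ax)
qed

text \<open>The Lie bracket of X with itself and the derivatives of \<open>\<xi>\<close> along X
  cancel, and the H-term sums an antisymmetric against a symmetric expression. What remains is the
  differential of \<open>\<xi>\<close> applied to X, the square of the section.\<close>

lemma courant_bracket_self:
  fixes H :: "'a \<Rightarrow> ('m::finite, real) form" and s :: "'a \<Rightarrow> ('k::real_normed_field, 'm) TT"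
  assumes "is_form (H p)"
  shows "courant_bracket \<A> H s s p =
    (let c = chart_at \<A> p; x = snd c p;
       X = (\<lambda>i y. fst (sect_in_chart \<A> c s y) $ i); \<xi> = (\<lambda>i y. snd (sect_in_chart \<A> c s y) $ i)
     in (0, \<chi> k. \<Sum>i\<in>UNIV. X i x * pderivative k (\<xi> i) x + \<xi> i x * pderivative k (X i) x))"
proof -
  have h: "(\<Sum>i\<in>UNIV. \<Sum>j\<in>UNIV. X i * X j * of_real (H p [axis i 1, axis j 1, axis k 1])) = 0"
    for X :: "'m \<Rightarrow> 'k" and k
  proof -
    let ?s = "\<Sum>i\<in>UNIV. \<Sum>j\<in>UNIV. X i * X j * of_real (H p [axis i 1, axis j 1, axis k 1])"
    have "H p [axis i 1, axis j 1, axis k 1] = - H p [axis j 1, axis i 1, axis k 1]" for i j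
      by (rule is_form_swap[OF assms])
    note sw = this
    have flip_term: "X i * X j * of_real (H p [axis i 1, axis j 1, axis k 1]) =
        - (X j * X i * of_real (H p [axis j 1, axis i 1, axis k 1]))" for i j
      by (subst sw) (simp add: mult.commute)
    have "?s = (\<Sum>i\<in>UNIV. \<Sum>j\<in>UNIV. - (X j * X i * of_real (H p [axis j 1, axis i 1, axis k 1])))"
      by (rule sum.cong[OF refl], rule sum.cong[OF refl], rule flip_term)
    also have "\<dots> = - ?s" by (subst sum.swap) (simp add: sum_negf)
    finally show ?thesis by (simp add: eq_neg_iff_add_eq_0 flip: mult_2)
  qed
  show ?thesis
    unfolding courant_bracket_def Let_def h
    by (simp add: vec_eq_iff sum_subtractf algebra_simps sum.distrib)
qed

locale gen_complex_manifold = smooth_manifold \<A>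
  for \<A> :: "('a::{t2_space, second_countable_topology}, 'm::finite) chart set" +
  fixes H :: "'a \<Rightarrow> ('m, real) form" and J :: "'a \<Rightarrow> (real, 'm) TT \<Rightarrow> (real, 'm) TT"
  assumes H_form: "is_form (H p)" and gcs: "generalized_complex_structure \<A> H J"
begin

lemma J_linear: "linear (J p)" and J_J: "J p (J p v) = - v"
  and J_smooth: "open U \<Longrightarrow> smooth_sect \<A> U s \<Longrightarrow> smooth_sect \<A> U (\<lambda>p. J p (s p))"
  and J_involutive: "involutive \<A> H (gcs_L J)"
  using gcs unfolding generalized_complex_structure_def smooth_endomorphism_def by blast+

lemma sect_in_chart_cpl:
  "sect_in_chart \<A> c (\<lambda>q. cpl z (s q) (t q)) x = cpl z (sect_in_chart \<A> c s x) (sect_in_chart \<A> c t x)"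
  by (simp add: sect_in_chart_eq chg_def cpl_def vec_eq_iff algebra_simps sum.distrib sum_distrib_left)

lemma smooth_sect_cpl:
  assumes "open U" "smooth_sect \<A> U s" "smooth_sect \<A> U t"
  shows "smooth_sect \<A> U (\<lambda>q. cpl z (s q) (t q))"
  unfolding smooth_sect_def
proof
  fix c assume c: "c \<in> \<A>"
  have o: "open (snd c ` (fst c \<inter> U))" by (rule open_chart_image[OF c assms(1)])
  have s: "smooth_on (snd c ` (fst c \<inter> U)) (sect_in_chart \<A> c s)" "smooth_on (snd c ` (fst c \<inter> U)) (sect_in_chart \<A> c t)"
    using assms c by (auto simp: smooth_sect_def)
  show "smooth_on (snd c ` (fst c \<inter> U)) (sect_in_chart \<A> c (\<lambda>q. cpl z (s q) (t q)))"
    unfolding sect_in_chart_cpl[abs_def] unfolding cpl_def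
    by (intro smooth_on_Pair smooth_on_vec smooth_on_add smooth_on_mult smooth_on_const smooth_on_of_real
        smooth_on_vec_nth smooth_on_fst smooth_on_snd o s)
qed

lemma sect_in_chart_J_scaleR:
  "sect_in_chart \<A> c (\<lambda>q. J q (r (snd c q) *\<^sub>R s q)) x = r (snd c (chart_inv c x)) *\<^sub>R sect_in_chart \<A> c (\<lambda>q. J q (s q)) x"
  by (simp add: sect_in_chart_eq linear_scale[OF J_linear] linear_scale[OF linear_chg])

text \<open>For sections \<open>s\<close> of \<open>L\<close> one has \<open>[s,s] = d\<langle>s,s\<rangle>\<close>. Comparing \<open>s\<close> with \<open>f s\<close>, where
  \<open>f(p) = 1\<close>, shows that \<open>2\<langle>s,s\<rangle> df\<close> lies in \<open>L\<close> at \<open>p\<close>; but \<open>L\<close> contains no nonzero complex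
  multiple of a real covector.\<close>

lemma pair_J_self: "pair v (J p v) = 0"
proof -
  define c where "c = chart_at \<A> p"
  define x0 where "x0 = snd c p"
  have c: "c \<in> \<A>" "p \<in> fst c" by (auto simp: c_def chart_at)
  have x0: "x0 \<in> snd c ` fst c" using c(2) by (simp add: x0_def)
  note oS = open_img[OF c(1)]
  \<comment> \<open>Any coordinate serves; it fixes the covector \<open>?E\<close> used
    below.\<close>
  define j :: 'm where "j = undefined"
  define f :: "real^'m \<Rightarrow> real" where "f = (\<lambda>x. 1 + (x - x0) $ j)"
  define s1 :: "'a \<Rightarrow> (real, 'm) TT" where "s1 = sect_of c (\<lambda>x. v)"
  define sf :: "'a \<Rightarrow> (real, 'm) TT" where "sf = sect_of c (\<lambda>x. f x *\<^sub>R v)"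
  define L where "L = (\<lambda>s q. cpl (- \<i>) (s q) (J q (s q)))"
  have sm_f: "smooth_on (snd c ` fst c) f"
  proof -
    have "f = (\<lambda>x. x $ j + (1 - x0 $ j))" by (auto simp: f_def)
    then show ?thesis
      by (simp only:) (intro smooth_on_add smooth_on_vec_nth smooth_on_const smooth_on_ident oS)
  qed
  have sm1: "smooth_sect \<A> (fst c) s1"
    unfolding s1_def by (intro smooth_sect_of smooth_on_const oS c(1))
  have smf: "smooth_sect \<A> (fst c) sf"
    unfolding sf_def by (intro smooth_sect_of smooth_on_bilinear[OF _ bounded_bilinear_scaleR] smooth_on_const oS sm_f c(1))
  have L_sm: "smooth_sect \<A> (fst c) (L s)" if "smooth_sect \<A> (fst c) s" for s
    unfolding L_def by (intro smooth_sect_cpl J_smooth open_dom c(1) that)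
  have L_in: "L s q \<in> gcs_L J q" for s q
    unfolding gcs_L_eq[OF J_J] L_def by blast
  have br: "courant_bracket \<A> H (L s) (L s) p \<in> gcs_L J p" if "smooth_sect \<A> (fst c) s" for s
    using J_involutive open_dom[OF c(1)] L_sm[OF that] L_in c(2) unfolding involutive_def by blast
  define a where "a = (\<lambda>i y. fst (sect_in_chart \<A> c (L s1) y) $ i)"
  define b where "b = (\<lambda>i y. snd (sect_in_chart \<A> c (L s1) y) $ i)"
  have sf_s1: "sf q = f (snd c q) *\<^sub>R s1 q" for q
    by (simp add: sf_def s1_def sect_of_def linear_scale[OF linear_chg])
  have Lf: "sect_in_chart \<A> c (L sf) y = (\<chi> i. of_real (f y) * a i y, \<chi> i. of_real (f y) * b i y)" if "y \<in> snd c ` fst c" for y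
    using that c(1) unfolding L_def sect_in_chart_cpl sf_s1 sect_in_chart_J_scaleR a_def b_def
    by (auto simp: sect_in_chart_eq linear_scale[OF linear_chg] cpl_def vec_eq_iff prod_eq_iff algebra_simps)
  have sL: "smooth_on (snd c ` fst c) (sect_in_chart \<A> c (L s1))"
    using L_sm[OF sm1] c(1) by (auto simp: smooth_sect_def)
  have "smooth_on (snd c ` fst c) (a i)" "smooth_on (snd c ` fst c) (b i)" for i
    unfolding a_def b_def by (intro smooth_on_vec_nth smooth_on_fst smooth_on_snd oS sL)+
  then have dab: "a i differentiable (at x0)" "b i differentiable (at x0)" for i
    using smooth_on_has_derivative[OF _ x0] unfolding differentiable_def by blast+
  have pd: "pderivative k (\<lambda>y. fst (sect_in_chart \<A> c (L sf) y) $ i) x0 = (if k = j then a i x0 else 0) + pderivative k (a i) x0"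
    "pderivative k (\<lambda>y. snd (sect_in_chart \<A> c (L sf) y) $ i) x0 = (if k = j then b i x0 else 0) + pderivative k (b i) x0" for i k
  proof -
    have d: "(\<lambda>y. of_real (f y) * g y :: complex) differentiable (at x0)" if "g differentiable (at x0)" for g
    proof -
      have "(\<lambda>y. of_real (f y) :: complex) differentiable (at x0)"
        using smooth_on_has_derivative[OF smooth_on_of_real[OF oS sm_f] x0] unfolding differentiable_def by blast
      then show ?thesis using that by (rule differentiable_mult)
    qed
    show "pderivative k (\<lambda>y. fst (sect_in_chart \<A> c (L sf) y) $ i) x0 = (if k = j then a i x0 else 0) + pderivative k (a i) x0"
      unfolding pderivative_scaled[OF dab(1), symmetric] f_def[symmetric, THEN fun_cong]
      by (rule pderivative_cong[OF oS x0, symmetric]) (use Lf d[OF dab(1)] in auto)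
    show "pderivative k (\<lambda>y. snd (sect_in_chart \<A> c (L sf) y) $ i) x0 = (if k = j then b i x0 else 0) + pderivative k (b i) x0"
      unfolding pderivative_scaled[OF dab(2), symmetric] f_def[symmetric, THEN fun_cong]
      by (rule pderivative_cong[OF oS x0, symmetric]) (use Lf d[OF dab(2)] in auto)
  qed
  \<comment> \<open>The complex bilinear square <s,s> at \<open>p\<close> of the section
    \<open>s = L s1\<close>.\<close>
  define G where "G = (\<Sum>i\<in>UNIV. a i x0 * b i x0)"
  have B1: "courant_bracket \<A> H (L s1) (L s1) p =
      (0, \<chi> k. \<Sum>i\<in>UNIV. a i x0 * pderivative k (b i) x0 + b i x0 * pderivative k (a i) x0)"
    unfolding courant_bracket_self[of H, OF H_form] Let_def c_def[symmetric] x0_def[symmetric] a_def b_def ..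
  have fx0: "f x0 = 1" by (simp add: f_def)
  have Bf: "courant_bracket \<A> H (L sf) (L sf) p =
      (0, \<chi> k. (\<Sum>i\<in>UNIV. a i x0 * pderivative k (b i) x0 + b i x0 * pderivative k (a i) x0) + (if k = j then 2 * G else 0))"
    unfolding courant_bracket_self[of H, OF H_form] Let_def c_def[symmetric] x0_def[symmetric] pd Lf[OF x0] fx0
    by (auto simp: vec_eq_iff G_def algebra_simps sum.distrib sum_distrib_left)
  obtain u1 where u1: "courant_bracket \<A> H (L s1) (L s1) p = cpl (- \<i>) u1 (J p u1)"
    using br[OF sm1] unfolding gcs_L_eq[OF J_J] by blast
  obtain uf where uf: "courant_bracket \<A> H (L sf) (L sf) p = cpl (- \<i>) uf (J p uf)"
    using br[OF smf] unfolding gcs_L_eq[OF J_J] by blast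
  \<comment> \<open>The fibre of L is linear, so the difference of the two brackets,
    \<open>2 * G\<close> times the covector \<open>?E\<close>, lies in L; its real part is
    \<open>u\<close>.\<close>
  define u where "u = uf - u1"
  let ?E = "(0, axis j 1) :: (real, 'm) TT"
  have "cpl (- \<i>) u (J p u) = cpl (- \<i>) uf (J p uf) - cpl (- \<i>) u1 (J p u1)"
    by (simp add: u_def linear_diff[OF J_linear] cpl_def vec_eq_iff algebra_simps)
  also have "\<dots> = (0, \<chi> k. if k = j then 2 * G else 0)"
    unfolding u1[symmetric] uf[symmetric] B1 Bf by (simp add: vec_eq_iff)
  also have "\<dots> = cpl (- \<i>) ((2 * Re G) *\<^sub>R ?E) ((- 2 * Im G) *\<^sub>R ?E)"
    by (auto simp: cpl_def vec_eq_iff axis_def complex_eq_iff)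
  finally have "u = (2 * Re G) *\<^sub>R ?E \<and> J p u = (- 2 * Im G) *\<^sub>R ?E"
    unfolding cpl_inject .
  then have u: "u = (2 * Re G) *\<^sub>R ?E" "J p u = (- 2 * Im G) *\<^sub>R ?E" by blast+
  have E0: "r = 0" if "r *\<^sub>R ?E = 0" for r
    using that by (auto simp: vec_eq_iff axis_def zero_prod_def split: if_splits)
  define x where "x = 2 * Re G"
  define y where "y = - 2 * Im G"
  note u = u[folded x_def y_def]
  \<comment> \<open>Both \<open>u\<close> and \<open>J p u\<close> are real multiples of
    \<open>?E\<close>. Cross-multiplying these relations gives \<open>x * x + y * y = 0\<close>: a
    real endomorphism with square -1 has no real eigenvector.\<close>
  have JE: "J p u = x *\<^sub>R J p ?E" "- u = y *\<^sub>R J p ?E"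
    using J_J[of p u] unfolding u(2) linear_scale[OF J_linear] by (simp_all only: u(1) linear_scale[OF J_linear] flip: u(2))
  have "x *\<^sub>R (- u) = y *\<^sub>R J p u"
    unfolding JE by (simp only: scaleR_scaleR mult.commute)
  then have "(x * x) *\<^sub>R ?E + (y * y) *\<^sub>R ?E = 0"
    unfolding u(2) unfolding u(1) by (simp only: scaleR_minus_right scaleR_scaleR) (metis add.right_inverse)
  then have "x * x + y * y = 0" by (intro E0) (simp only: scaleR_left_distrib)
  then have "y = 0" by (simp only: sum_squares_eq_zero_iff)
  then have "Im G = 0" by (simp add: y_def)
  have "a i x0 = of_real (fst v $ i) - \<i> * of_real (fst (J p v) $ i)"
    "b i x0 = of_real (snd v $ i) - \<i> * of_real (snd (J p v) $ i)" for i
  proof -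
    have "sect_in_chart \<A> c (L s1) x0 = L s1 p"
      using c by (simp add: sect_in_chart_eq x0_def c_def[symmetric] chg_self)
    moreover have "s1 p = v"
      using c by (simp add: s1_def sect_of_def c_def[symmetric] chg_self)
    ultimately show "a i x0 = of_real (fst v $ i) - \<i> * of_real (fst (J p v) $ i)"
      "b i x0 = of_real (snd v $ i) - \<i> * of_real (snd (J p v) $ i)"
      by (simp_all add: a_def b_def L_def cpl_def)
  qed
  note ab = this
  \<comment> \<open>The mixed terms in the square of \<open>v - \<i> J v\<close> form its imaginary
    part.\<close>
  have "Im G = - pair v (J p v)"
    unfolding G_def ab pair_def inner_vec_def
    by (simp add: algebra_simps sum.distrib sum_negf sum_subtractf)
  then show ?thesis using \<open>Im G = 0\<close> by simp
qed

lemma skew_J: "skew (J p)"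
  unfolding skew_def
proof (intro allI)
  fix v w
  have "0 = pair (v + w) (J p (v + w))" by (simp only: pair_J_self)
  also have "\<dots> = pair v (J p w) + pair w (J p v)"
    by (simp add: linear_add[OF J_linear] pair_simps pair_J_self)
  finally show "pair (J p v) w = - pair v (J p w)" by (simp add: pair_commute[of "J p v"])
qed

sublocale fiber: skew_complex_structure "J p" for p
  by (rule skew_complex_structure.intro) (rule J_linear J_J skew_J)+

section \<open>Smooth local frames and vacua\<close>

lemma smooth_form_tw:
  assumes "open V" "smooth_form \<A> V \<omega>" "\<And>q. q \<in> V \<Longrightarrow> is_form (\<omega> q)" "smooth_sect \<A> V s"
  shows "smooth_form \<A> V (\<lambda>q. tw (J q) z (s q) (\<omega> q))"
  unfolding clifford_cpl[symmetric]
  by (intro smooth_form_clifford smooth_sect_cpl J_smooth assms)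

lemma smooth_form_full:
  assumes "open V" "smooth_form \<A> V \<omega>" "\<And>q. q \<in> V \<Longrightarrow> is_form (\<omega> q)" "\<And>s. s \<in> set ss \<Longrightarrow> smooth_sect \<A> V s"
  shows "smooth_form \<A> V (\<lambda>q. full (J q) z (map (\<lambda>s. s q) ss) (\<omega> q))"
  using assms(4)
  by (induction ss) (auto intro!: smooth_form_tw is_form_full assms(1-3))

lemma smooth_form_frame:
  assumes "open V" "smooth_form \<A> V \<omega>" "\<And>q. q \<in> V \<Longrightarrow> is_form (\<omega> q)" "\<And>s. s \<in> set ss \<Longrightarrow> smooth_sect \<A> V s"
    "j < length ss choose k"
  shows "smooth_form \<A> V (\<lambda>q. frame (J q) (map (\<lambda>s. s q) ss) (\<omega> q) k ! j)"
  using assms(4,5)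
proof (induction ss arbitrary: k j)
  case Nil
  then have "k = 0" "j = 0" by (cases k; simp)+
  then show ?case using assms(2) by simp
next
  case (Cons s ss)
  show ?case
  proof (cases "j < length ss choose k")
    case True
    then have "frame (J q) (map (\<lambda>s. s q) (s # ss)) (\<omega> q) k ! j = frame (J q) (map (\<lambda>s. s q) ss) (\<omega> q) k ! j" for q
      by (simp add: nth_append length_frame)
    then show ?thesis using Cons.IH[OF _ True] Cons.prems by simp
  next
    case False
    let ?i = "j - (length ss choose k)"
    obtain k' where k: "k = Suc k'" using False Cons.prems(2) by (cases k) auto
    then have i: "?i < length ss choose k'" using False Cons.prems(2) by simp
    have "frame (J q) (map (\<lambda>s. s q) (s # ss)) (\<omega> q) k ! j = tw (J q) \<i> (s q) (frame (J q) (map (\<lambda>s. s q) ss) (\<omega> q) k' ! ?i)" for q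
      using False i by (simp add: nth_append length_frame k)
    moreover have "is_form (frame (J q) (map (\<lambda>s. s q) ss) (\<omega> q) k' ! ?i)" if "q \<in> V" for q
      by (rule is_form_frame[OF assms(3)[OF that] nth_mem]) (simp add: length_frame i)
    ultimately show ?thesis
      using Cons.IH[OF _ i] Cons.prems(1) by (simp add: smooth_form_tw[OF assms(1)])
  qed
qed

text \<open>A basis at \<open>p\<close> is extended by constant components in the preferred chart of
  \<open>p\<close>. Together with their images under \<open>J\<close> the extensions have continuous
  components, so they keep spanning near \<open>p\<close>.\<close>

lemma local_L_frame:
  obtains bs ss W where "length bs = CARD('m)" "span (set bs \<union> J p ` set bs) = UNIV"
    "map (\<lambda>s. s p) ss = bs" "open W" "p \<in> W" "W \<subseteq> fst (chart_at \<A> p)" "\<And>s. s \<in> set ss \<Longrightarrow> smooth_sect \<A> W s"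
    "\<And>q. q \<in> W \<Longrightarrow> span (set (map (\<lambda>s. s q) ss) \<union> J q ` set (map (\<lambda>s. s q) ss)) = UNIV"
proof -
  define c where "c = chart_at \<A> p"
  define x0 where "x0 = snd c p"
  have c: "c \<in> \<A>" "p \<in> fst c" by (auto simp: c_def chart_at)
  have x0: "x0 \<in> snd c ` fst c" using c(2) by (simp add: x0_def)
  note oS = open_img[OF c(1)]
  obtain bs where bs: "length bs = CARD('m)" "span (set bs \<union> J p ` set bs) = UNIV"
    using complex_basis_exists[of "J p" "CARD('m)"] J_linear J_J by (auto simp: mult_2)
  define se :: "(real, 'm) TT \<Rightarrow> 'a \<Rightarrow> (real, 'm) TT" where "se = (\<lambda>b. sect_of c (\<lambda>x. b))"
  have se: "smooth_sect \<A> (fst c) (se b)" for b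
    unfolding se_def by (intro smooth_sect_of smooth_on_const oS c(1))
  have sep: "se b p = b" for b
    using c by (simp add: se_def sect_of_def c_def[symmetric] chg_self)
  \<comment> \<open>The Boolean separates a section from its image under \<open>J\<close>, so that
    both kinds form one finite family for \<open>spanning_eventually\<close>.\<close>
  let ?t = "\<lambda>(e, b) x. if e then sect_in_chart \<A> c (se b) x else sect_in_chart \<A> c (\<lambda>q. J q (se b q)) x"
  let ?I = "UNIV \<times> set bs :: (bool \<times> _) set"
  have t: "(?t i \<longlongrightarrow> ?t i x0) (nhds x0)" for i
  proof -
    have "smooth_on (snd c ` (fst c \<inter> fst c)) (sect_in_chart \<A> c (se (snd i)))"
      "smooth_on (snd c ` (fst c \<inter> fst c)) (sect_in_chart \<A> c (\<lambda>q. J q (se (snd i) q)))"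
      using se J_smooth[OF open_dom[OF c(1)] se] c(1) unfolding smooth_sect_def by blast+
    then have "continuous_on (snd c ` fst c) (?t i)"
      by (cases "fst i") (auto simp: split_def intro: smooth_on_continuous_on)
    then have "isCont (?t i) x0" using oS x0 continuous_on_eq_continuous_at by blast
    then show ?thesis by (simp add: isCont_def tendsto_at_iff_tendsto_nhds)
  qed
  have sp: "(\<lambda>i. ?t i x) ` ?I = chg (chart_at \<A> q) c q ` (set (map (\<lambda>b. se b q) bs) \<union> J q ` set (map (\<lambda>b. se b q) bs))"
    if "q \<in> fst c" "x = snd c q" for q x
  proof -
    have I: "?I = Pair True ` set bs \<union> Pair False ` set bs" by (auto simp: UNIV_bool)
    show ?thesis
      unfolding I image_Un image_image set_map using that c(1) by (simp add: sect_in_chart_eq)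
  qed
  have "(\<lambda>i. ?t i x0) ` ?I = set bs \<union> J p ` set bs"
    using sp[OF c(2) x0_def] c by (simp add: c_def[symmetric] chg_self sep)
  then have "\<forall>\<^sub>F x in nhds x0. span ((\<lambda>i. ?t i x) ` ?I) = UNIV"
    by (intro spanning_eventually[OF _ t]) (auto simp: bs(2))
  then obtain N where N: "open N" "x0 \<in> N" "\<And>x. x \<in> N \<Longrightarrow> span ((\<lambda>i. ?t i x) ` ?I) = UNIV"
    unfolding eventually_nhds by blast
  define W where "W = {q \<in> fst c. snd c q \<in> N}"
  have "span (set (map (\<lambda>b. se b q) bs) \<union> J q ` set (map (\<lambda>b. se b q) bs)) = UNIV" if q: "q \<in> W" for q
  proof -
    let ?A = "set (map (\<lambda>b. se b q) bs) \<union> J q ` set (map (\<lambda>b. se b q) bs)"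
    let ?f = "chg (chart_at \<A> q) c q :: (real, 'm) TT \<Rightarrow> _" and ?g = "chg c (chart_at \<A> q) q :: (real, 'm) TT \<Rightarrow> _"
    have qc: "q \<in> fst c" "snd c q \<in> N" using q by (auto simp: W_def)
    \<comment> \<open>Chart components and fibre components at \<open>q\<close> correspond by a
      linear bijection, so spanning carries back to the fibre.\<close>
    have gf: "?g (?f v) = v" for v
      using chg_chg[of "chart_at \<A> q" c "chart_at \<A> q" q v] qc(1) c(1) by (simp add: chart_at chg_self)
    have "?f ` span ?A = UNIV"
      using N(3)[OF qc(2)] unfolding sp[OF qc(1) refl] span_linear_image[OF linear_chg] .
    then have "v \<in> span ?A" for v
      by (metis (no_types, lifting) UNIV_I gf imageE)
    then show ?thesis by blast
  qed
  moreover have "open W" unfolding W_def by (rule open_chart_vimage[OF c(1) N(1)])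
  moreover have "p \<in> W" "W \<subseteq> fst c" using c N(2) by (auto simp: W_def x0_def)
  moreover have "smooth_sect \<A> W s" if "s \<in> set (map se bs)" for s
    using that se smooth_sect_subset[OF _ \<open>W \<subseteq> fst c\<close>] by auto
  ultimately show ?thesis
    by (intro that[of bs "map se bs" W]) (simp_all add: bs o_def sep c_def[symmetric])
qed

lemma local_vacuum:
  obtains ss V \<omega> where "length ss = CARD('m)" "open V" "p \<in> V" "\<And>s. s \<in> set ss \<Longrightarrow> smooth_sect \<A> V s"
    "\<And>q. q \<in> V \<Longrightarrow> span (set (map (\<lambda>s. s q) ss) \<union> J q ` set (map (\<lambda>s. s q) ss)) = UNIV"
    "smooth_form \<A> V \<omega>" "\<And>q. q \<in> V \<Longrightarrow> fiber.vacuum q (\<omega> q)" "\<And>q. q \<in> V \<Longrightarrow> \<omega> q \<noteq> 0"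
proof -
  obtain bs ss W where W: "length bs = CARD('m)" "span (set bs \<union> J p ` set bs) = UNIV"
    "map (\<lambda>s. s p) ss = bs" "open W" "p \<in> W" "W \<subseteq> fst (chart_at \<A> p)" "\<And>s. s \<in> set ss \<Longrightarrow> smooth_sect \<A> W s"
    "\<And>q. q \<in> W \<Longrightarrow> span (set (map (\<lambda>s. s q) ss) \<union> J q ` set (map (\<lambda>s. s q) ss)) = UNIV"
    by (rule local_L_frame[of p]) blast
  obtain \<phi> where \<phi>: "fiber.vacuum p \<phi>" "\<phi> \<noteq> 0" using fiber.vacuum_exists[OF W(2)] by blast
  have f: "is_form \<phi>" using \<phi>(1) by (simp add: fiber.vacuum_def)
  let ?c = "chart_at \<A> p"
  define \<omega> where "\<omega> = (\<lambda>q. full (J q) (- \<i>) (map (\<lambda>s. s q) ss) (form_of ?c (cj \<phi>) q))"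
  have sf: "is_form (form_of ?c (cj \<phi>) q)" for q by (intro is_form_form_of is_form_cj f)
  have sm: "smooth_form \<A> W \<omega>"
    unfolding \<omega>_def
    by (intro smooth_form_full W(4,7) smooth_form_subset[OF smooth_form_of W(6)] chart_at is_form_cj f sf)
  \<comment> \<open>Conjugation exchanges factors from L with factors from its conjugate, so
    \<open>full_neq_0\<close> for the vacuum \<open>\<phi>\<close> applies to
    \<open>\<omega>\<close> at \<open>p\<close>.\<close>
  have "\<omega> p = cj (full (J p) \<i> bs \<phi>)"
    by (simp add: \<omega>_def form_of_chart_at W(3) cj_full)
  then have "\<omega> p \<noteq> 0" using fiber.full_neq_0[OF \<phi> W(2,1)] by simp
  then obtain V where V: "open V" "p \<in> V" "V \<subseteq> W" "\<And>q. q \<in> V \<Longrightarrow> \<omega> q \<noteq> 0"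
    using smooth_form_nonzero_nearby[OF W(4) sm W(5)] by blast
  have vac: "fiber.vacuum q (\<omega> q)" if "q \<in> V" for q
    unfolding fiber.vacuum_def \<omega>_def
    using fiber.full_vacuum[OF sf _ W(8)] V(3) that by (auto simp: is_form_full sf)
  show ?thesis
  proof (rule that[of ss V \<omega>])
    show "length ss = CARD('m)" using W(1,3) by auto
    show "smooth_sect \<A> V s" if "s \<in> set ss" for s using smooth_sect_subset[OF W(7)[OF that] V(3)] .
    show "smooth_form \<A> V \<omega>" using smooth_form_subset[OF sm V(3)] .
  qed (use V W(8) vac in auto)
qed

lemma spin_eigenbundle_eq:
  "spin_eigenbundle J k p = {\<phi>. is_form \<phi> \<and> spin (J p) \<phi> = sc (\<i> * of_int k) \<phi>}"
  by (auto simp: spin_eigenbundle_def fun_eq_iff sc_apply)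

lemma canonical_bundle_eq: "canonical_bundle J p = {\<phi>. fiber.vacuum p \<phi>}"
proof -
  have "(\<forall>v\<in>gcs_L J p. \<forall>vs. clifford v \<phi> vs = 0) \<longleftrightarrow> (\<forall>v. tw (J p) (- \<i>) v \<phi> = 0)" for \<phi>
    unfolding gcs_L_eq[OF J_J] clifford_cpl[symmetric] by (auto simp: fun_eq_iff)
  then show ?thesis by (auto simp: canonical_bundle_def fiber.vacuum_def)
qed

section \<open>The eigenbundles of the spin action\<close>

context
  fixes n assumes dim: "CARD('m) = 2 * n"
begin

text \<open>The vacuum sits in degree \<open>n\<close> and each factor lowers the degree by one, so
  degree \<open>k\<close> is reached with \<open>n - k\<close> factors.\<close>

lemma spin_eigenbundle_frame:
  assumes "fiber.vacuum p \<phi>" "\<phi> \<noteq> 0" "span (set bs \<union> J p ` set bs) = UNIV" "length bs = CARD('m)"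
    "k \<in> {- int n..int n}"
  shows "spin_eigenbundle J k p = cfun.span (set (frame (J p) bs \<phi> (nat (int n - k))))"
proof -
  have "of_int k = (of_nat CARD('m) / 2 - of_nat (nat (int n - k)) :: complex)"
    using assms(5) by (simp add: dim of_nat_nat)
  moreover have "nat (int n - k) \<le> CARD('m)" using assms(5) dim by auto
  ultimately show ?thesis
    unfolding spin_eigenbundle_eq by (simp only: fiber.eigenspace_eq_span_frame[OF assms(1-4)])
qed

lemma subspace_spin_eigenbundle: "complex_subspace (spin_eigenbundle J k p)"
  unfolding complex_subspace_iff spin_eigenbundle_eq
  by (rule cfun.subspaceI) (auto simp: is_form_0 is_form_add is_form_sc clinear_simps[OF clinear_spin]
     cfun.scale_right_distrib mult.commute)

lemma smooth_subbundle_spin_eigenbundle: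
  assumes k: "k \<in> {- int n..int n}"
  shows "smooth_subbundle \<A> (CARD('m) choose nat (int n - k)) (spin_eigenbundle J k)"
  unfolding smooth_subbundle_def
proof (intro conjI allI)
  fix p
  show "complex_subspace (spin_eigenbundle J k p)" by (rule subspace_spin_eigenbundle)
  show "\<forall>\<phi>\<in>spin_eigenbundle J k p. is_form \<phi>" by (simp add: spin_eigenbundle_def)
next
  fix p
  let ?r = "CARD('m) choose nat (int n - k)"
  obtain ss V \<omega> where V: "length ss = CARD('m)" "open V" "p \<in> V" "\<And>s. s \<in> set ss \<Longrightarrow> smooth_sect \<A> V s"
    "\<And>q. q \<in> V \<Longrightarrow> span (set (map (\<lambda>s. s q) ss) \<union> J q ` set (map (\<lambda>s. s q) ss)) = UNIV"
    "smooth_form \<A> V \<omega>" "\<And>q. q \<in> V \<Longrightarrow> fiber.vacuum q (\<omega> q)" "\<And>q. q \<in> V \<Longrightarrow> \<omega> q \<noteq> 0"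
    by (rule local_vacuum[of p]) blast
  define fr where "fr = (\<lambda>q. frame (J q) (map (\<lambda>s. s q) ss) (\<omega> q) (nat (int n - k)))"
  have len: "length (fr q) = ?r" for q by (simp add: fr_def length_frame V(1))
  have sm: "smooth_form \<A> V (\<lambda>q. fr q ! j)" if "j < ?r" for j
    unfolding fr_def
    by (rule smooth_form_frame[OF V(2,6) _ V(4)]) (use V(1,7) that in \<open>auto simp: fiber.vacuum_def\<close>)
  have eb: "spin_eigenbundle J k q = cfun.span (set (fr q))" if "q \<in> V" for q
    unfolding fr_def by (rule spin_eigenbundle_frame[OF V(7,8,5)[OF that] _ k]) (simp add: V(1))
  have ex: "\<exists>!z. (\<forall>j\<ge>?r. z j = 0) \<and> (\<forall>vs. \<phi> vs = (\<Sum>j<?r. z j * (fr q ! j) vs))"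
    if q: "q \<in> V" and \<phi>: "\<phi> \<in> spin_eigenbundle J k q" for q \<phi>
  proof -
    have lc: "(\<forall>vs. \<phi> vs = (\<Sum>j<?r. z j * (fr q ! j) vs)) \<longleftrightarrow> \<phi> = lcomb z (fr q)" for z
      by (simp add: fun_eq_iff lcomb_def sum_fun_apply sc_apply len)
    obtain z where z: "\<phi> = lcomb z (fr q)"
      using \<phi> unfolding eb[OF q] span_set_iff_lcomb by blast
    \<comment> \<open>Only the first \<open>?r\<close> coefficients enter \<open>lcomb\<close>;
      setting the others to zero is what makes the coordinate function unique.\<close>
    show ?thesis unfolding lc
    proof (rule ex1I[of _ "\<lambda>j. if j < ?r then z j else 0"])
      show "(\<forall>j\<ge>?r. (if j < ?r then z j else 0) = 0) \<and> \<phi> = lcomb (\<lambda>j. if j < ?r then z j else 0) (fr q)"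
        by (simp add: z lcomb_def len)
      fix w assume w: "(\<forall>j\<ge>?r. w j = 0) \<and> \<phi> = lcomb w (fr q)"
      have "lcomb (\<lambda>j. w j - z j) (fr q) = lcomb w (fr q) - lcomb z (fr q)"
        by (simp add: lcomb_def cfun.scale_left_diff_distrib sum_subtractf)
      also have "\<dots> = 0" using w z by simp
      finally have lz: "lcomb (\<lambda>j. w j - z j) (fr q) = 0" .
      have "w j - z j = 0" if "j < ?r" for j
        by (rule fiber.frame_independent[OF V(7,8,5)[OF q] _ lz[unfolded fr_def]])
           (use that in \<open>simp_all add: V(1) length_frame\<close>)
      then show "w = (\<lambda>j. if j < ?r then z j else 0)" using w by (auto simp: fun_eq_iff)
    qed
  qed
  have "fr q ! j \<in> spin_eigenbundle J k q" if "q \<in> V" "j < ?r" for q j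
    unfolding eb[OF that(1)] using that(2) len by (intro cfun.span_base) simp
  then show "\<exists>V s. open V \<and> p \<in> V \<and> (\<forall>j<?r. smooth_form \<A> V (s j)) \<and>
        (\<forall>q\<in>V. (\<forall>j<?r. s j q \<in> spin_eigenbundle J k q) \<and>
           (\<forall>\<phi>\<in>spin_eigenbundle J k q. \<exists>!z :: nat \<Rightarrow> complex.
              (\<forall>j\<ge>?r. z j = 0) \<and> (\<forall>vs. \<phi> vs = (\<Sum>j<?r. z j * s j q vs))))"
    using V(2,3) sm ex by (intro exI[of _ V] exI[of _ "\<lambda>j q. fr q ! j"]) simp
qed

text \<open>With no factor applied the frame is the vacuum alone, so the top eigenspace is its span
  and consists of vacua; the converse is \<open>spin_vacuum\<close>.\<close>

lemma spin_eigenbundle_eq_canonical: "spin_eigenbundle J (int n) p = canonical_bundle J p"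
proof
  obtain ss V \<omega> where V: "length ss = CARD('m)" "open V" "p \<in> V" "\<And>s. s \<in> set ss \<Longrightarrow> smooth_sect \<A> V s"
    "\<And>q. q \<in> V \<Longrightarrow> span (set (map (\<lambda>s. s q) ss) \<union> J q ` set (map (\<lambda>s. s q) ss)) = UNIV"
    "smooth_form \<A> V \<omega>" "\<And>q. q \<in> V \<Longrightarrow> fiber.vacuum q (\<omega> q)" "\<And>q. q \<in> V \<Longrightarrow> \<omega> q \<noteq> 0"
    by (rule local_vacuum[of p]) blast
  have "spin_eigenbundle J (int n) p = cfun.span {\<omega> p}"
    using spin_eigenbundle_frame[OF V(7,8,5)[OF V(3)], of "int n"] by (simp add: V(1) frame_0)
  moreover have "cfun.subspace {\<phi>. fiber.vacuum p \<phi>}"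
    by (rule cfun.subspaceI) (simp_all add: fiber.vacuum_def is_form_0 is_form_add is_form_sc tw_simps)
  then have "cfun.span {\<omega> p} \<subseteq> {\<phi>. fiber.vacuum p \<phi>}"
    using V(7)[OF V(3)] by (intro cfun.span_minimal) auto
  ultimately show "spin_eigenbundle J (int n) p \<subseteq> canonical_bundle J p"
    by (simp add: canonical_bundle_eq)
  show "canonical_bundle J p \<subseteq> spin_eigenbundle J (int n) p"
    unfolding canonical_bundle_eq spin_eigenbundle_eq
    using fiber.spin_vacuum by (auto simp: fiber.vacuum_def dim)
qed

lemma direct_sum_spin_eigenbundle:
  "is_direct_sum {\<phi>. is_form \<phi>} {- int n..int n} (\<lambda>k. spin_eigenbundle J k p)"
  unfolding is_direct_sum_def
proof (intro conjI ballI)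
  fix k show "complex_subspace (spin_eigenbundle J k p)" by (rule subspace_spin_eigenbundle)
  show "spin_eigenbundle J k p \<subseteq> {\<phi>. is_form \<phi>}" by (auto simp: spin_eigenbundle_def)
next
  fix \<phi> :: "('m, complex) form" assume "\<phi> \<in> {\<phi>. is_form \<phi>}"
  then have \<phi>: "is_form \<phi>" by simp
  let ?I = "{- int n..int n}" and ?U = "\<lambda>k. spin_eigenbundle J k p"
  have sm: "(\<forall>b. \<phi> b = (\<Sum>k\<in>?I. \<psi> k b)) \<longleftrightarrow> \<phi> = (\<Sum>k\<in>?I. \<psi> k)" for \<psi>
    by (simp add: fun_eq_iff sum_fun_apply)
  have z: "(\<lambda>_. 0 :: complex) = 0" by (simp add: fun_eq_iff)
  obtain ss V \<omega> where V: "length ss = CARD('m)" "open V" "p \<in> V" "\<And>s. s \<in> set ss \<Longrightarrow> smooth_sect \<A> V s"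
    "\<And>q. q \<in> V \<Longrightarrow> span (set (map (\<lambda>s. s q) ss) \<union> J q ` set (map (\<lambda>s. s q) ss)) = UNIV"
    "smooth_form \<A> V \<omega>" "\<And>q. q \<in> V \<Longrightarrow> fiber.vacuum q (\<omega> q)" "\<And>q. q \<in> V \<Longrightarrow> \<omega> q \<noteq> 0"
    by (rule local_vacuum[of p]) blast
  obtain f where f: "\<And>k. f k \<in> cfun.span (set (frame (J p) (map (\<lambda>s. s p) ss) (\<omega> p) k))"
    "\<phi> = (\<Sum>k\<le>length (map (\<lambda>s. s p) ss). f k)"
    using fiber.frame_decomposition[OF V(7,8,5)[OF V(3)] \<phi>] by blast
  \<comment> \<open>Products with \<open>j\<close> factors belong to degree \<open>n - j\<close>;
    components outside the range are zero, as \<open>is_direct_sum\<close> prescribes.\<close>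
  define \<psi> where "\<psi> = (\<lambda>k. if k \<in> ?I then f (nat (int n - k)) else 0)"
  have mem: "\<psi> k \<in> ?U k" if "k \<in> ?I" for k
    using that f(1) spin_eigenbundle_frame[OF V(7,8,5)[OF V(3)] _ that] by (simp add: \<psi>_def V(1))
  have "(\<Sum>k\<in>?I. \<psi> k) = (\<Sum>k\<le>2 * n. f k)"
    by (rule sum.reindex_bij_witness[of _ "\<lambda>k. int n - int k" "\<lambda>k. nat (int n - k)"]) (auto simp: \<psi>_def)
  then have s: "\<phi> = (\<Sum>k\<in>?I. \<psi> k)" using f(2) by (simp add: V(1) dim)
  show "\<exists>!\<psi>. (\<forall>k\<in>?I. \<psi> k \<in> ?U k) \<and> (\<forall>k. k \<notin> ?I \<longrightarrow> \<psi> k = (\<lambda>_. 0)) \<and> (\<forall>b. \<phi> b = (\<Sum>k\<in>?I. \<psi> k b))"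
    unfolding sm z
  proof (rule ex1I[of _ \<psi>])
    show "(\<forall>k\<in>?I. \<psi> k \<in> ?U k) \<and> (\<forall>k. k \<notin> ?I \<longrightarrow> \<psi> k = 0) \<and> \<phi> = (\<Sum>k\<in>?I. \<psi> k)"
      using mem s by (auto simp: \<psi>_def)
    fix \<theta> assume t: "(\<forall>k\<in>?I. \<theta> k \<in> ?U k) \<and> (\<forall>k. k \<notin> ?I \<longrightarrow> \<theta> k = 0) \<and> \<phi> = (\<Sum>k\<in>?I. \<theta> k)"
    \<comment> \<open>Two decompositions differ by eigenvectors for distinct eigenvalues that sum to
      zero.\<close>
    have 0: "(\<Sum>k\<in>?I. \<theta> k - \<psi> k) = 0"
      unfolding sum_subtractf using t s by (metis cancel_comm_monoid_add_class.diff_cancel)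
    have e: "spin (J p) (\<theta> k - \<psi> k) = sc (\<i> * of_int k) (\<theta> k - \<psi> k)" if "k \<in> ?I" for k
      using t mem that unfolding spin_eigenbundle_eq
      by (simp add: clinear_simps[OF clinear_spin] cfun.scale_right_diff_distrib)
    have d: "\<theta> k - \<psi> k = 0" if "k \<in> ?I" for k
      by (rule eigenvectors_independent[where T = "spin (J p)" and I = ?I and \<psi> = "\<lambda>k. \<theta> k - \<psi> k"
          and \<mu> = "\<lambda>k. \<i> * of_int k", OF clinear_spin _ e _ 0 that]) (auto simp: inj_on_def)
    have "\<theta> k = \<psi> k" for k
    proof (cases "k \<in> ?I")
      case True
      then show ?thesis using d by (metis right_minus_eq)
    next
      case False
      then have "\<theta> k = 0" using t by blast
      moreover have "\<psi> k = 0" unfolding \<psi>_def using False by (rule if_not_P)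
      ultimately show ?thesis by (rule trans[OF _ sym])
    qed
    then show "\<theta> = \<psi>" by (rule ext)
  qed
qed

end

end

theorem proposition3p9:
  fixes \<A> :: "('a::{t2_space, second_countable_topology}, 'm::finite) chart set"
    and H :: "'a \<Rightarrow> ('m, real) form"
    and J :: "'a \<Rightarrow> (real, 'm) TT \<Rightarrow> (real, 'm) TT"
    and n :: nat
  assumes "smooth_atlas \<A>"
    and "CARD('m) = 2 * n"
    and "closed_real_3form \<A> H"
    and "generalized_complex_structure \<A> H J"
  shows "(\<forall>p. is_direct_sum {\<phi>. is_form \<phi>} {- int n..int n} (\<lambda>k. spin_eigenbundle J k p)) \<and>
    (\<forall>k\<in>{- int n..int n}. \<exists>r. smooth_subbundle \<A> r (spin_eigenbundle J k)) \<and>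
    (\<forall>p. spin_eigenbundle J (int n) p = canonical_bundle J p) \<and>
    smooth_subbundle \<A> 1 (canonical_bundle J)"
proof -
  interpret gen_complex_manifold \<A> H J
    using assms by unfold_locales (auto simp: closed_real_3form_def)
  \<comment> \<open>For \<open>k = n\<close> the rank is CARD('m) choose 0, which is 1.\<close>
  have "smooth_subbundle \<A> 1 (spin_eigenbundle J (int n))"
    using smooth_subbundle_spin_eigenbundle[OF assms(2), of "int n"] by simp
  moreover have "spin_eigenbundle J (int n) = canonical_bundle J"
    by (rule ext) (rule spin_eigenbundle_eq_canonical[OF assms(2)])
  ultimately show ?thesis
    using direct_sum_spin_eigenbundle[OF assms(2)] smooth_subbundle_spin_eigenbundle[OF assms(2)] by metis
qed

end
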